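(* Let $\alpha\in\mathbb{R}$ and $Q\in\mathcal{Q}$. As $\varepsilon\to0$ ($\varepsilon>0$), the operator family $\mathrm{H}_\varepsilon(\alpha,Q)$ converges in the norm resolvent sense to $\mathrm{H}(\alpha,Q)$. Moreover, for each fixed $\zeta\in\mathbb{C}\setminus\mathbb{R}$ there exists a constant $C$ (independent of $\varepsilon$) such that $$\|(\mathrm{H}_\varepsilon(\alpha,Q)-\zeta)^{-1}-(\mathrm{H}(\alpha,Q)-\zeta)^{-1}\|_{B(\mathscr{L}_2(\Gamma))}\leq C\varepsilon^{1/2}$$ for every $\varepsilon\in(0,1)$, where $\|\cdot\|_{B(\mathscr{L}_2(\Gamma))}$ is the operator norm on bounded operators in $\mathscr{L}_2(\Gamma)$.
   Context: Graph. $\Gamma$ is the noncompact star metric graph with three edges $\gamma_1,\gamma_2,\gamma_3$, each a half-line, joined at the single vertex $a$. Each $\gamma_n$ is identified with $[0,\infty)$ by the distance from $a$. $\Omega\subset\Gamma$ is the compact star graph of points at distance at most $1$ from $a$; its edges are $\omega_n\subset\gamma_n$ of length $1$ ($n=1,2,3$), and $a_n$ is the endpoint of $\omega_n$ at distance $1$ from $a$. For $x\in\gamma_n$ and $\varepsilon>0$, $\varepsilon^{-1}x$ is the point of $\gamma_n$ at distance $\varepsilon^{-1}|x|$ from $a$. Functions. For a graph $G$ (here $\Gamma$ or $\Omega$), $f_g$ denotes the restriction of $f$ to the edge $g$; differentiation is with respect to the natural (arclength) parameter; $\frac{\mathrm{d}f}{\mathrm{d}g}(b)$ is the limit value at the vertex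 $b$ of the derivative along $g$ taken in the direction away from $b$. The integral over $G$ is the sum of the integrals over the edges. $\mathscr{L}_2(G)$ is the Hilbert space of (complex-valued) functions with inner product $(f,h)=\int_G f\bar h\,\mathrm{d}G$; $\mathscr{C}^\infty(G)$ is the set of $f$ with $f_g\in C^\infty(\bar g)$ for each edge $g$; $\mathscr{W}_2^2(G)$ is the set of $f\in\mathscr{L}_2(G)$ with $f_g\in W_2^2(g)$ for each edge $g$. We write $f\in\mathcal{K}(G;a)$ (Kirchhoff conditions at $a$) if $f$ is continuous at $a$ and $\sum\frac{\mathrm{d}f}{\mathrm{d}g}(a)=0$, the sum being over all edges $g$ adjacent to $a$. Potentials. $\mathcal{Q}$ is the set of real-valued $Q\in\mathscr{C}^\infty(\Gamma)$ with $\mathrm{supp}\,Q=\Omega$ and $\int_\Omega Q\,\mathrm{d}\Omega=0$. Operators $\mathrm{H}_\varepsilon(\alpha,Q)$. For $\varepsilon>0$, $$\mathrm{H}_\varepsilon(\alpha,Q)=-\frac{\mathrm{d}^2}{\mathrm{d}x^2}+\alpha\varepsilon^{-2}Q(\varepsilon^{-1}x),\qquad \mathrm{dom}\,\mathrm{H}_\varepsilon(\alpha,Q)=\mathscr{W}_2^2(\Gamma)\cap\mathcal{K}(\Gamma;a).$$ Resonant problem. Consider $$-f''+\alpha Qf=0\ \text{ on }\Omega,\qquad f\in\mathcal{K}(\Omega;a),\qquad \frac{\mathrm{d}f}{\mathrm{d}\omega_1}(a_1)=\frac{\mathrm{d}f}{\mathrm{d}\omega_2}(a_2)=\frac{\mathrm{d}f}{\mathrm{d}\omega_3}(a_3)=0.\qquad(\ast)$$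 $\alpha$ is called an eigenvalue of $(\ast)$ if $(\ast)$ has a nontrivial solution; it is simple or double according to whether the solution space has dimension $1$ or $2$ (these are the only possibilities). Limit operator $\mathrm{H}(\alpha,Q)$. It acts by $\mathrm{H}(\alpha,Q)f=-f''$ on the domain of all $f\in\mathscr{W}_2^2(\Gamma)$ satisfying the following conditions at $a$. (i) Non-resonant case ($\alpha$ is not an eigenvalue of $(\ast)$): $f_{\gamma_1}(a)=f_{\gamma_2}(a)=f_{\gamma_3}(a)=0$. (ii) Simple resonant case ($\alpha$ is a simple eigenvalue with eigenfunction $\phi_\alpha$): put $\theta_n=\phi_\alpha(a_n)$, $n=1,2,3$; the conditions are $$\frac{f_{\gamma_1}(a)}{\theta_1}=\frac{f_{\gamma_2}(a)}{\theta_2}=\frac{f_{\gamma_3}(a)}{\theta_3},\qquad \sum_{n=1}^3\theta_n\frac{\mathrm{d}f}{\mathrm{d}\gamma_n}(a)=0.$$ (iii) Double resonant case ($\alpha$ is a double eigenvalue and $\varphi_\alpha,\psi_\alpha$ form a basis of the solution space): $(\theta_1,\theta_2,\theta_3)$ is the vector product of $(\varphi_\alpha(a_1),\varphi_\alpha(a_2),\varphi_\alpha(a_3))$ and $(\psi_\alpha(a_1),\psi_\alpha(a_2),\psi_\alpha(a_3))$; the conditions are $$\frac{1}{\theta_1}\frac{\mathrm{d}f}{\mathrm{d}\gamma_1}(a)=\frac{1}{\theta_2}\frac{\mathrm{d}f}{\mathrm{d}\gamma_2}(a)=\frac{1}{\theta_3}\frac{\mathrm{d}f}{\mathrm{d}\gamma_3}(a),\qquad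 \sum_{n=1}^3\theta_nf_{\gamma_n}(a)=0.$$ The chains of equal ratios in (ii) and (iii) mean that the vector of numerators (the values $f_{\gamma_n}(a)$ in (ii), the derivatives $\frac{\mathrm{d}f}{\mathrm{d}\gamma_n}(a)$ in (iii)) is a scalar multiple of $(\theta_1,\theta_2,\theta_3)$; in particular a numerator vanishes when the corresponding $\theta_n=0$. *)

theory Defs
  imports "HOL-Analysis.Analysis" "HOL-Library.Function_Algebras"
begin

text \<open>
  A function on the star graph with three half-lines is a map \<^typ>\<open>3 \<Rightarrow> real \<Rightarrow> 'a\<close>: edge \<open>n\<close>
  and distance \<open>t \<ge> 0\<close> from the vertex. Values at \<open>t < 0\<close> are never used. The
  values \<open>f n 0\<close> are the edgewise boundary values at the vertex and may differ for different \<open>n\<close>.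
\<close>

type_synonym 'a star_fun = "3 \<Rightarrow> real \<Rightarrow> 'a"

definition half_line :: "real measure" where
  "half_line = restrict_space lborel {0..}"


definition L2_half :: "(real \<Rightarrow> complex) set" where
  "L2_half = {u. u \<in> borel_measurable half_line \<and> integrable half_line (\<lambda>t. (cmod (u t))\<^sup>2)}"

definition star_eq :: "complex star_fun \<Rightarrow> complex star_fun \<Rightarrow> bool" where
  "star_eq f g \<longleftrightarrow> (\<forall>n. f n \<in> L2_half \<and> g n \<in> L2_half \<and> (AE t in half_line. f n t = g n t))"

lemma L2_half_meas [measurable_dest]: "u \<in> L2_half \<Longrightarrow> u \<in> borel_measurable half_line"
  by (simp add: L2_half_def)

lemma L2_half_int: "u \<in> L2_half \<Longrightarrow> integrable half_line (\<lambda>t. (cmod (u t))\<^sup>2)"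
  by (simp add: L2_half_def)

lemma L2_half_zero: "(\<lambda>t. 0) \<in> L2_half"
  by (simp add: L2_half_def)

lemma L2_half_scale:
  assumes "u \<in> L2_half" shows "(\<lambda>t. c * u t) \<in> L2_half"
  using assms by (auto simp: L2_half_def norm_mult power_mult_distrib)

lemma L2_half_add:
  assumes u: "u \<in> L2_half" and v: "v \<in> L2_half" shows "(\<lambda>t. u t + v t) \<in> L2_half"
proof -
  have m: "(\<lambda>t. u t + v t) \<in> borel_measurable half_line"
    using L2_half_meas[OF u] L2_half_meas[OF v] by measurable
  have le: "(cmod (a + b))\<^sup>2 \<le> 2 * (cmod a)\<^sup>2 + 2 * (cmod b)\<^sup>2" for a b :: complex
  proof -
    have "(cmod (a + b))\<^sup>2 \<le> (cmod a + cmod b)\<^sup>2"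
      by (intro power_mono norm_triangle_ineq) auto
    also have "\<dots> \<le> 2 * (cmod a)\<^sup>2 + 2 * (cmod b)\<^sup>2"
      using sum_squares_bound[of "cmod a" "cmod b"] by (simp add: power2_sum)
    finally show ?thesis .
  qed
  have "integrable half_line (\<lambda>t. (cmod (u t + v t))\<^sup>2)"
  proof (rule Bochner_Integration.integrable_bound)
    show "integrable half_line (\<lambda>t. 2 * (cmod (u t))\<^sup>2 + 2 * (cmod (v t))\<^sup>2)"
      using L2_half_int[OF u] L2_half_int[OF v] by auto
    show "(\<lambda>t. (cmod (u t + v t))\<^sup>2) \<in> borel_measurable half_line"
      using m by measurable
    show "AE t in half_line. norm ((cmod (u t + v t))\<^sup>2) \<le> norm (2 * (cmod (u t))\<^sup>2 + 2 * (cmod (v t))\<^sup>2)"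
    proof (rule AE_I2)
      fix t
      show "norm ((cmod (u t + v t))\<^sup>2) \<le> norm (2 * (cmod (u t))\<^sup>2 + 2 * (cmod (v t))\<^sup>2)"
        using le[of "u t" "v t"] by simp
    qed
  qed
  with m show ?thesis by (simp add: L2_half_def)
qed

lemma L2_half_mult_cnj:
  assumes u: "u \<in> L2_half" and v: "v \<in> L2_half"
  shows "integrable half_line (\<lambda>t. u t * cnj (v t))"
proof (rule Bochner_Integration.integrable_bound)
  show "integrable half_line (\<lambda>t. (cmod (u t))\<^sup>2 + (cmod (v t))\<^sup>2)"
    using L2_half_int[OF u] L2_half_int[OF v] by auto
  show "(\<lambda>t. u t * cnj (v t)) \<in> borel_measurable half_line"
    using L2_half_meas[OF u] L2_half_meas[OF v] by (auto intro!: borel_measurable_times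
      measurable_compose[OF _ borel_measurable_continuous_onI[OF continuous_on_cnj[OF continuous_on_id]]])
  have "norm (a * cnj b) \<le> norm ((cmod a)\<^sup>2 + (cmod b)\<^sup>2)" for a b :: complex
  proof -
    have "0 \<le> cmod a * cmod b" by simp
    moreover have "2 * (cmod a * cmod b) \<le> (cmod a)\<^sup>2 + (cmod b)\<^sup>2"
      using sum_squares_bound[of "cmod a" "cmod b"] by simp
    ultimately have "cmod a * cmod b \<le> (cmod a)\<^sup>2 + (cmod b)\<^sup>2" by linarith
    then show ?thesis by (simp add: norm_mult)
  qed
  then show "AE t in half_line. norm (u t * cnj (v t)) \<le> norm ((cmod (u t))\<^sup>2 + (cmod (v t))\<^sup>2)"
    by simp
qed

lemma star_eq_refl: "(\<And>n. f n \<in> L2_half) \<Longrightarrow> star_eq f f"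
  by (simp add: star_eq_def)

lemma star_eq_part_equivp: "part_equivp star_eq"
proof (rule part_equivpI)
  show "\<exists>f. star_eq f f"
    using L2_half_zero by (intro exI[of _ "\<lambda>n t. 0"]) (simp add: star_eq_def)
  show "symp star_eq"
    by (rule sympI) (simp add: star_eq_def eq_commute)
  show "transp star_eq"
  proof (rule transpI)
    fix f g h assume A: "star_eq f g" "star_eq g h"
    have "AE t in half_line. f n t = h n t" for n
    proof -
      have "AE t in half_line. f n t = g n t" "AE t in half_line. g n t = h n t"
        using A by (auto simp: star_eq_def)
      then show ?thesis by eventually_elim simp
    qed
    with A show "star_eq f h" by (simp add: star_eq_def)
  qed
qed

quotient_type star_L2 = "complex star_fun" / partial: star_eq
  by (rule star_eq_part_equivp)

text \<open>The class \<^class>\<open>real_inner\<close> is instantiated with the real part of the complex inner product;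
  both induce the same norm, and the operator norm of a complex linear operator is \<^const>\<open>onorm\<close>.\<close>

lift_definition cinner_L2 :: "star_L2 \<Rightarrow> star_L2 \<Rightarrow> complex"
  is "\<lambda>f h. \<Sum>n\<in>UNIV. LINT t|half_line. f n t * cnj (h n t)"
proof -
  fix f f' h h' :: "complex star_fun"
  assume A: "star_eq f f'" "star_eq h h'"
  show "(\<Sum>n\<in>UNIV. LINT t|half_line. f n t * cnj (h n t)) =
        (\<Sum>n\<in>UNIV. LINT t|half_line. f' n t * cnj (h' n t))"
  proof (intro sum.cong refl integral_cong_AE)
    fix n
    show "(\<lambda>t. f n t * cnj (h n t)) \<in> borel_measurable half_line"
      "(\<lambda>t. f' n t * cnj (h' n t)) \<in> borel_measurable half_line"
      using A by (auto simp: star_eq_def intro!: borel_measurable_integrable L2_half_mult_cnj)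
    have "AE t in half_line. f n t = f' n t" "AE t in half_line. h n t = h' n t"
      using A by (auto simp: star_eq_def)
    then show "AE t in half_line. f n t * cnj (h n t) = f' n t * cnj (h' n t)"
      by eventually_elim simp
  qed
qed

lift_definition scaleC_L2 :: "complex \<Rightarrow> star_L2 \<Rightarrow> star_L2"
  is "\<lambda>c f n t. c * f n t"
  by (auto simp: star_eq_def intro: L2_half_scale)

instantiation star_L2 :: real_inner
begin

lift_definition zero_star_L2 :: star_L2 is "\<lambda>n t. 0"
  by (simp add: star_eq_def L2_half_zero)

lift_definition plus_star_L2 :: "star_L2 \<Rightarrow> star_L2 \<Rightarrow> star_L2" is "\<lambda>f g n t. f n t + g n t"
proof -
  fix f f' g g' :: "complex star_fun"
  assume A: "star_eq f f'" "star_eq g g'"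
  have "AE t in half_line. f n t + g n t = f' n t + g' n t" for n
  proof -
    have "AE t in half_line. f n t = f' n t" "AE t in half_line. g n t = g' n t"
      using A by (auto simp: star_eq_def)
    then show ?thesis by eventually_elim simp
  qed
  with A show "star_eq (\<lambda>n t. f n t + g n t) (\<lambda>n t. f' n t + g' n t)"
    by (auto simp: star_eq_def intro: L2_half_add)
qed

definition uminus_star_L2 :: "star_L2 \<Rightarrow> star_L2" where "uminus_star_L2 f = scaleC_L2 (-1) f"
definition minus_star_L2 :: "star_L2 \<Rightarrow> star_L2 \<Rightarrow> star_L2" where "minus_star_L2 f g = f + scaleC_L2 (-1) g"
definition scaleR_star_L2 :: "real \<Rightarrow> star_L2 \<Rightarrow> star_L2" where "scaleR_star_L2 r f = scaleC_L2 (of_real r) f"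
definition inner_star_L2 :: "star_L2 \<Rightarrow> star_L2 \<Rightarrow> real" where "inner_star_L2 f g = Re (cinner_L2 f g)"
definition norm_star_L2 :: "star_L2 \<Rightarrow> real" where "norm_star_L2 f = sqrt (inner f f)"
definition sgn_star_L2 :: "star_L2 \<Rightarrow> star_L2" where "sgn_star_L2 f = inverse (norm f) *\<^sub>R f"
definition dist_star_L2 :: "star_L2 \<Rightarrow> star_L2 \<Rightarrow> real" where "dist_star_L2 f g = norm (f - g)"
definition uniformity_star_L2 :: "(star_L2 \<times> star_L2) filter" where
  "uniformity_star_L2 = (INF e\<in>{0<..}. principal {(x, y). dist x y < e})"
definition open_star_L2 :: "star_L2 set \<Rightarrow> bool" where
  "open_star_L2 U \<longleftrightarrow> (\<forall>x\<in>U. eventually (\<lambda>(x', y). x' = x \<longrightarrow> y \<in> U) uniformity)"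

instance
proof
  show "a + b + c = a + (b + c)" for a b c :: star_L2
    by transfer (auto simp: add.assoc star_eq_def intro!: L2_half_add)
  show "a + b = b + a" for a b :: star_L2
    by transfer (auto simp: add.commute star_eq_def intro!: L2_half_add)
  show "0 + a = a" for a :: star_L2
    by transfer (auto simp: star_eq_def)
  show "- a + a = 0" for a :: star_L2
    unfolding uminus_star_L2_def by transfer (auto simp: star_eq_def L2_half_zero)
  show "a - b = a + - b" for a b :: star_L2
    by (simp add: minus_star_L2_def uminus_star_L2_def)
  show "r *\<^sub>R (x + y) = r *\<^sub>R x + r *\<^sub>R y" for r and x y :: star_L2
    unfolding scaleR_star_L2_def
    by transfer (auto simp: star_eq_def distrib_left intro!: L2_half_add L2_half_scale)
  show "(r + s) *\<^sub>R x = r *\<^sub>R x + s *\<^sub>R x" for r s and x :: star_L2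
    unfolding scaleR_star_L2_def
    by transfer (auto simp: star_eq_def distrib_right intro!: L2_half_add L2_half_scale)
  show "r *\<^sub>R s *\<^sub>R x = (r * s) *\<^sub>R x" for r s and x :: star_L2
    unfolding scaleR_star_L2_def
    by transfer (auto simp: star_eq_def mult.assoc intro!: L2_half_scale)
  show "1 *\<^sub>R x = x" for x :: star_L2
    unfolding scaleR_star_L2_def by transfer (auto simp: star_eq_def)
  show "sgn x = inverse (norm x) *\<^sub>R x" for x :: star_L2 by (simp add: sgn_star_L2_def)
  show "dist x y = norm (x - y)" for x y :: star_L2 by (simp add: dist_star_L2_def)
  show "uniformity = (INF e\<in>{0<..}. principal {(x :: star_L2, y). dist x y < e})"
    by (rule uniformity_star_L2_def)
  show "open U \<longleftrightarrow> (\<forall>x\<in>U. eventually (\<lambda>(x', y). x' = x \<longrightarrow> y \<in> U) uniformity)" for U :: "star_L2 set"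
    by (rule open_star_L2_def)
  show "norm x = sqrt (x \<bullet> x)" for x :: star_L2 by (rule norm_star_L2_def)
  have sym: "cinner_L2 x y = cnj (cinner_L2 y x)" for x y :: star_L2
    by transfer (simp flip: Bochner_Integration.integral_cnj add: mult.commute)
  show "x \<bullet> y = y \<bullet> x" for x y :: star_L2
    using sym[of x y] by (simp add: inner_star_L2_def)
  have add: "cinner_L2 (x + y) z = cinner_L2 x z + cinner_L2 y z" for x y z :: star_L2
    by transfer (simp add: star_eq_def distrib_right L2_half_mult_cnj
        Bochner_Integration.integral_add sum.distrib)
  show "(x + y) \<bullet> z = x \<bullet> z + y \<bullet> z" for x y z :: star_L2
    by (simp add: inner_star_L2_def add)
  have scale: "cinner_L2 (scaleC_L2 c x) y = c * cinner_L2 x y" for c and x y :: star_L2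
    by transfer (simp add: mult.assoc sum_distrib_left)
  show "(r *\<^sub>R x) \<bullet> y = r * (x \<bullet> y)" for r and x y :: star_L2
    by (simp add: inner_star_L2_def scaleR_star_L2_def scale)
  have eq: "Re (\<Sum>n\<in>UNIV. LINT t|half_line. f n t * cnj (f n t)) =
      (\<Sum>n\<in>UNIV. LINT t|half_line. (cmod (f n t))\<^sup>2)" if "star_eq f f" for f
  proof -
    have "Re (LINT t|half_line. f n t * cnj (f n t)) = (LINT t|half_line. (cmod (f n t))\<^sup>2)" for n
    proof -
      have "f n t * cnj (f n t) = complex_of_real ((cmod (f n t))\<^sup>2)" for t
        using complex_norm_square[of "f n t"] by (simp only: of_real_power)
      then show ?thesis by (simp only: integral_complex_of_real Re_complex_of_real)
    qed
    then show ?thesis by simp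
  qed
  show "0 \<le> x \<bullet> x" for x :: star_L2
    unfolding inner_star_L2_def
  proof transfer
    fix f assume f: "star_eq f f"
    show "0 \<le> Re (\<Sum>n\<in>UNIV. LINT t|half_line. f n t * cnj (f n t))"
      unfolding eq[OF f] by (intro sum_nonneg integral_nonneg_AE) auto
  qed
  show "x \<bullet> x = 0 \<longleftrightarrow> x = 0" for x :: star_L2
    unfolding inner_star_L2_def
  proof transfer
    fix f assume f: "star_eq f f"
    have "(LINT t|half_line. (cmod (f n t))\<^sup>2) = 0 \<longleftrightarrow> (AE t in half_line. f n t = 0)" for n
      using f L2_half_int[of "f n"] by (subst integral_nonneg_eq_0_iff_AE) (auto simp: star_eq_def)
    then show "Re (\<Sum>n\<in>UNIV. LINT t|half_line. f n t * cnj (f n t)) = 0 \<longleftrightarrow> star_eq f (\<lambda>n t. 0)"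
      unfolding eq[OF f] using f
      by (subst sum_nonneg_eq_0_iff) (auto simp: star_eq_def L2_half_zero)
  qed
qed

end


text \<open>One-sided derivatives at boundary points of \<open>S\<close>, so this is smoothness up to the boundary.\<close>

definition smooth_on :: "real set \<Rightarrow> (real \<Rightarrow> 'a::real_normed_vector) \<Rightarrow> bool" where
  "smooth_on S f \<longleftrightarrow> (\<exists>D :: nat \<Rightarrow> real \<Rightarrow> 'a. D 0 = f \<and>
     (\<forall>k. \<forall>t\<in>S. (D k has_vector_derivative D (Suc k) t) (at t within S)))"

definition test_functions :: "(real \<Rightarrow> real) set" where
  "test_functions = {\<eta>. smooth_on UNIV \<eta> \<and> (\<exists>a b. 0 < a \<and> (\<forall>t. t \<notin> {a..b} \<longrightarrow> \<eta> t = 0))}"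

definition weak_deriv :: "(real \<Rightarrow> complex) \<Rightarrow> (real \<Rightarrow> complex) \<Rightarrow> bool" where
  "weak_deriv u v \<longleftrightarrow> (\<forall>\<eta>\<in>test_functions.
     (LINT t|half_line. deriv \<eta> t *\<^sub>R u t) = - (LINT t|half_line. \<eta> t *\<^sub>R v t))"

text \<open>\<open>u\<close> lies in \<open>W\<^sub>2\<^sup>2(0,\<infinity>)\<close> with weak derivatives \<open>u' = v\<close> and \<open>u'' = w\<close>.\<close>

definition W22_derivs :: "(real \<Rightarrow> complex) \<Rightarrow> (real \<Rightarrow> complex) \<Rightarrow> (real \<Rightarrow> complex) \<Rightarrow> bool" where
  "W22_derivs u v w \<longleftrightarrow> u \<in> L2_half \<and> v \<in> L2_half \<and> w \<in> L2_half \<and> weak_deriv u v \<and> weak_deriv v w"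

text \<open>Every class in \<open>W\<^sub>2\<^sup>2\<close> has exactly one representative that is continuous on the closed edges, and
  it is continuously differentiable; vertex values and derivatives are those of this representative.\<close>

definition regular_rep :: "complex star_fun \<Rightarrow> bool" where
  "regular_rep f \<longleftrightarrow> (\<forall>n. continuous_on {0..} (f n) \<and> f n C1_differentiable_on {0<..})"

definition vertex_deriv :: "complex star_fun \<Rightarrow> 3 \<Rightarrow> complex" where
  "vertex_deriv f n = Lim (at_right 0) (\<lambda>t. vector_derivative (f n) (at t))"

definition kirchhoff :: "complex star_fun \<Rightarrow> bool" where
  "kirchhoff f \<longleftrightarrow> (\<exists>c. \<forall>n. f n 0 = c \<and> (f n \<longlongrightarrow> c) (at_right 0)) \<and>
     (\<Sum>n\<in>UNIV. vertex_deriv f n) = 0"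


text \<open>Unbounded operators are given by their graphs, so \<open>(T - \<zeta>) F = G\<close> reads \<open>(F, G + \<zeta> F) \<in> T\<close>.
  The resolvents of the complex linear operators below are complex linear by construction, hence
  only boundedness and real linearity are required in \<open>resolvent_set\<close>.\<close>

type_synonym star_op = "(star_L2 \<times> star_L2) set"

definition resolvent :: "star_op \<Rightarrow> complex \<Rightarrow> star_L2 \<Rightarrow> star_L2" where
  "resolvent T \<zeta> G = (THE F. (F, G + scaleC_L2 \<zeta> F) \<in> T)"

definition resolvent_set :: "star_op \<Rightarrow> complex set" where
  "resolvent_set T = {\<zeta>. (\<forall>G. \<exists>!F. (F, G + scaleC_L2 \<zeta> F) \<in> T) \<and> bounded_linear (resolvent T \<zeta>)}"

definition norm_resolvent_converges :: "(real \<Rightarrow> star_op) \<Rightarrow> star_op \<Rightarrow> real filter \<Rightarrow> bool" where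
  "norm_resolvent_converges T S \<F> \<longleftrightarrow> (\<forall>\<zeta>. \<zeta> \<notin> \<real> \<longrightarrow>
     \<zeta> \<in> resolvent_set S \<and> (\<forall>\<^sub>F \<epsilon> in \<F>. \<zeta> \<in> resolvent_set (T \<epsilon>)) \<and>
     ((\<lambda>\<epsilon>. onorm (\<lambda>G. resolvent (T \<epsilon>) \<zeta> G - resolvent S \<zeta> G)) \<longlongrightarrow> 0) \<F>)"

definition schroedinger_op :: "real star_fun \<Rightarrow> (complex star_fun \<Rightarrow> bool) \<Rightarrow> star_op" where
  "schroedinger_op V bc = {(F, G). \<exists>f w.
     (\<forall>n. \<exists>v. W22_derivs (f n) v (w n)) \<and> regular_rep f \<and> bc f \<and>
     F = abs_star_L2 f \<and> G = abs_star_L2 (\<lambda>n t. - w n t + of_real (V n t) * f n t)}"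


text \<open>The support equals \<open>\<Omega>\<close>; taking closures edge by edge is equivalent to taking the closure in
  the graph, since each edge meets the other edges only in the vertex, which lies in every \<open>\<omega>\<^sub>n\<close>.\<close>

definition potentials :: "real star_fun set" where
  "potentials = {Q. (\<forall>n. smooth_on {0..} (Q n)) \<and>
     (\<forall>n. closure {t. 0 \<le> t \<and> Q n t \<noteq> 0} = {0..1}) \<and>
     (\<Sum>n\<in>UNIV. LINT t:{0..1}|lborel. Q n t) = 0}"

definition H_eps :: "real \<Rightarrow> real star_fun \<Rightarrow> real \<Rightarrow> star_op" where
  "H_eps \<alpha> Q \<epsilon> = schroedinger_op (\<lambda>n t. \<alpha> / \<epsilon>\<^sup>2 * Q n (t / \<epsilon>)) kirchhoff"

text \<open>Derivative at \<open>a\<^sub>n\<close> along \<open>\<omega>\<^sub>n\<close> in the direction away from \<open>a\<^sub>n\<close>, hence the sign.\<close>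

definition end_deriv :: "complex star_fun \<Rightarrow> 3 \<Rightarrow> complex" where
  "end_deriv f n = Lim (at_left 1) (\<lambda>t. - vector_derivative (f n) (at t))"

text \<open>Functions on \<open>\<Omega>\<close> are represented by their extension by \<open>0\<close>, so that the complex dimension of
  the solution space is meaningful.\<close>

definition resonant_solutions :: "real \<Rightarrow> real star_fun \<Rightarrow> complex star_fun set" where
  "resonant_solutions \<alpha> Q = {f.
     (\<forall>n t. t \<notin> {0..1} \<longrightarrow> f n t = 0) \<and>
     (\<forall>n. \<exists>f' f''. \<forall>t\<in>{0..1}.
        (f n has_vector_derivative f' t) (at t within {0..1}) \<and>
        (f' has_vector_derivative f'' t) (at t within {0..1}) \<and>
        - f'' t + of_real (\<alpha> * Q n t) * f n t = 0) \<and>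
     kirchhoff f \<and> (\<forall>n. end_deriv f n = 0)}"

definition star_scale :: "complex \<Rightarrow> complex star_fun \<Rightarrow> complex star_fun" where
  "star_scale c f = (\<lambda>n t. c * f n t)"

interpretation star_fun: vector_space star_scale
  by unfold_locales (auto simp: star_scale_def fun_eq_iff algebra_simps)

definition resonant_eigenvalue :: "real \<Rightarrow> real star_fun \<Rightarrow> bool" where
  "resonant_eigenvalue \<alpha> Q \<longleftrightarrow> (\<exists>f\<in>resonant_solutions \<alpha> Q. f \<noteq> 0)"

definition simple_eigenvalue :: "real \<Rightarrow> real star_fun \<Rightarrow> bool" where
  "simple_eigenvalue \<alpha> Q \<longleftrightarrow>
     resonant_eigenvalue \<alpha> Q \<and> star_fun.dim (resonant_solutions \<alpha> Q) = 1"

definition double_eigenvalue :: "real \<Rightarrow> real star_fun \<Rightarrow> bool" where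
  "double_eigenvalue \<alpha> Q \<longleftrightarrow>
     resonant_eigenvalue \<alpha> Q \<and> star_fun.dim (resonant_solutions \<alpha> Q) = 2"

definition eigenfunction :: "real \<Rightarrow> real star_fun \<Rightarrow> complex star_fun \<Rightarrow> bool" where
  "eigenfunction \<alpha> Q \<phi> \<longleftrightarrow> \<phi> \<in> resonant_solutions \<alpha> Q \<and> \<phi> \<noteq> 0"

definition eigenbasis :: "real \<Rightarrow> real star_fun \<Rightarrow> complex star_fun \<Rightarrow> complex star_fun \<Rightarrow> bool" where
  "eigenbasis \<alpha> Q \<phi> \<psi> \<longleftrightarrow> \<phi> \<noteq> \<psi> \<and> star_fun.independent {\<phi>, \<psi>} \<and>
     star_fun.span {\<phi>, \<psi>} = resonant_solutions \<alpha> Q"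

definition end_values :: "complex star_fun \<Rightarrow> complex ^ 3" where
  "end_values \<phi> = (\<chi> n. \<phi> n 1)"

definition vector_product :: "complex ^ 3 \<Rightarrow> complex ^ 3 \<Rightarrow> complex ^ 3" where
  "vector_product x y = vector [x$2 * y$3 - x$3 * y$2, x$3 * y$1 - x$1 * y$3, x$1 * y$2 - x$2 * y$1]"

text \<open>The vertex conditions of the limit operator: \<open>\<phi>\<close> is the eigenfunction in the simple case (there
  \<open>\<psi>\<close> is not used), and \<open>\<phi>, \<psi>\<close> form the basis in the double case.
  Chains of equal ratios express proportionality to \<open>\<theta>\<close>.\<close>

definition limit_condition ::
  "real \<Rightarrow> real star_fun \<Rightarrow> complex star_fun \<Rightarrow> complex star_fun \<Rightarrow> complex star_fun \<Rightarrow> bool" where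
  "limit_condition \<alpha> Q \<phi> \<psi> f \<longleftrightarrow>
     (\<not> resonant_eigenvalue \<alpha> Q \<longrightarrow> (\<forall>n. f n 0 = 0)) \<and>
     (simple_eigenvalue \<alpha> Q \<longrightarrow> (let \<theta> = end_values \<phi> in
        (\<exists>c. \<forall>n. f n 0 = c * \<theta>$n) \<and> (\<Sum>n\<in>UNIV. \<theta>$n * vertex_deriv f n) = 0)) \<and>
     (double_eigenvalue \<alpha> Q \<longrightarrow> (let \<theta> = vector_product (end_values \<phi>) (end_values \<psi>) in
        (\<exists>c. \<forall>n. vertex_deriv f n = c * \<theta>$n) \<and> (\<Sum>n\<in>UNIV. \<theta>$n * f n 0) = 0))"

definition H_lim :: "real \<Rightarrow> real star_fun \<Rightarrow> complex star_fun \<Rightarrow> complex star_fun \<Rightarrow> star_op" where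
  "H_lim \<alpha> Q \<phi> \<psi> = schroedinger_op (\<lambda>n t. 0) (limit_condition \<alpha> Q \<phi> \<psi>)"

end

theory Submission
  imports Defs
begin

text \<open>
  All vertex conditions in question have the form \<open>f(a) \<in> N\<close>, \<open>f'(a) \<in> N\<^sup>\<bottom>\<close> with a complex subspace
  \<open>N\<close> of \<open>\<complex>\<^sup>3\<close>: the Kirchhoff conditions with the line spanned by \<open>(1, 1, 1)\<close>, and all three cases of
  the limit operator with the space of end values of the resonant solutions. For a real potential
  supported in \<open>\<Omega>\<close> such an operator satisfies the usual resolvent bound by the energy identity, and the
  resolvent exists because a half-line solution is unique up to one homogeneous solution per edge,
  which leaves an injective, hence bijective, \<open>3 \<times> 3\<close> system.

  Let \<open>u\<close> and \<open>v\<close> be the images of \<open>g\<close> under the resolvents of \<open>H\<^sub>\<epsilon>\<close> and \<open>H\<close>. Beyond distance \<open>\<epsilon>\<close> from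
  the vertex the difference \<open>u - v\<close> solves the free homogeneous equation, so it is a decaying exponential
  determined by its values \<open>W\<close> at distance \<open>\<epsilon>\<close>. On the small star, Green's identity with the rescaled
  zero-energy solutions shows that \<open>u(\<epsilon>)\<close> is within \<open>O(\<epsilon>)\<close> of \<open>N\<close>, and that \<open>u'(\<epsilon>)\<close> is orthogonal to \<open>N\<close>
  up to \<open>O(\<epsilon>\<^sup>1\<^sup>/\<^sup>2)\<close>. Since \<open>v\<close> satisfies both conditions at \<open>0\<close> and \<open>u' - v'\<close> is proportional to \<open>W\<close> at
  distance \<open>\<epsilon>\<close>, it follows that \<open>W = O(\<epsilon>\<^sup>1\<^sup>/\<^sup>2)\<close>.
\<close>

subsection \<open>Square-integrable functions on the half-line\<close>

text \<open>The second derivative of a function in the domain is only square integrable, so no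
  pointwise calculus applies to it. Everything is therefore phrased through \<open>ac\<close>, that
  is, through integrals of the derivative over compact intervals: this survives changes on null
  sets, it is what the weak formulation yields, and it is all that the energy and Green identities
  need.

  The rate has two sources: Cauchy-Schwarz over an interval of length \<epsilon>, applied to g and
  to v'', and the L2 norm over the small star of a difference that is merely bounded there. The
  estimate of W is implicit, because the Cauchy data of u at distance \<epsilon> that enter the
  remainders contain W again. It returns with a factor of order sqrt \<epsilon>, which is absorbed
  for small \<epsilon>; for the remaining \<epsilon> the two resolvent bounds alone suffice, at the
  price of a larger constant.

  The energy identity removes the real potential by taking imaginary parts, so its constants do not
  see the factor 1 / \<epsilon>^2. The spaces N are cut out by real equations and hence closed under
  conjugation, so orthogonality to N may be read with or without conjugation.\<close>

lemma AE_half_line_iff: "(AE t in half_line. P t) \<longleftrightarrow> (AE t in lborel. 0 \<le> t \<longrightarrow> P t)"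
  unfolding half_line_def by (subst AE_restrict_space_iff) auto

lemma AE_half_line_negligibleE:
  assumes "AE t in half_line. P t"
  obtains Z where "negligible Z" "\<And>t. 0 \<le> t \<Longrightarrow> t \<notin> Z \<Longrightarrow> P t"
proof -
  have "AE t in lborel. 0 \<le> t \<longrightarrow> P t"
    using assms by (simp add: AE_half_line_iff)
  then obtain Z where Z: "{t \<in> space lborel. \<not> (0 \<le> t \<longrightarrow> P t)} \<subseteq> Z" "emeasure lborel Z = 0" "Z \<in> sets lborel"
    by (rule AE_E)
  then have "Z \<in> null_sets lborel" by auto
  then have "negligible Z"
    by (simp add: negligible_iff_null_sets null_sets_completionI)
  then show thesis using that[of Z] Z(1) by auto
qed

lemma integrable_half_line_iff:
  fixes f :: "real \<Rightarrow> 'a::{banach,second_countable_topology}"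
  shows "integrable half_line f \<longleftrightarrow> set_integrable lborel {0..} f"
  by (simp add: half_line_def set_integrable_def integrable_restrict_space)

lemma integral_half_line_eq:
  fixes f :: "real \<Rightarrow> 'a::{banach,second_countable_topology}"
  shows "integral\<^sup>L half_line f = (LINT t:{0..}|lborel. f t)"
  by (simp add: half_line_def set_lebesgue_integral_def integral_restrict_space)

lemma has_integral_half_line:
  fixes f :: "real \<Rightarrow> 'a::euclidean_space"
  assumes "integrable half_line f"
  shows "(f has_integral (LINT t|half_line. f t)) {0..}"
  using set_borel_integral_eq_integral[of "{0..}" f] assms
  by (auto simp: integrable_half_line_iff integral_half_line_eq has_integral_iff)

lemma borel_measurable_half_line_iff:
  fixes f :: "real \<Rightarrow> 'a::real_normed_vector"
  shows "f \<in> borel_measurable half_line \<longleftrightarrow> (\<lambda>t. indicator {0..} t *\<^sub>R f t) \<in> borel_measurable lborel"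
  by (simp add: half_line_def borel_measurable_restrict_space_iff)

lemma continuous_measurable_half_line:
  fixes f :: "real \<Rightarrow> 'a::real_normed_vector"
  assumes "continuous_on {0..} f" shows "f \<in> borel_measurable half_line"
proof -
  have "f \<in> borel_measurable (restrict_space borel {0..})"
    using assms by (rule borel_measurable_continuous_on_restrict)
  moreover have "sets half_line = sets (restrict_space borel {0..})"
    unfolding half_line_def by (rule sets_restrict_space_cong) simp
  ultimately show ?thesis using measurable_cong_sets by blast
qed

lemma absolutely_integrable_half_line:
  fixes f :: "real \<Rightarrow> 'a::euclidean_space"
  assumes "integrable half_line f" shows "f absolutely_integrable_on {0..}"
  using assms unfolding integrable_half_line_iff set_integrable_def
  by (subst integrable_completion) auto

definition l2 :: "(real \<Rightarrow> complex) \<Rightarrow> real" where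
  "l2 h = sqrt (LINT t|half_line. (cmod (h t))\<^sup>2)"

lemma l2_nonneg [simp]: "0 \<le> l2 h" by (simp add: l2_def)

lemma l2_sq: "(l2 h)\<^sup>2 = (LINT t|half_line. (cmod (h t))\<^sup>2)"
  by (simp add: l2_def)

lemma L2_half_integrable_interval:
  assumes h: "h \<in> L2_half" and a: "0 \<le> a"
  shows "h absolutely_integrable_on {a..b}"
proof -
  have m: "(\<lambda>t. indicator {a..b} t *\<^sub>R h t) \<in> borel_measurable half_line"
    using L2_half_meas[OF h] by (intro borel_measurable_scaleR)
       (auto simp: half_line_def intro: measurable_restrict_space1)
  have fin: "integrable half_line (\<lambda>t. indicator {a..b} t :: real)"
    unfolding integrable_half_line_iff set_integrable_def
    by (rule Bochner_Integration.integrable_bound[where f="indicator {a..b} :: real \<Rightarrow> real"])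
       (auto simp: indicator_def emeasure_lborel_Icc_eq intro!: integrable_real_indicator)
  have sq: "cmod z \<le> 1 + (cmod z)\<^sup>2" for z :: complex
    using sum_squares_bound[of 1 "cmod z"] by (simp add: power2_eq_square)
       (use norm_ge_zero[of z] in linarith)
  have "integrable half_line (\<lambda>t. indicator {a..b} t *\<^sub>R h t)"
  proof (rule Bochner_Integration.integrable_bound[OF _ m])
    show "integrable half_line (\<lambda>t. indicator {a..b} t + (cmod (h t))\<^sup>2 :: real)"
      using fin L2_half_int[OF h] by simp
    show "AE t in half_line. norm (indicator {a..b} t *\<^sub>R h t) \<le> norm (indicator {a..b} t + (cmod (h t))\<^sup>2 :: real)"
      using sq by (intro AE_I2) (auto simp: indicator_def)
  qed
  then have "(\<lambda>t. indicator {a..b} t *\<^sub>R h t) absolutely_integrable_on {0..}"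
    by (rule absolutely_integrable_half_line)
  then have "(\<lambda>t. indicator {a..b} t *\<^sub>R h t) absolutely_integrable_on {a..b}"
    by (rule set_integrable_subset) (use a in auto)
  moreover have "(\<lambda>t. indicator {a..b} t *\<^sub>R (indicator {a..b} t *\<^sub>R h t)) = (\<lambda>t. indicator {a..b} t *\<^sub>R h t)"
    by (auto simp: indicator_def)
  ultimately show ?thesis by (simp only: set_integrable_def)
qed

lemma L2_half_sq_interval:
  assumes h: "h \<in> L2_half" and a: "0 \<le> a"
  shows "(\<lambda>t. (cmod (h t))\<^sup>2) absolutely_integrable_on {a..b}"
    "integral {a..b} (\<lambda>t. (cmod (h t))\<^sup>2) \<le> (l2 h)\<^sup>2"
proof -
  have A: "(\<lambda>t. (cmod (h t))\<^sup>2) absolutely_integrable_on {0..}"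
    by (rule absolutely_integrable_half_line[OF L2_half_int[OF h]])
  show B: "(\<lambda>t. (cmod (h t))\<^sup>2) absolutely_integrable_on {a..b}"
    by (rule set_integrable_subset[OF A]) (use a in auto)
  have "((\<lambda>t. (cmod (h t))\<^sup>2) has_integral (l2 h)\<^sup>2) {0..}"
    unfolding l2_sq by (rule has_integral_half_line[OF L2_half_int[OF h]])
  moreover have "((\<lambda>t. (cmod (h t))\<^sup>2) has_integral (integral {a..b} (\<lambda>t. (cmod (h t))\<^sup>2))) {a..b}"
    using B by (simp add: absolutely_integrable_on_def integrable_integral)
  ultimately show "integral {a..b} (\<lambda>t. (cmod (h t))\<^sup>2) \<le> (l2 h)\<^sup>2"
    by (intro has_integral_subset_le[of "{a..b}" "{0..}"]) (use a in auto)
qed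

text \<open>Cauchy-Schwarz against the constant 1, derived from 2 x \<le> k + x^2 / k with a free
  parameter k > 0; the optimum is \<open>l2 h / sqrt (b - a)\<close>. On an interval of length
  \<epsilon> this yields the factor sqrt \<epsilon> of the error terms.\<close>

lemma L2_half_abs_interval:
  assumes h: "h \<in> L2_half" and a: "0 \<le> a" "a \<le> b"
  shows "integral {a..b} (\<lambda>t. cmod (h t)) \<le> sqrt (b - a) * l2 h"
proof -
  have I1: "(\<lambda>t. cmod (h t)) integrable_on {a..b}"
    using L2_half_integrable_interval[OF h a(1)] by (simp add: absolutely_integrable_on_def)
  have I2: "(\<lambda>t. (cmod (h t))\<^sup>2) integrable_on {a..b}"
    using L2_half_sq_interval(1)[OF h a(1)] by (simp add: absolutely_integrable_on_def)
  have *: "2 * integral {a..b} (\<lambda>t. cmod (h t)) \<le> k * (b - a) + (l2 h)\<^sup>2 / k" if "k > 0" for k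
  proof -
    have "integral {a..b} (\<lambda>t. 2 * cmod (h t)) \<le> integral {a..b} (\<lambda>t. k + (1/k) * (cmod (h t))\<^sup>2)"
    proof (rule integral_le)
      show "(\<lambda>t. 2 * cmod (h t)) integrable_on {a..b}" using I1 by (rule integrable_on_mult_right)
      show "(\<lambda>t. k + (1/k) * (cmod (h t))\<^sup>2) integrable_on {a..b}"
        using I2 by (intro integrable_add integrable_on_mult_right) auto
      show "2 * cmod (h t) \<le> k + (1/k) * (cmod (h t))\<^sup>2" for t
        using sum_squares_bound[of k "cmod (h t)"] that
        by (simp add: field_simps power2_eq_square)
    qed
    also have "\<dots> = k * (b - a) + (1/k) * integral {a..b} (\<lambda>t. (cmod (h t))\<^sup>2)"
      using a by (subst integral_add[OF integrable_const_ivl integrable_on_mult_right[OF I2]]) simp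
    also have "\<dots> \<le> k * (b - a) + (1/k) * (l2 h)\<^sup>2"
      using L2_half_sq_interval(2)[OF h a(1)] that by (intro add_left_mono mult_left_mono) auto
    finally show ?thesis by simp
  qed
  show ?thesis
  proof (cases "l2 h = 0 \<or> a = b")
    case True
    show ?thesis
    proof (cases "a = b")
      case False
      with True have z: "l2 h = 0" by simp
      \<comment> \<open>The optimal k degenerates to 0 here, so arbitrarily small positive k are
        used instead.\<close>
      have "integral {a..b} (\<lambda>t. cmod (h t)) \<le> 0 + e" if "e > 0" for e
      proof -
        have "2 * integral {a..b} (\<lambda>t. cmod (h t)) \<le> e / (b - a) * (b - a)"
          using *[of "e / (b - a)"] False a that z by simp
        then have "2 * integral {a..b} (\<lambda>t. cmod (h t)) \<le> e" using False a by simp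
        then show ?thesis using that by linarith
      qed
      then show ?thesis using z by (simp add: field_le_epsilon)
    qed simp
  next
    case False
    then have p: "l2 h > 0" "b - a > 0" using a by (auto simp: less_le)
    define r where "r = sqrt (b - a)"
    have r: "r > 0" "r * r = b - a" using p by (auto simp: r_def)
    have "2 * integral {a..b} (\<lambda>t. cmod (h t)) \<le> l2 h / r * (b - a) + (l2 h)\<^sup>2 / (l2 h / r)"
      using *[of "l2 h / r"] p r by simp
    also have "\<dots> = 2 * (r * l2 h)"
      unfolding r(2)[symmetric] using p(1) r(1) by (simp add: power2_eq_square)
    finally show ?thesis by (simp add: r_def)
  qed
qed

text \<open>The energy identities live on compact intervals; this passes to the half-line by
  monotone convergence along \<open>{0..real k}\<close>. Nonnegativity of the integrand turns gauge
  integrability into Lebesgue integrability.\<close>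

lemma L2_halfI_continuous:
  assumes c: "continuous_on {0..} u" and B: "0 \<le> B"
    and bd: "\<And>T. 0 \<le> T \<Longrightarrow> integral {0..T} (\<lambda>t. (cmod (u t))\<^sup>2) \<le> B\<^sup>2"
  shows "u \<in> L2_half" "l2 u \<le> B"
proof -
  let ?f = "\<lambda>(k::nat) t. if t \<in> {0..real k} then (cmod (u t))\<^sup>2 else 0"
  have int: "(\<lambda>t. (cmod (u t))\<^sup>2) integrable_on {0..T}" for T
    by (intro integrable_continuous_real continuous_intros continuous_on_subset[OF c]) auto
  have sub: "{0..real k} \<inter> {0..} = {0..real k}" for k by auto
  have I: "(?f k) integrable_on {0..}" "integral {0..} (?f k) = integral {0..real k} (\<lambda>t. (cmod (u t))\<^sup>2)" for k
  proof -
    show "(?f k) integrable_on {0..}"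
      using int[of "real k"] sub[of k] by (subst integrable_restrict_Int) simp_all
    show "integral {0..} (?f k) = integral {0..real k} (\<lambda>t. (cmod (u t))\<^sup>2)"
      using sub[of k] by (subst integral_restrict_Int) simp_all
  qed
  have le: "integral {0..} (?f k) \<le> B\<^sup>2" for k
    unfolding I(2) by (rule bd) simp
  have nn: "0 \<le> integral {0..} (?f k)" for k
    by (rule integral_nonneg[OF I(1)]) auto
  have conv: "(\<lambda>t. (cmod (u t))\<^sup>2) integrable_on {0..} \<and>
      (\<lambda>k. integral {0..} (?f k)) \<longlonglongrightarrow> integral {0..} (\<lambda>t. (cmod (u t))\<^sup>2)"
  proof (rule monotone_convergence_increasing)
    show "?f k integrable_on {0..}" for k by (rule I)
    show "?f k t \<le> ?f (Suc k) t" for k t by auto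
    show "(\<lambda>k. ?f k t) \<longlonglongrightarrow> (cmod (u t))\<^sup>2" if "t \<in> {0..}" for t
    proof (rule tendsto_eventually)
      obtain k0 :: nat where "t \<le> real k0" using real_arch_simple by blast
      then show "\<forall>\<^sub>F k in sequentially. ?f k t = (cmod (u t))\<^sup>2"
        using that by (intro eventually_sequentiallyI[of k0]) auto
    qed
    show "bounded (range (\<lambda>k. integral {0..} (?f k)))"
      unfolding bounded_iff using le nn by (intro exI[of _ "B\<^sup>2"]) auto
  qed
  have m: "u \<in> borel_measurable half_line" by (rule continuous_measurable_half_line[OF c])
  have m2: "(\<lambda>t. (cmod (u t))\<^sup>2) \<in> borel_measurable half_line" using m by measurable
  have ai: "(\<lambda>t. (cmod (u t))\<^sup>2) absolutely_integrable_on {0..}"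
    by (rule nonnegative_absolutely_integrable_1) (use conv in auto)
  have ihl: "integrable half_line (\<lambda>t. (cmod (u t))\<^sup>2)"
    unfolding integrable_half_line_iff set_integrable_def
    using ai m2 unfolding set_integrable_def borel_measurable_half_line_iff
    by (subst (asm) integrable_completion) auto
  show "u \<in> L2_half" using m ihl by (simp add: L2_half_def)
  have "(LINT t|half_line. (cmod (u t))\<^sup>2) = integral {0..} (\<lambda>t. (cmod (u t))\<^sup>2)"
    using has_integral_half_line[OF ihl] by (simp add: integral_unique)
  also have "\<dots> \<le> B\<^sup>2"
    by (rule LIMSEQ_le_const2[OF conjunct2[OF conv]]) (use le in auto)
  finally show "l2 u \<le> B" using B by (simp add: l2_def real_le_lsqrt)
qed

text \<open>If |u| stayed above \<delta> from some point on, long intervals would carry more than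
  the total mass. Such points make boundary terms at infinity vanish without knowing that u tends to
  0.\<close>

lemma L2_half_small_point:
  assumes u: "u \<in> L2_half" and d: "0 < \<delta>"
  shows "\<exists>t\<ge>T. 0 \<le> t \<and> cmod (u t) < \<delta>"
proof (rule ccontr)
  assume "\<not> ?thesis"
  then have ge: "cmod (u t) \<ge> \<delta>" if "t \<ge> max 0 T" for t using that by force
  let ?a = "max 0 T"
  obtain n :: nat where n: "(l2 u)\<^sup>2 / \<delta>\<^sup>2 < real n" using reals_Archimedean2 by blast
  have "real n * \<delta>\<^sup>2 = integral {?a..?a + real n} (\<lambda>t. \<delta>\<^sup>2)" by simp
  also have "\<dots> \<le> integral {?a..?a + real n} (\<lambda>t. (cmod (u t))\<^sup>2)"
    using L2_half_sq_interval(1)[OF u, of ?a "?a + real n"] ge d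
    by (intro integral_le) (auto simp: absolutely_integrable_on_def intro!: power_mono)
  also have "\<dots> \<le> (l2 u)\<^sup>2" by (rule L2_half_sq_interval(2)[OF u]) simp
  finally show False using n d by (simp add: field_simps)
qed

text \<open>The minimum of |u|^2 over an interval of length 1 is at most its mean. Two such points
  are the input of the pointwise bounds for u and its derivative.\<close>

lemma L2_half_small_point_unit:
  assumes u: "u \<in> L2_half" and c: "continuous_on {0..} u" and a: "0 \<le> a"
  shows "\<exists>s\<in>{a..a+1}. cmod (u s) \<le> l2 u"
proof (rule ccontr)
  assume "\<not> ?thesis"
  then have gt: "cmod (u s) > l2 u" if "s \<in> {a..a+1}" for s using that by force
  have "continuous_on {a..a+1} (\<lambda>s. cmod (u s))"
    by (intro continuous_intros continuous_on_subset[OF c]) (use a in auto)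
  then obtain s0 where s0: "s0 \<in> {a..a+1}" "\<And>s. s \<in> {a..a+1} \<Longrightarrow> cmod (u s0) \<le> cmod (u s)"
    using continuous_attains_inf[of "{a..a+1}" "\<lambda>s. cmod (u s)"] by auto
  have "(cmod (u s0))\<^sup>2 = integral {a..a+1} (\<lambda>t. (cmod (u s0))\<^sup>2)" by simp
  also have "\<dots> \<le> integral {a..a+1} (\<lambda>t. (cmod (u t))\<^sup>2)"
    using L2_half_sq_interval(1)[OF u a, of "a+1"] s0
    by (intro integral_le) (auto simp: absolutely_integrable_on_def intro!: power_mono)
  also have "\<dots> \<le> (l2 u)\<^sup>2" by (rule L2_half_sq_interval(2)[OF u a])
  finally have "cmod (u s0) \<le> l2 u" by (rule power2_le_imp_le) simp
  with gt[OF s0(1)] show False by simp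
qed

lemma L2_half_uminus: "u \<in> L2_half \<Longrightarrow> (\<lambda>t. - u t) \<in> L2_half"
  using L2_half_scale[of u "-1"] by simp

lemma L2_half_diff: "u \<in> L2_half \<Longrightarrow> v \<in> L2_half \<Longrightarrow> (\<lambda>t. u t - v t) \<in> L2_half"
  using L2_half_add[OF _ L2_half_uminus, of u v] by simp

lemma L2_half_bounded_mult:
  assumes u: "u \<in> L2_half" and c: "continuous_on {0..} k" and b: "\<And>t. 0 \<le> t \<Longrightarrow> cmod (k t) \<le> B"
  shows "(\<lambda>t. k t * u t) \<in> L2_half"
proof -
  have m: "(\<lambda>t. k t * u t) \<in> borel_measurable half_line"
    using L2_half_meas[OF u] continuous_measurable_half_line[OF c] by measurable
  have "integrable half_line (\<lambda>t. (cmod (k t * u t))\<^sup>2)"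
  proof (rule Bochner_Integration.integrable_bound)
    show "integrable half_line (\<lambda>t. B\<^sup>2 * (cmod (u t))\<^sup>2)" using L2_half_int[OF u] by simp
    show "(\<lambda>t. (cmod (k t * u t))\<^sup>2) \<in> borel_measurable half_line" using m by measurable
    show "AE t in half_line. norm ((cmod (k t * u t))\<^sup>2) \<le> norm (B\<^sup>2 * (cmod (u t))\<^sup>2)"
      unfolding AE_half_line_iff
      by (intro AE_I2) (auto simp: norm_mult power_mult_distrib intro!: mult_right_mono power_mono b)
  qed
  with m show ?thesis by (simp add: L2_half_def)
qed

subsection \<open>Integrals of derivatives\<close>

text \<open>Absolute continuity with derivative \<open>f'\<close>; \<open>f'\<close> need not be a derivative at any given point,
  as is the case for second derivatives in \<open>L\<^sub>2\<close>.\<close>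

definition ac :: "real set \<Rightarrow> (real \<Rightarrow> complex) \<Rightarrow> (real \<Rightarrow> complex) \<Rightarrow> bool" where
  "ac S f f' \<longleftrightarrow> (\<forall>a\<in>S. \<forall>b\<in>S. a \<le> b \<longrightarrow> (f' has_integral (f b - f a)) {a..b})"

lemma acD: "ac S f f' \<Longrightarrow> a \<in> S \<Longrightarrow> b \<in> S \<Longrightarrow> a \<le> b \<Longrightarrow> (f' has_integral (f b - f a)) {a..b}"
  by (simp add: ac_def)

lemma ac_integral: "ac S f f' \<Longrightarrow> a \<in> S \<Longrightarrow> b \<in> S \<Longrightarrow> a \<le> b \<Longrightarrow> integral {a..b} f' = f b - f a"
  by (rule integral_unique[OF acD])

lemma ac_subset: "ac S f f' \<Longrightarrow> T \<subseteq> S \<Longrightarrow> ac T f f'"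
  by (auto simp: ac_def)

lemma ac_half_lineI: "(\<And>T. 0 \<le> T \<Longrightarrow> ac {0..T} f f') \<Longrightarrow> ac {0..} f f'"
  unfolding ac_def by (metis atLeastAtMost_iff atLeast_iff order.refl)

lemma ac_cong:
  assumes "ac S f f'" "\<And>t. t \<in> S \<Longrightarrow> f t = g t" "\<And>t. t \<in> S \<Longrightarrow> f' t = g' t" "is_interval S"
  shows "ac S g g'"
  unfolding ac_def
proof (intro ballI impI)
  fix a b assume ab: "a \<in> S" "b \<in> S" "a \<le> b"
  have "{a..b} \<subseteq> S" using mem_is_interval_1_I[OF assms(4) ab(1,2)] by auto
  then have "(g' has_integral f b - f a) {a..b}"
    by (intro has_integral_eq[OF _ acD[OF assms(1) ab]] assms(3)) auto
  then show "(g' has_integral g b - g a) {a..b}"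
    by (simp only: assms(2)[OF ab(1)] assms(2)[OF ab(2)])
qed

lemma ac_add: "ac S f f' \<Longrightarrow> ac S g g' \<Longrightarrow> ac S (\<lambda>t. f t + g t) (\<lambda>t. f' t + g' t)"
  unfolding ac_def add_diff_add by (blast intro: has_integral_add)

lemma ac_cmult: "ac S f f' \<Longrightarrow> ac S (\<lambda>t. c * f t) (\<lambda>t. c * f' t)"
  unfolding ac_def by (metis has_integral_mult_right right_diff_distrib)

lemma ac_const: "ac S (\<lambda>t. c) (\<lambda>t. 0)"
  by (simp add: ac_def)

lemma ac_uminus: "ac S f f' \<Longrightarrow> ac S (\<lambda>t. - f t) (\<lambda>t. - f' t)"
  using ac_cmult[of S f f' "-1"] by simp

lemma ac_diff: "ac S f f' \<Longrightarrow> ac S g g' \<Longrightarrow> ac S (\<lambda>t. f t - g t) (\<lambda>t. f' t - g' t)"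
  using ac_add[OF _ ac_uminus, of S f f' g g'] by simp

lemma ac_cnj:
  assumes "ac S f f'" shows "ac S (\<lambda>t. cnj (f t)) (\<lambda>t. cnj (f' t))"
  unfolding ac_def
proof (intro ballI impI)
  fix a b assume ab: "a \<in> S" "b \<in> S" "a \<le> b"
  show "((\<lambda>t. cnj (f' t)) has_integral cnj (f b) - cnj (f a)) {a..b}"
    using has_integral_linear[OF acD[OF assms ab] bounded_linear_cnj] by (simp add: o_def)
qed

lemma ac_continuous_Icc: assumes "ac {a..b} f f'" shows "continuous_on {a..b} f"
proof (cases "a \<le> b")
  case True
  have "f' integrable_on {a..b}" using acD[OF assms, of a b] True by auto
  then have "continuous_on {a..b} (\<lambda>x. f a + integral {a..x} f')"
    by (intro continuous_intros indefinite_integral_continuous_1)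
  moreover have "f a + integral {a..x} f' = f x" if "x \<in> {a..b}" for x
    using ac_integral[OF assms, of a x] that by auto
  ultimately show ?thesis by (metis (no_types, lifting) continuous_on_cong)
qed simp

lemma continuous_on_half_lineI:
  fixes f :: "real \<Rightarrow> 'a::topological_space"
  assumes "\<And>T. 0 \<le> T \<Longrightarrow> continuous_on {0..T} f" shows "continuous_on {0..} f"
proof -
  have "continuous (at x within {0..}) f" if x: "0 \<le> x" for x
  proof -
    have "continuous (at x within {0..x+1}) f"
      using assms[of "x+1"] x by (simp add: continuous_on_eq_continuous_within)
    moreover have "at x within {0..x+1} = at x within {0..}"
      by (rule at_within_nhd[of x "{..<x+1}"]) auto
    ultimately show ?thesis by simp
  qed
  then show ?thesis by (simp add: continuous_on_eq_continuous_within)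
qed

lemma ac_continuous: "ac {0..} f f' \<Longrightarrow> continuous_on {0..} f"
  by (rule continuous_on_half_lineI, rule ac_continuous_Icc, erule ac_subset) auto

lemma ac_vector_derivative_Icc:
  assumes ac: "ac {a..b} f f'" and c: "continuous_on {a..b} f'" and t: "t \<in> {a..b}"
  shows "(f has_vector_derivative f' t) (at t within {a..b})"
proof -
  have "((\<lambda>u. f a + integral {a..u} f') has_vector_derivative 0 + f' t) (at t within {a..b})"
    by (intro has_vector_derivative_add has_vector_derivative_const integral_has_vector_derivative c t)
  moreover have "f x = f a + integral {a..x} f'" if "x \<in> {a..b}" for x
    using ac_integral[OF ac, of a x] that by auto
  ultimately show ?thesis
    by (metis (no_types, lifting) add_0 has_vector_derivative_transform[OF t])
qed

lemma ac_vector_derivative: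
  assumes ac: "ac {0..} f f'" and c: "continuous_on {0..} f'" and t: "0 \<le> t"
  shows "(f has_vector_derivative f' t) (at t within {0..})"
proof -
  have "(f has_vector_derivative f' t) (at t within {0..t+1})"
    by (rule ac_vector_derivative_Icc[OF ac_subset[OF ac] continuous_on_subset[OF c]]) (use t in auto)
  moreover have "at t within {0..t+1} = at t within {0..}"
    by (rule at_within_nhd[of t "{..<t+1}"]) auto
  ultimately show ?thesis by simp
qed

lemma acI_vector_derivative:
  assumes "\<And>t. t \<in> S \<Longrightarrow> (f has_vector_derivative f' t) (at t within S)" "is_interval S"
  shows "ac S f f'"
  unfolding ac_def
proof (intro ballI impI)
  fix a b assume ab: "a \<in> S" "b \<in> S" "a \<le> b"
  have sub: "{a..b} \<subseteq> S" using mem_is_interval_1_I[OF assms(2) ab(1,2)] by auto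
  show "(f' has_integral f b - f a) {a..b}"
    by (rule fundamental_theorem_of_calculus[OF ab(3)])
       (use sub assms(1) in \<open>blast intro: has_vector_derivative_within_subset\<close>)
qed

lemma ac_primitive:
  assumes "\<And>T. 0 \<le> T \<Longrightarrow> h integrable_on {0..T}"
  shows "ac {0..} (\<lambda>t. c + integral {0..t} h) h"
  unfolding ac_def
proof (intro ballI impI)
  fix a b :: real assume ab: "a \<in> {0..}" "b \<in> {0..}" "a \<le> b"
  have "integral {0..a} h + integral {a..b} h = integral {0..b} h"
    using ab assms[of b] by (intro Henstock_Kurzweil_Integration.integral_combine) auto
  moreover have "h integrable_on {a..b}"
    using integrable_on_subinterval[OF assms[of b], of a b] ab by auto
  ultimately show "(h has_integral c + integral {0..b} h - (c + integral {0..a} h)) {a..b}"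
    by (metis (no_types, lifting) add_diff_cancel_left add_diff_cancel_left' integrable_integral)
qed

lemma absolutely_integrable_continuous_mult:
  fixes k h :: "real \<Rightarrow> complex"
  assumes "continuous_on {a..b} k" "h absolutely_integrable_on {a..b}"
  shows "(\<lambda>t. k t * h t) absolutely_integrable_on {a..b}"
  by (rule absolutely_integrable_bounded_measurable_product[OF bilinear_times _ _ _ assms(2)])
     (auto intro!: continuous_imp_measurable_on_sets_lebesgue assms compact_imp_bounded compact_continuous_image)

text \<open>The defect \<open>\<Phi>\<close> of the product rule satisfies \<open>\<Phi> y - \<Phi> x = o(y - x)\<close>, so it is constant; this
  needs no differentiability of the rougher factor.\<close>

lemma ac_mult_Icc:
  assumes p: "ac {a..b} p p'" and p': "p' absolutely_integrable_on {a..b}"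
    and q: "ac {a..b} q q'" and q': "continuous_on {a..b} q'"
  shows "ac {a..b} (\<lambda>t. p t * q t) (\<lambda>t. p' t * q t + p t * q' t)"
proof (cases "a \<le> b")
  case False then show ?thesis by (simp add: ac_def)
next
  case ab: True
  let ?F = "\<lambda>t. p' t * q t + p t * q' t"
  have cp: "continuous_on {a..b} p" and cq: "continuous_on {a..b} q"
    using p q by (auto intro: ac_continuous_Icc)
  have "(\<lambda>t. q t * p' t) absolutely_integrable_on {a..b}"
    by (rule absolutely_integrable_continuous_mult[OF cq p'])
  then have I1: "(\<lambda>t. p' t * q t) integrable_on {a..b}"
    by (simp add: mult.commute absolutely_integrable_on_def)
  have I2: "(\<lambda>t. p t * q' t) integrable_on {a..b}"
    by (intro integrable_continuous_real continuous_intros cp q')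
  have F: "?F integrable_on {a..b}" using I1 I2 by (rule integrable_add)
  have nP: "(\<lambda>t. cmod (p' t)) integrable_on {a..b}"
    using p' by (simp add: absolutely_integrable_on_def)
  define P where "P t = integral {a..t} (\<lambda>t. cmod (p' t))" for t
  have cP: "continuous_on {a..b} P"
    unfolding P_def by (rule indefinite_integral_continuous_1[OF nP])
  have "bounded (q' ` {a..b})" by (intro compact_imp_bounded compact_continuous_image q') auto
  then obtain B0 where B0: "\<And>t. t \<in> {a..b} \<Longrightarrow> cmod (q' t) \<le> B0" unfolding bounded_iff by blast
  define B where "B = max B0 0"
  have B: "B \<ge> 0" "\<And>t. t \<in> {a..b} \<Longrightarrow> cmod (q' t) \<le> B" using B0 by (auto simp: B_def intro: le_max_iff_disj[THEN iffD2])
  have sub: "{x..y} \<subseteq> {a..b}" if "a \<le> x" "y \<le> b" for x y using that by auto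
  have Pdiff: "P y - P x = integral {x..y} (\<lambda>t. cmod (p' t))" if "a \<le> x" "x \<le> y" "y \<le> b" for x y
    unfolding P_def using Henstock_Kurzweil_Integration.integral_combine[of a x y "\<lambda>t. cmod (p' t)"] that
      integrable_on_subinterval[OF nP sub[of a y]] by auto
  have Pmono: "P x \<le> P y" if "a \<le> x" "x \<le> y" "y \<le> b" for x y
  proof -
    have "0 \<le> integral {x..y} (\<lambda>t. cmod (p' t))"
      using integrable_on_subinterval[OF nP sub[OF that(1,3)]] by (intro integral_nonneg) auto
    then show ?thesis using Pdiff[OF that] by simp
  qed
  have dp: "cmod (p y - p x) \<le> P y - P x" if "a \<le> x" "x \<le> y" "y \<le> b" for x y
  proof -
    have "cmod (integral {x..y} p') \<le> integral {x..y} (\<lambda>t. cmod (p' t))"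
      using integrable_on_subinterval[OF nP sub[OF that(1,3)]] acD[OF p, of x y] that
      by (intro integral_norm_bound_integral) auto
    then show ?thesis using Pdiff[OF that] ac_integral[OF p, of x y] that by simp
  qed
  have dq: "cmod (q y - q x) \<le> B * (y - x)" if "a \<le> x" "x \<le> y" "y \<le> b" for x y
    using has_integral_bound[OF B(1) acD[OF q, of x y, unfolded box_real(2)[symmetric]]] that B
    by (auto simp: content_real)
  define \<Phi> where "\<Phi> t = integral {a..t} ?F - p t * q t" for t
  have D: "cmod (\<Phi> y - \<Phi> x) \<le> 2 * B * (y - x) * (P y - P x)" if xy: "a \<le> x" "x \<le> y" "y \<le> b" for x y
  proof -
    have Ixy: "?F integrable_on {x..y}" by (rule integrable_on_subinterval[OF F sub[OF xy(1,3)]])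
    have pp: "(p' has_integral p y - p x) {x..y}" "(q' has_integral q y - q x) {x..y}"
      using acD[OF p, of x y] acD[OF q, of x y] xy by auto
    \<comment> \<open>With \<open>q\<close> frozen at \<open>y\<close> and \<open>p\<close> at
      \<open>x\<close> the integral is exactly \<open>p y * q y - p x * q x\<close>. Hence the
      increment of \<open>\<Phi>\<close> is the integral of the freezing errors, each the product of
      a derivative and a small difference.\<close>
    have h: "((\<lambda>t. p' t * q y + p x * q' t) has_integral ((p y - p x) * q y + p x * (q y - q x))) {x..y}"
      by (intro has_integral_add has_integral_mult_left has_integral_mult_right pp)
    have "integral {a..y} ?F = integral {a..x} ?F + integral {x..y} ?F"
      using Henstock_Kurzweil_Integration.integral_combine[of a x y ?F] xy integrable_on_subinterval[OF F sub[of a y]] by auto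
    then have "\<Phi> y - \<Phi> x = integral {x..y} ?F - ((p y - p x) * q y + p x * (q y - q x))"
      by (simp add: \<Phi>_def algebra_simps)
    then have "((\<lambda>t. ?F t - (p' t * q y + p x * q' t)) has_integral (\<Phi> y - \<Phi> x)) {x..y}"
      using has_integral_diff[OF integrable_integral[OF Ixy] h] by simp
    then have e: "((\<lambda>t. p' t * (q t - q y) + (p t - p x) * q' t) has_integral (\<Phi> y - \<Phi> x)) {x..y}"
      by (simp add: algebra_simps)
    have b1: "(\<lambda>t. cmod (p' t) * (B * (y - x)) + (P y - P x) * B) integrable_on {x..y}"
      by (intro integrable_add integrable_on_mult_left integrable_const_ivl
          integrable_on_subinterval[OF nP sub[OF xy(1,3)]])
    have "cmod (integral {x..y} (\<lambda>t. p' t * (q t - q y) + (p t - p x) * q' t))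
        \<le> integral {x..y} (\<lambda>t. cmod (p' t) * (B * (y - x)) + (P y - P x) * B)"
    proof (rule integral_norm_bound_integral[OF _ b1])
      fix t assume t: "t \<in> {x..y}"
      have "cmod (q t - q y) \<le> B * (y - x)"
        using dq[of t y] t xy B(1) mult_left_mono[of "y - t" "y - x" B] by (simp add: norm_minus_commute)
      moreover have "cmod (p t - p x) \<le> P y - P x"
        using dp[of x t] Pmono[of t y] t xy by simp
      moreover have "cmod (q' t) \<le> B" using B t xy by auto
      ultimately show "cmod (p' t * (q t - q y) + (p t - p x) * q' t)
          \<le> cmod (p' t) * (B * (y - x)) + (P y - P x) * B"
        by (intro norm_triangle_le add_mono) (auto simp: norm_mult intro!: mult_mono order_trans[OF norm_ge_zero])
    qed (use e in auto)
    also have "\<dots> = integral {x..y} (\<lambda>t. cmod (p' t)) * (B * (y - x)) + (P y - P x) * B * (y - x)"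
      using xy by (subst integral_add) (auto intro!: integrable_on_mult_left integrable_on_subinterval[OF nP sub[OF xy(1,3)]])
    also have "\<dots> = 2 * B * (y - x) * (P y - P x)"
      using Pdiff[OF xy] by (simp add: algebra_simps)
    finally show ?thesis using e by (simp add: integral_unique)
  qed
  have D': "cmod (\<Phi> y - \<Phi> x) \<le> 2 * B * \<bar>P y - P x\<bar> * \<bar>y - x\<bar>" if "x \<in> {a..b}" "y \<in> {a..b}" for x y
  proof (cases "x \<le> y")
    case True then show ?thesis using D[of x y] Pmono[of x y] that by (simp add: algebra_simps)
  next
    case False then show ?thesis using D[of y x] Pmono[of y x] that
      by (simp add: algebra_simps norm_minus_commute)
  qed
  have "(\<Phi> has_derivative (\<lambda>h. 0)) (at x within {a..b})" if x: "x \<in> {a..b}" for x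
  proof (rule has_derivativeI_sandwich[of 1])
    show "((\<lambda>y. 2 * B * \<bar>P y - P x\<bar>) \<longlongrightarrow> 0) (at x within {a..b})"
    proof -
      have "(P \<longlongrightarrow> P x) (at x within {a..b})" using cP x by (simp add: continuous_on_def)
      then have "((\<lambda>y. 2 * B * \<bar>P y - P x\<bar>) \<longlongrightarrow> 2 * B * \<bar>P x - P x\<bar>) (at x within {a..b})"
        by (intro tendsto_intros)
      then show ?thesis by simp
    qed
    show "norm (\<Phi> y - \<Phi> x - 0) / norm (y - x) \<le> 2 * B * \<bar>P y - P x\<bar>"
      if "y \<in> {a..b}" "y \<noteq> x" "dist y x < 1" for y
      using D'[OF x that(1)] that(2) by (simp add: divide_le_eq)
  qed auto
  then have const: "\<exists>c. \<forall>x\<in>{a..b}. \<Phi> x = c"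
    by (intro has_derivative_zero_constant) auto
  show ?thesis unfolding ac_def
  proof (intro ballI impI)
    fix x y assume xy: "x \<in> {a..b}" "y \<in> {a..b}" "x \<le> y"
    have "\<Phi> x = \<Phi> y" using const xy by metis
    then have e1: "integral {a..y} ?F - integral {a..x} ?F = p y * q y - p x * q x"
      by (simp add: \<Phi>_def algebra_simps)
    have "integral {a..x} ?F + integral {x..y} ?F = integral {a..y} ?F"
      using xy integrable_on_subinterval[OF F sub[of a y]]
      by (intro Henstock_Kurzweil_Integration.integral_combine) auto
    then have "integral {x..y} ?F = integral {a..y} ?F - integral {a..x} ?F"
      by (simp only: eq_diff_eq add.commute)
    also note e1
    finally have "integral {x..y} ?F = p y * q y - p x * q x" .
    moreover have "?F integrable_on {x..y}" using xy by (intro integrable_on_subinterval[OF F sub]) auto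
    ultimately show "(?F has_integral p y * q y - p x * q x) {x..y}"
      by (simp only: has_integral_iff simp_thms)
  qed
qed

lemma ac_mult:
  assumes "ac {0..} p p'" "\<And>T. 0 \<le> T \<Longrightarrow> p' absolutely_integrable_on {0..T}"
    and "ac {0..} q q'" "continuous_on {0..} q'"
  shows "ac {0..} (\<lambda>t. p t * q t) (\<lambda>t. p' t * q t + p t * q' t)"
  by (rule ac_half_lineI, rule ac_mult_Icc)
     (use assms in \<open>auto elim: ac_subset continuous_on_subset\<close>)

lemma absolutely_integrable_continuous_Icc:
  fixes f :: "real \<Rightarrow> 'a::euclidean_space"
  assumes "continuous_on {a..b} f" shows "f absolutely_integrable_on {a..b}"
  using absolutely_integrable_continuous_real[OF assms] .

lemma ac_norm_diff_le:
  assumes ac: "ac S u u'" and ab: "a \<in> S" "b \<in> S" "a \<le> b"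
    and B: "\<And>t. t \<in> {a..b} \<Longrightarrow> cmod (u' t) \<le> B"
  shows "cmod (u b - u a) \<le> B * (b - a)"
proof -
  have "0 \<le> B" by (rule order_trans[OF norm_ge_zero B[of a]]) (use ab in auto)
  then show ?thesis
    using has_integral_bound[OF _ acD[OF ac ab, unfolded box_real(2)[symmetric]]] B ab
    by (auto simp: content_real)
qed

lemma ac_L2_diff_le:
  assumes ac: "ac {0..} u w" and w: "w \<in> L2_half" and ab: "0 \<le> a" "a \<le> b"
  shows "cmod (u b - u a) \<le> sqrt (b - a) * l2 w"
proof -
  have "cmod (integral {a..b} w) \<le> integral {a..b} (\<lambda>t. cmod (w t))"
    using L2_half_integrable_interval[OF w ab(1), of b]
    by (intro integral_norm_bound_integral) (auto simp: absolutely_integrable_on_def)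
  also have "\<dots> \<le> sqrt (b - a) * l2 w" by (rule L2_half_abs_interval[OF w ab])
  finally show ?thesis using ac_integral[OF ac, of a b] ab by simp
qed

text \<open>Two points with small values at mutual distance in \<open>[1, 3]\<close> control the mean slope.\<close>

lemma W22_pointwise_bounds:
  assumes u: "u \<in> L2_half" "ac {0..} u u1" and w: "w \<in> L2_half" "ac {0..} u1 w" and t: "0 \<le> t"
  shows "cmod (u1 t) \<le> 2 * l2 u + 2 * l2 w" "cmod (u t) \<le> 3 * l2 u + 4 * l2 w"
proof -
  have c: "continuous_on {0..} u" by (rule ac_continuous[OF u(2)])
  obtain s1 where s1: "s1 \<in> {t..t+1}" "cmod (u s1) \<le> l2 u"
    using L2_half_small_point_unit[OF u(1) c t] by auto
  obtain s2 where s2: "s2 \<in> {t+2..t+2+1}" "cmod (u s2) \<le> l2 u"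
    using L2_half_small_point_unit[OF u(1) c, of "t+2"] t by auto
  have osc: "cmod (u1 s - u1 t) \<le> 2 * l2 w" if "t \<le> s" "s \<le> t + 3" for s
  proof -
    have "sqrt (s - t) \<le> 2" using that by (intro real_le_lsqrt) auto
    then show ?thesis
      using ac_L2_diff_le[OF w(2,1) t that(1)] mult_right_mono[of "sqrt (s - t)" 2 "l2 w"] by simp
  qed
  have ac': "ac {0..} (\<lambda>s. u s - u1 t * of_real s) (\<lambda>s. u1 s - u1 t)"
  proof -
    have "ac {0..} (\<lambda>s. complex_of_real s) (\<lambda>s. 1)"
      by (rule acI_vector_derivative) (auto intro!: derivative_eq_intros simp: is_interval_ci)
    from ac_diff[OF u(2) ac_cmult[OF this, of "u1 t"]] show ?thesis by simp
  qed
  have "cmod ((u s2 - u1 t * s2) - (u s1 - u1 t * s1)) \<le> (2 * l2 w) * (s2 - s1)"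
    by (rule ac_norm_diff_le[OF ac']) (use s1 s2 t osc in auto)
  then have "cmod ((u s2 - u s1) - u1 t * (s2 - s1)) \<le> (2 * l2 w) * (s2 - s1)"
    by (simp add: algebra_simps)
  then have "cmod (u1 t * (s2 - s1)) \<le> cmod (u s2 - u s1) + 2 * l2 w * (s2 - s1)"
    using norm_triangle_ineq3[of "u1 t * (s2 - s1)" "u s2 - u s1"] by (simp add: norm_minus_commute)
  moreover have "cmod (u s2 - u s1) \<le> 2 * l2 u"
    using norm_triangle_ineq4[of "u s2" "u s1"] s1 s2 by simp
  moreover have "cmod (u1 t * (s2 - s1)) = cmod (u1 t) * (s2 - s1)"
  proof -
    have "cmod (complex_of_real (s2 - s1)) = s2 - s1" using s1 s2 by (subst norm_of_real) auto
    then show ?thesis by (simp add: norm_mult)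
  qed
  moreover have d: "1 \<le> s2 - s1" using s1 s2 by auto
  moreover have "2 * l2 u \<le> 2 * l2 u * (s2 - s1)" using d mult_left_mono[of 1 "s2 - s1" "2 * l2 u"] by simp
  ultimately have "cmod (u1 t) * (s2 - s1) \<le> (2 * l2 u + 2 * l2 w) * (s2 - s1)"
    by (simp add: algebra_simps)
  then show *: "cmod (u1 t) \<le> 2 * l2 u + 2 * l2 w" using d by simp
  have "cmod (u s1 - u t) \<le> (2 * l2 u + 4 * l2 w) * (s1 - t)"
  proof (rule ac_norm_diff_le[OF u(2)])
    show "cmod (u1 s) \<le> 2 * l2 u + 4 * l2 w" if "s \<in> {t..s1}" for s
      using osc[of s] * s1 that norm_triangle_ineq2[of "u1 s" "u1 t"] by auto
  qed (use s1 t in auto)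
  also have "\<dots> \<le> (2 * l2 u + 4 * l2 w) * 1" using s1 by (intro mult_left_mono) auto
  finally show "cmod (u t) \<le> 3 * l2 u + 4 * l2 w"
    using s1 norm_triangle_ineq2[of "u t" "u s1"] by (simp add: norm_minus_commute)
qed

subsection \<open>The Sturm-Liouville equation on an edge\<close>

lemma ac_primitive_backward:
  assumes h: "h integrable_on {a..b}"
  shows "ac {a..b} (\<lambda>t. c - integral {t..b} h) h"
  unfolding ac_def
proof (intro ballI impI)
  fix x y assume xy: "x \<in> {a..b}" "y \<in> {a..b}" "x \<le> y"
  have "integral {x..y} h + integral {y..b} h = integral {x..b} h"
    using xy integrable_on_subinterval[OF h, of x b]
    by (intro Henstock_Kurzweil_Integration.integral_combine) auto
  then have "integral {x..y} h = (c - integral {y..b} h) - (c - integral {x..b} h)"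
    by (simp add: algebra_simps)
  moreover have "h integrable_on {x..y}" using integrable_on_subinterval[OF h, of x y] xy by auto
  ultimately show "(h has_integral c - integral {y..b} h - (c - integral {x..b} h)) {x..y}"
    by (simp only: has_integral_iff simp_thms)
qed

text \<open>Integrating the weight exp (L (1 - r)) gains a factor 1 / L. This gain is what makes the
  backward Picard iteration contract for large L.\<close>

lemma exp_weight_integral_bound:
  fixes h :: "real \<Rightarrow> complex"
  assumes h: "h integrable_on {s..1}" and s: "s \<le> 1" and L: "L > 0" and K: "K \<ge> 0"
    and bd: "\<And>r. r \<in> {s..1} \<Longrightarrow> cmod (h r) \<le> K * exp (L * (1 - r))"
  shows "cmod (integral {s..1} h) \<le> K / L * exp (L * (1 - s))"
proof -
  have "((\<lambda>r. K * exp (L * (1 - r))) has_integral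
      ((- K / L * exp (L * (1 - 1))) - (- K / L * exp (L * (1 - s))))) {s..1}"
    using L by (intro fundamental_theorem_of_calculus[OF s])
      (auto intro!: derivative_eq_intros simp flip: has_real_derivative_iff_has_vector_derivative)
  then have "cmod (integral {s..1} h) \<le> (- K / L * exp (L * (1 - 1))) - (- K / L * exp (L * (1 - s)))"
    using integral_norm_bound_integral[OF h _ bd] by (metis has_integral_iff)
  also have "\<dots> \<le> K / L * exp (L * (1 - s))" using K L by simp
  finally show ?thesis .
qed

text \<open>Picard iteration backwards from \<open>1\<close> is a contraction in the weighted norm
  \<open>sup \<bar>y t\<bar> exp (- L (1 - t))\<close>, so that the whole unit interval is reached in one step.\<close>

lemma linear_ivp_backward:
  fixes q g :: "real \<Rightarrow> complex"
  assumes q: "continuous_on {0..1} q" and g: "g absolutely_integrable_on {0..1}"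
  obtains y y1 where "y 1 = A" "y1 1 = B" "ac {0..1} y y1" "ac {0..1} y1 (\<lambda>t. q t * y t - g t)"
proof -
  have "bounded (q ` {0..1})" by (intro compact_imp_bounded compact_continuous_image q) auto
  then obtain M0 where M0: "\<And>t. t \<in> {0..1} \<Longrightarrow> cmod (q t) \<le> M0" unfolding bounded_iff by blast
  define M where "M = max M0 0"
  have M: "M \<ge> 0" "\<And>t. t \<in> {0..1} \<Longrightarrow> cmod (q t) \<le> M"
    using M0 by (auto simp: M_def le_max_iff_disj)
  \<comment> \<open>One Picard step integrates twice and so gains M / L^2, which this choice makes
    at most 1 / 2.\<close>
  define L where "L = 1 + 2 * M"
  have L: "L > 0" "M / L / L \<le> 1 / 2"
  proof -
    show "L > 0" using M by (simp add: L_def)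
    have "2 * M \<le> L * L" using M by (simp add: L_def algebra_simps)
    then show "M / L / L \<le> 1 / 2" using \<open>L > 0\<close> by (simp add: field_simps)
  qed
  \<comment> \<open>The unknown of the fixed point problem is the solution divided by the weight, so
    that the plain supremum norm of bounded continuous functions is the weighted norm;
    \<open>Y\<close> restores the weight and \<open>F\<close> divides it out again.\<close>
  define Y where "Y x t = exp (of_real (L * (1 - t))) * apply_bcontfun x t" for x :: "real \<Rightarrow>\<^sub>C complex" and t
  define k where "k x t = q t * Y x t - g t" for x t
  define y1 where "y1 x t = B - integral {t..1} (k x)" for x t
  define y2 where "y2 x t = A - integral {t..1} (y1 x)" for x t
  define F where "F x t = exp (- of_real (L * (1 - t))) * y2 x t" for x t
  have cY: "continuous_on S (Y x)" for x S
  proof -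
    have "continuous_on S (apply_bcontfun x)"
      using apply_bcontfun[of x] by (auto simp: bcontfun_def intro: continuous_on_subset)
    then show ?thesis unfolding Y_def by (intro continuous_intros)
  qed
  have k: "k x absolutely_integrable_on {0..1}" for x
    unfolding k_def
    by (rule set_integral_diff(1)[OF absolutely_integrable_continuous_Icc[OF continuous_on_mult[OF q cY]] g])
  have ki: "k x integrable_on {0..1}" for x using k by (simp add: absolutely_integrable_on_def)
  have cy1: "continuous_on {0..1} (y1 x)" for x
    unfolding y1_def by (intro continuous_intros indefinite_integral_continuous_1' ki)
  have y1i: "y1 x integrable_on {0..1}" for x by (rule integrable_continuous_real[OF cy1])
  have cF: "continuous_on {0..1} (F x)" for x
    unfolding F_def y2_def by (intro continuous_intros indefinite_integral_continuous_1' y1i)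
  \<comment> \<open>Bounded continuous functions live on the whole line. Clamping the argument
    extends \<open>F x\<close> from the unit interval, and the iteration only looks at values
    there.\<close>
  define cl where "cl t = max 0 (min 1 t)" for t :: real
  have cl: "cl t \<in> {0..1}" "t \<in> {0..1} \<Longrightarrow> cl t = t" for t by (auto simp: cl_def)
  have ccl: "continuous_on UNIV cl" unfolding cl_def by (intro continuous_intros)
  have bc: "(\<lambda>t. F x (cl t)) \<in> bcontfun" for x
  proof -
    have "bounded (F x ` {0..1})" by (intro compact_imp_bounded compact_continuous_image cF) auto
    then obtain b where b: "\<And>t. t \<in> {0..1} \<Longrightarrow> cmod (F x t) \<le> b" unfolding bounded_iff by blast
    have "continuous_on UNIV (\<lambda>t. F x (cl t))"
      by (rule continuous_on_compose2[OF cF ccl]) (use cl in auto)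
    then show ?thesis by (rule bcontfun_normI[of _ b]) (rule b[OF cl(1)])
  qed
  define T where "T x = Bcontfun (\<lambda>t. F x (cl t))" for x
  have T: "apply_bcontfun (T x) t = F x (cl t)" for x t
    unfolding T_def by (simp add: Bcontfun_inverse[OF bc])
  have lip: "dist (T x) (T x') \<le> 1 / 2 * dist x x'" for x x'
  proof (rule dist_bound)
    fix t0 :: real
    define t where "t = cl t0"
    have t: "t \<in> {0..1}" using cl by (simp add: t_def)
    define D where "D = dist x x'"
    have D: "D \<ge> 0" by (simp add: D_def)
    have d1: "cmod (y1 x s - y1 x' s) \<le> M * D / L * exp (L * (1 - s))" if s: "s \<in> {0..1}" for s
    proof -
      have i: "k x integrable_on {s..1}" "k x' integrable_on {s..1}"
        using s by (auto intro: integrable_on_subinterval[OF ki])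
      have "cmod (integral {s..1} (\<lambda>r. k x' r - k x r)) \<le> M * D / L * exp (L * (1 - s))"
      proof (rule exp_weight_integral_bound)
        fix r assume r: "r \<in> {s..1}"
        have e: "k x' r - k x r = q r * exp (of_real (L * (1 - r))) * (apply_bcontfun x' r - apply_bcontfun x r)"
          by (simp add: k_def Y_def algebra_simps)
        have "cmod (apply_bcontfun x' r - apply_bcontfun x r) \<le> D"
          unfolding D_def dist_commute[of x] using dist_bounded[of x' r x] by (simp add: dist_norm)
        moreover have "cmod (q r) \<le> M" using M s r by auto
        moreover have "cmod (exp (of_real (L * (1 - r)))) = exp (L * (1 - r))"
          by (simp add: norm_exp_eq_Re)
        ultimately have "cmod (k x' r - k x r) \<le> M * exp (L * (1 - r)) * D"
          unfolding e norm_mult using M D by (auto intro!: mult_mono)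
        then show "cmod (k x' r - k x r) \<le> M * D * exp (L * (1 - r))" by (simp add: algebra_simps)
      qed (use i s L M D in \<open>auto intro: integrable_diff\<close>)
      then show ?thesis using integral_diff[OF i(2,1)] by (simp add: y1_def)
    qed
    have i: "y1 x integrable_on {t..1}" "y1 x' integrable_on {t..1}"
      using t by (auto intro: integrable_on_subinterval[OF y1i])
    have "cmod (integral {t..1} (\<lambda>r. y1 x' r - y1 x r)) \<le> M * D / L / L * exp (L * (1 - t))"
      by (rule exp_weight_integral_bound)
        (use i t L M D d1 in \<open>auto intro: integrable_diff simp: norm_minus_commute\<close>)
    then have d2: "cmod (y2 x t - y2 x' t) \<le> M * D / L / L * exp (L * (1 - t))"
      using integral_diff[OF i(2,1)] by (simp add: y2_def)
    have ne: "cmod (exp (- of_real (L * (1 - t)))) = exp (- (L * (1 - t)))"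
      by (simp add: norm_exp_eq_Re)
    have "cmod (F x t - F x' t) = exp (- (L * (1 - t))) * cmod (y2 x t - y2 x' t)"
      unfolding F_def by (simp only: right_diff_distrib[symmetric] norm_mult ne)
    also have "\<dots> \<le> exp (- (L * (1 - t))) * (M * D / L / L * exp (L * (1 - t)))"
      by (rule mult_left_mono[OF d2]) simp
    also have "\<dots> = M / L / L * D * (exp (- (L * (1 - t))) * exp (L * (1 - t)))" by simp
    also have "exp (- (L * (1 - t))) * exp (L * (1 - t)) = 1" by (simp flip: exp_add)
    also have "M / L / L * D * 1 \<le> 1 / 2 * D" using mult_right_mono[OF L(2) D] by simp
    finally show "dist (apply_bcontfun (T x) t0) (apply_bcontfun (T x') t0) \<le> 1 / 2 * dist x x'"
      by (simp add: T dist_norm t_def D_def)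
  qed
  have "\<exists>!x. T x = x" by (rule banach_fix_type[of "1/2"]) (use lip in auto)
  then obtain x where x: "T x = x" by auto
  have eq: "Y x t = y2 x t" if "t \<in> {0..1}" for t
  proof -
    have "apply_bcontfun x t = F x t" using T[of x t] x cl(2)[OF that] by simp
    then have "Y x t = exp (of_real (L * (1 - t))) * exp (- of_real (L * (1 - t))) * y2 x t"
      by (simp add: Y_def F_def)
    then show ?thesis by (simp flip: exp_add)
  qed
  show thesis
  proof
    show "y2 x 1 = A" "y1 x 1 = B" by (simp_all add: y2_def y1_def)
    show "ac {0..1} (y2 x) (y1 x)"
      unfolding y2_def[abs_def] by (rule ac_primitive_backward[OF y1i])
    have "ac {0..1} (y1 x) (k x)"
      unfolding y1_def[abs_def] by (rule ac_primitive_backward[OF ki])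
    then show "ac {0..1} (y1 x) (\<lambda>t. q t * y2 x t - g t)"
      by (rule ac_cong) (auto simp: k_def eq is_interval_cc)
  qed
qed

text \<open>The resolvent equation - u'' + V u - \<zeta> u = g as a first-order system with
  \<open>u1\<close> in the role of u'.\<close>

definition edge_ode :: "(real \<Rightarrow> real) \<Rightarrow> complex \<Rightarrow> (real \<Rightarrow> complex) \<Rightarrow> (real \<Rightarrow> complex) \<Rightarrow> (real \<Rightarrow> complex) \<Rightarrow> bool" where
  "edge_ode V \<zeta> g u u1 \<longleftrightarrow> ac {0..} u u1 \<and> ac {0..} u1 (\<lambda>t. (of_real (V t) - \<zeta>) * u t - g t)"

section \<open>Energy identities on one edge\<close>

lemma complex_half_AMGM:
  fixes x y :: complex and c :: real
  assumes "c > 0" shows "cmod x * cmod y \<le> c / 2 * (cmod y)\<^sup>2 + (cmod x)\<^sup>2 / (2 * c)"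
proof -
  have "0 \<le> (cmod x - c * cmod y)\<^sup>2" by simp
  then have "2 * c * (cmod x * cmod y) \<le> c\<^sup>2 * (cmod y)\<^sup>2 + (cmod x)\<^sup>2"
    by (simp add: power2_eq_square algebra_simps)
  then show ?thesis using assms by (simp add: field_simps power2_eq_square)
qed

text \<open>Multiply the equation by the conjugate of u, integrate by parts and take imaginary
  parts: the terms V |u|^2 and |u'|^2 are real and drop out, which leaves |Im \<zeta>| times the
  integral of |u|^2. Half of it absorbs the term with g. No bound on V enters the constants, so they
  are uniform in \<epsilon>.\<close>

lemma edge_energy:
  assumes V: "continuous_on {0..} V" and \<zeta>: "Im \<zeta> \<noteq> 0" and g: "g \<in> L2_half"
    and ode: "edge_ode V \<zeta> g u u1" and T: "0 \<le> T"
  defines "b \<equiv> \<lambda>t. sgn (Im \<zeta>) * Im (u1 t * cnj (u t))"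
  shows "\<bar>Im \<zeta>\<bar> / 2 * integral {0..T} (\<lambda>t. (cmod (u t))\<^sup>2) \<le> b 0 - b T + (l2 g)\<^sup>2 / (2 * \<bar>Im \<zeta>\<bar>)"
proof -
  let ?w = "\<lambda>t. (of_real (V t) - \<zeta>) * u t - g t"
  have u: "ac {0..} u u1" "ac {0..} u1 ?w" using ode by (auto simp: edge_ode_def)
  have cu: "continuous_on {0..} u" "continuous_on {0..} u1" using u by (auto intro: ac_continuous)
  have wi: "?w absolutely_integrable_on {0..T}" for T
  proof (cases "0 \<le> T")
    case True
    have "continuous_on {0..T} (\<lambda>t. (of_real (V t) - \<zeta>) * u t)"
      by (intro continuous_intros continuous_on_subset[OF cu(1)] continuous_on_subset[OF V]) auto
    then show ?thesis using L2_half_integrable_interval[OF g, of 0 T]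
      by (intro set_integral_diff(1)[OF absolutely_integrable_continuous_Icc]) auto
  qed simp
  have "ac {0..} (\<lambda>t. u1 t * cnj (u t)) (\<lambda>t. ?w t * cnj (u t) + u1 t * cnj (u1 t))"
    by (rule ac_mult[OF u(2) wi ac_cnj[OF u(1)]]) (intro continuous_intros cu)
  then have "((\<lambda>t. ?w t * cnj (u t) + u1 t * cnj (u1 t)) has_integral
      (u1 T * cnj (u T) - u1 0 * cnj (u 0))) {0..T}"
    by (rule acD) (use T in auto)
  from has_integral_linear[OF this bounded_linear_Im]
  have I: "((\<lambda>t. Im (?w t * cnj (u t) + u1 t * cnj (u1 t))) has_integral
      (Im (u1 T * cnj (u T) - u1 0 * cnj (u 0)))) {0..T}" by (simp add: o_def)
  let ?s = "sgn (Im \<zeta>)"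
  have I2: "((\<lambda>t. - ?s * Im (?w t * cnj (u t) + u1 t * cnj (u1 t)) + (cmod (g t))\<^sup>2 / (2 * \<bar>Im \<zeta>\<bar>))
     has_integral (- ?s * Im (u1 T * cnj (u T) - u1 0 * cnj (u 0)) +
        integral {0..T} (\<lambda>t. (cmod (g t))\<^sup>2) / (2 * \<bar>Im \<zeta>\<bar>))) {0..T}"
    using L2_half_sq_interval(1)[OF g, of 0 T] T
    by (intro has_integral_add has_integral_mult_right has_integral_divide I integrable_integral)
       (auto simp: absolutely_integrable_on_def)
  have pw: "\<bar>Im \<zeta>\<bar> / 2 * (cmod (u t))\<^sup>2 \<le>
      - ?s * Im (?w t * cnj (u t) + u1 t * cnj (u1 t)) + (cmod (g t))\<^sup>2 / (2 * \<bar>Im \<zeta>\<bar>)" for t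
  proof -
    have e: "(cmod (u t))\<^sup>2 = Re (u t) * Re (u t) + Im (u t) * Im (u t)"
      using cmod_power2[of "u t"] by (simp only: power2_eq_square)
    have E: "Im (?w t * cnj (u t) + u1 t * cnj (u1 t)) = - Im \<zeta> * (cmod (u t))\<^sup>2 - Im (g t * cnj (u t))"
      unfolding e by (simp add: algebra_simps)
    have "- ?s * Im (?w t * cnj (u t) + u1 t * cnj (u1 t)) = \<bar>Im \<zeta>\<bar> * (cmod (u t))\<^sup>2 + ?s * Im (g t * cnj (u t))"
      unfolding E abs_sgn by (simp add: algebra_simps)
    moreover have "\<bar>?s * Im (g t * cnj (u t))\<bar> \<le> cmod (g t) * cmod (u t)"
      using abs_Im_le_cmod[of "g t * cnj (u t)"] \<zeta> by (simp add: abs_mult norm_mult abs_sgn_eq)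
    moreover have "cmod (g t) * cmod (u t) \<le> \<bar>Im \<zeta>\<bar> / 2 * (cmod (u t))\<^sup>2 + (cmod (g t))\<^sup>2 / (2 * \<bar>Im \<zeta>\<bar>)"
      using \<zeta> by (intro complex_half_AMGM) auto
    moreover have "\<bar>Im \<zeta>\<bar> / 2 * (cmod (u t))\<^sup>2 + \<bar>Im \<zeta>\<bar> / 2 * (cmod (u t))\<^sup>2 = \<bar>Im \<zeta>\<bar> * (cmod (u t))\<^sup>2" by simp
    ultimately show ?thesis by linarith
  qed
  have "((\<lambda>t. \<bar>Im \<zeta>\<bar> / 2 * (cmod (u t))\<^sup>2) has_integral (\<bar>Im \<zeta>\<bar> / 2 * integral {0..T} (\<lambda>t. (cmod (u t))\<^sup>2))) {0..T}"
    by (intro has_integral_mult_right integrable_integral integrable_continuous_real continuous_intros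
        continuous_on_subset[OF cu(1)]) auto
  from has_integral_le[OF this I2 pw]
  have "\<bar>Im \<zeta>\<bar> / 2 * integral {0..T} (\<lambda>t. (cmod (u t))\<^sup>2) \<le>
     - ?s * Im (u1 T * cnj (u T) - u1 0 * cnj (u 0)) +
        integral {0..T} (\<lambda>t. (cmod (g t))\<^sup>2) / (2 * \<bar>Im \<zeta>\<bar>)" .
  also have "\<dots> \<le> - ?s * Im (u1 T * cnj (u T) - u1 0 * cnj (u 0)) + (l2 g)\<^sup>2 / (2 * \<bar>Im \<zeta>\<bar>)"
    using L2_half_sq_interval(2)[OF g, of 0 T] by (intro add_left_mono divide_right_mono) auto
  finally show ?thesis by (simp add: b_def algebra_simps)
qed

text \<open>Bounded Cauchy data bound the boundary terms of the energy identity uniformly in T. For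
  explicit or integrated solutions boundedness is easy to see, and square integrability then comes
  for free.\<close>

lemma edge_bounded_imp_L2:
  assumes V: "continuous_on {0..} V" and \<zeta>: "Im \<zeta> \<noteq> 0" and g: "g \<in> L2_half"
    and ode: "edge_ode V \<zeta> g u u1"
    and B: "\<And>t. 0 \<le> t \<Longrightarrow> cmod (u t) \<le> B" "\<And>t. 0 \<le> t \<Longrightarrow> cmod (u1 t) \<le> B"
  shows "u \<in> L2_half"
proof -
  let ?s = "sgn (Im \<zeta>)"
  define K where "K = 2 / \<bar>Im \<zeta>\<bar> * (2 * (B * B) + (l2 g)\<^sup>2 / (2 * \<bar>Im \<zeta>\<bar>))"
  have B0: "B \<ge> 0" using order_trans[OF norm_ge_zero B(1)[of 0]] by simp
  have K: "K \<ge> 0" using B0 by (simp add: K_def)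
  have cu: "continuous_on {0..} u" using ode by (auto simp: edge_ode_def intro: ac_continuous)
  show ?thesis
  proof (rule L2_halfI_continuous(1)[OF cu, of "sqrt K"])
    fix T :: real assume T: "0 \<le> T"
    have bb: "\<bar>?s * Im (u1 t * cnj (u t))\<bar> \<le> B * B" if "0 \<le> t" for t
    proof -
      have "\<bar>?s * Im (u1 t * cnj (u t))\<bar> \<le> cmod (u1 t) * cmod (u t)"
        using abs_Im_le_cmod[of "u1 t * cnj (u t)"] \<zeta> by (simp add: abs_mult norm_mult abs_sgn_eq)
      also have "\<dots> \<le> B * B" using B[OF that] B0 by (intro mult_mono) auto
      finally show ?thesis .
    qed
    have "\<bar>Im \<zeta>\<bar> / 2 * integral {0..T} (\<lambda>t. (cmod (u t))\<^sup>2) \<le> 2 * (B * B) + (l2 g)\<^sup>2 / (2 * \<bar>Im \<zeta>\<bar>)"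
      using edge_energy[OF V \<zeta> g ode T] bb[of 0] bb[OF T] by linarith
    then have "integral {0..T} (\<lambda>t. (cmod (u t))\<^sup>2) \<le> K"
      using \<zeta> by (simp add: K_def field_simps)
    then show "integral {0..T} (\<lambda>t. (cmod (u t))\<^sup>2) \<le> (sqrt K)\<^sup>2" using K by simp
  qed (use K in simp)
qed

text \<open>The boundary term at T disappears along points where u is small, because
  \<open>u1\<close> stays bounded. What is left at the vertex is the quantity that the vertex
  conditions cancel after summation over the edges.\<close>

lemma edge_energy_L2:
  assumes V: "continuous_on {0..} V" and \<zeta>: "Im \<zeta> \<noteq> 0" and g: "g \<in> L2_half"
    and ode: "edge_ode V \<zeta> g u u1" and uL: "u \<in> L2_half"
    and B: "\<And>t. 0 \<le> t \<Longrightarrow> cmod (u1 t) \<le> B"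
  shows "(l2 u)\<^sup>2 \<le> 2 / \<bar>Im \<zeta>\<bar> * (sgn (Im \<zeta>) * Im (u1 0 * cnj (u 0))) + (l2 g)\<^sup>2 / (Im \<zeta>)\<^sup>2"
proof -
  let ?s = "sgn (Im \<zeta>)"
  define K where "K = 2 / \<bar>Im \<zeta>\<bar> * (?s * Im (u1 0 * cnj (u 0))) + (l2 g)\<^sup>2 / (Im \<zeta>)\<^sup>2"
  have B0: "B \<ge> 0" using order_trans[OF norm_ge_zero B[of 0]] by simp
  have cu: "continuous_on {0..} u" using ode by (auto simp: edge_ode_def intro: ac_continuous)
  have sq: "(\<lambda>t. (cmod (u t))\<^sup>2) integrable_on {0..T}" for T
    by (intro integrable_continuous_real continuous_intros continuous_on_subset[OF cu]) auto
  have le: "integral {0..T} (\<lambda>t. (cmod (u t))\<^sup>2) \<le> K" if T: "0 \<le> T" for T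
  proof (rule field_le_epsilon)
    fix e :: real assume e: "0 < e"
    \<comment> \<open>Chosen so that the boundary term, multiplied by 2 / |Im \<zeta>|, costs at
      most \<open>e\<close>; the summand 1 guards against B = 0.\<close>
    define \<delta> where "\<delta> = e * \<bar>Im \<zeta>\<bar> / (2 * (B + 1))"
    have \<delta>: "\<delta> > 0" using e \<zeta> B0 by (simp add: \<delta>_def)
    obtain T' where T': "T' \<ge> T" "0 \<le> T'" "cmod (u T') < \<delta>"
      using L2_half_small_point[OF uL \<delta>] by blast
    have "\<bar>?s * Im (u1 T' * cnj (u T'))\<bar> \<le> cmod (u1 T') * cmod (u T')"
      using abs_Im_le_cmod[of "u1 T' * cnj (u T')"] \<zeta> by (simp add: abs_mult norm_mult abs_sgn_eq)
    also have "\<dots> \<le> B * \<delta>" using B[OF T'(2)] B0 T'(3) by (intro mult_mono) auto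
    also have "\<dots> \<le> (B + 1) * \<delta>" using \<delta> by simp
    also have "\<dots> = e * \<bar>Im \<zeta>\<bar> / 2" using B0 by (simp add: \<delta>_def field_simps)
    finally have "\<bar>?s * Im (u1 T' * cnj (u T'))\<bar> \<le> e * \<bar>Im \<zeta>\<bar> / 2" .
    then have "\<bar>Im \<zeta>\<bar> / 2 * integral {0..T'} (\<lambda>t. (cmod (u t))\<^sup>2)
        \<le> ?s * Im (u1 0 * cnj (u 0)) + e * \<bar>Im \<zeta>\<bar> / 2 + (l2 g)\<^sup>2 / (2 * \<bar>Im \<zeta>\<bar>)"
      using edge_energy[OF V \<zeta> g ode T'(2)] by linarith
    moreover have "integral {0..T} (\<lambda>t. (cmod (u t))\<^sup>2) \<le> integral {0..T'} (\<lambda>t. (cmod (u t))\<^sup>2)"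
      using T' by (intro integral_subset_le sq) auto
    ultimately have "\<bar>Im \<zeta>\<bar> / 2 * integral {0..T} (\<lambda>t. (cmod (u t))\<^sup>2)
        \<le> ?s * Im (u1 0 * cnj (u 0)) + e * \<bar>Im \<zeta>\<bar> / 2 + (l2 g)\<^sup>2 / (2 * \<bar>Im \<zeta>\<bar>)"
      using mult_left_mono[of "integral {0..T} (\<lambda>t. (cmod (u t))\<^sup>2)" "integral {0..T'} (\<lambda>t. (cmod (u t))\<^sup>2)" "\<bar>Im \<zeta>\<bar> / 2"]
      by linarith
    then have "2 / \<bar>Im \<zeta>\<bar> * (\<bar>Im \<zeta>\<bar> / 2 * integral {0..T} (\<lambda>t. (cmod (u t))\<^sup>2))
        \<le> 2 / \<bar>Im \<zeta>\<bar> * (?s * Im (u1 0 * cnj (u 0)) + e * \<bar>Im \<zeta>\<bar> / 2 + (l2 g)\<^sup>2 / (2 * \<bar>Im \<zeta>\<bar>))"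
      by (rule mult_left_mono) simp
    also have "\<dots> = K + e"
    proof -
      have "(l2 g)\<^sup>2 / (\<bar>Im \<zeta>\<bar> * \<bar>Im \<zeta>\<bar>) = (l2 g)\<^sup>2 / (Im \<zeta>)\<^sup>2" by (simp add: power2_eq_square)
      then show ?thesis using \<zeta> by (simp add: K_def distrib_left)
    qed
    finally show "integral {0..T} (\<lambda>t. (cmod (u t))\<^sup>2) \<le> K + e" using \<zeta> by simp
  qed
  have K: "K \<ge> 0" using le[of 0] by simp
  have "l2 u \<le> sqrt K" by (rule L2_halfI_continuous(2)[OF cu]) (use le K in auto)
  then have "(l2 u)\<^sup>2 \<le> (sqrt K)\<^sup>2" by (rule power_mono) simp
  then show ?thesis using K by (simp add: K_def)
qed

text \<open>The derivative of Re (u' cnj u) is |u'|^2 + Re (u'' cnj u), and its boundary terms are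
  controlled by the pointwise bounds. This supplies the square integrable first derivative that
  \<open>W22_derivs\<close> demands.\<close>

lemma L2_half_deriv:
  assumes u: "u \<in> L2_half" "ac {0..} u u1" and w: "w \<in> L2_half" "ac {0..} u1 w"
  shows "u1 \<in> L2_half"
proof -
  define B where "B = 3 * l2 u + 4 * l2 w"
  have B0: "B \<ge> 0" by (simp add: B_def)
  have B: "cmod (u1 t) \<le> B" "cmod (u t) \<le> B" if "0 \<le> t" for t
    using W22_pointwise_bounds[OF u w that] l2_nonneg[of u] l2_nonneg[of w]
    unfolding B_def by linarith+
  have cu: "continuous_on {0..} u" "continuous_on {0..} u1" using u w by (auto intro: ac_continuous)
  define K where "K = 2 * (B * B) + ((l2 w)\<^sup>2 + (l2 u)\<^sup>2) / 2"
  have K: "K \<ge> 0" using B0 by (simp add: K_def)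
  show ?thesis
  proof (rule L2_halfI_continuous(1)[OF cu(2), of "sqrt K"])
    fix T :: real assume T: "0 \<le> T"
    have "ac {0..} (\<lambda>t. u1 t * cnj (u t)) (\<lambda>t. w t * cnj (u t) + u1 t * cnj (u1 t))"
      by (rule ac_mult[OF w(2) L2_half_integrable_interval[OF w(1)] ac_cnj[OF u(2)]])
         (auto intro!: continuous_intros cu)
    then have "((\<lambda>t. w t * cnj (u t) + u1 t * cnj (u1 t)) has_integral
        (u1 T * cnj (u T) - u1 0 * cnj (u 0))) {0..T}"
      by (rule acD) (use T in auto)
    from has_integral_linear[OF this bounded_linear_Re]
    have I: "((\<lambda>t. Re (w t * cnj (u t) + u1 t * cnj (u1 t))) has_integral
        (Re (u1 T * cnj (u T) - u1 0 * cnj (u 0)))) {0..T}" by (simp add: o_def)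
    have I2: "((\<lambda>t. Re (w t * cnj (u t) + u1 t * cnj (u1 t)) + ((cmod (w t))\<^sup>2 + (cmod (u t))\<^sup>2) / 2)
       has_integral (Re (u1 T * cnj (u T) - u1 0 * cnj (u 0)) +
          (integral {0..T} (\<lambda>t. (cmod (w t))\<^sup>2) + integral {0..T} (\<lambda>t. (cmod (u t))\<^sup>2)) / 2)) {0..T}"
      using L2_half_sq_interval(1)[OF u(1), of 0 T] L2_half_sq_interval(1)[OF w(1), of 0 T] T
      by (intro has_integral_add has_integral_divide I integrable_integral)
         (auto simp: absolutely_integrable_on_def)
    have pw: "(cmod (u1 t))\<^sup>2 \<le> Re (w t * cnj (u t) + u1 t * cnj (u1 t)) + ((cmod (w t))\<^sup>2 + (cmod (u t))\<^sup>2) / 2" for t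
    proof -
      have "\<bar>Re (w t * cnj (u t))\<bar> \<le> cmod (w t) * cmod (u t)"
        using abs_Re_le_cmod[of "w t * cnj (u t)"] by (simp add: norm_mult)
      moreover have "cmod (w t) * cmod (u t) \<le> ((cmod (w t))\<^sup>2 + (cmod (u t))\<^sup>2) / 2"
        using complex_half_AMGM[of 1 "w t" "u t"] by (simp add: field_simps)
      moreover have "Re (u1 t * cnj (u1 t)) = (cmod (u1 t))\<^sup>2"
        by (metis Re_complex_of_real complex_norm_square)
      ultimately show ?thesis unfolding plus_complex.sel by linarith
    qed
    have "((\<lambda>t. (cmod (u1 t))\<^sup>2) has_integral (integral {0..T} (\<lambda>t. (cmod (u1 t))\<^sup>2))) {0..T}"
      by (intro integrable_integral integrable_continuous_real continuous_intros
          continuous_on_subset[OF cu(2)]) auto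
    from has_integral_le[OF this I2 pw]
    have 1: "integral {0..T} (\<lambda>t. (cmod (u1 t))\<^sup>2) \<le> Re (u1 T * cnj (u T) - u1 0 * cnj (u 0)) +
          (integral {0..T} (\<lambda>t. (cmod (w t))\<^sup>2) + integral {0..T} (\<lambda>t. (cmod (u t))\<^sup>2)) / 2" .
    have bb: "\<bar>Re (u1 t * cnj (u t))\<bar> \<le> B * B" if "0 \<le> t" for t
    proof -
      have "\<bar>Re (u1 t * cnj (u t))\<bar> \<le> cmod (u1 t) * cmod (u t)"
        using abs_Re_le_cmod[of "u1 t * cnj (u t)"] by (simp add: norm_mult)
      also have "\<dots> \<le> B * B" using B[OF that] B0 by (intro mult_mono) auto
      finally show ?thesis .
    qed
    have 2: "Re (u1 T * cnj (u T) - u1 0 * cnj (u 0)) \<le> 2 * (B * B)"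
      using bb[of 0] bb[OF T] by (simp only: minus_complex.simps) linarith
    have "integral {0..T} (\<lambda>t. (cmod (u1 t))\<^sup>2) \<le> K"
      unfolding K_def
      by (rule order_trans[OF 1], intro add_mono divide_right_mono 2 L2_half_sq_interval(2) u w) auto
    then show "integral {0..T} (\<lambda>t. (cmod (u1 t))\<^sup>2) \<le> (sqrt K)\<^sup>2" using K by simp
  qed (use K in simp)
qed

section \<open>Solutions for zero potential and their continuation to the vertex\<close>

lemma ac_exp: "ac S (\<lambda>t. exp (c * of_real (t - a))) (\<lambda>t. c * exp (c * of_real (t - a)))" if "is_interval S" for S
proof (rule acI_vector_derivative[OF _ that])
  fix t
  have "((\<lambda>z. exp (c * (z - of_real a))) has_field_derivative c * exp (c * (of_real t - of_real a))) (at (of_real t))"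
    by (auto intro!: derivative_eq_intros)
  from has_vector_derivative_real_field[OF this, of S]
  show "((\<lambda>t. exp (c * of_real (t - a))) has_vector_derivative c * exp (c * of_real (t - a))) (at t within S)"
    by simp
qed

text \<open>The operator y'' - \<mu>^2 y factors into (d/dt - \<mu>) (d/dt + \<mu>). The factor z =
  y' + \<mu> y solves z' = \<mu> z - g, an unstable equation whose bounded solution is obtained by
  integrating from infinity; then y' = z - \<mu> y is stable and is integrated forward from
  0.\<close>

lemma half_line_particular_solution:
  assumes \<mu>: "Re \<mu> > 0" and g: "g \<in> L2_half"
  obtains y y1 B where "edge_ode (\<lambda>t. 0) (- (\<mu>\<^sup>2)) g y y1"
    "\<And>t. 0 \<le> t \<Longrightarrow> cmod (y t) \<le> B" "\<And>t. 0 \<le> t \<Longrightarrow> cmod (y1 t) \<le> B"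
proof -
  define \<kappa> where "\<kappa> = Re \<mu>"
  have \<kappa>: "\<kappa> > 0" using \<mu> by (simp add: \<kappa>_def)
  define E where "E c t = exp (c * of_real (t - 0))" for c :: complex and t :: real
  have nE: "cmod (E c t) = exp (Re c * t)" for c t by (simp add: E_def norm_exp_eq_Re)
  have acE: "ac {0..} (E c) (\<lambda>t. c * E c t)" for c
    unfolding E_def[abs_def] by (rule ac_exp) (simp add: is_interval_ci)
  have cE: "continuous_on S (E c)" for c S unfolding E_def[abs_def] by (intro continuous_intros)
  have EE: "E \<mu> t * E (- \<mu>) t = 1" "E (- \<mu>) t * E \<mu> t = 1" for t
    by (simp_all add: E_def flip: exp_add)
  define h where "h t = E (- \<mu>) t * g t" for t
  have hai: "h absolutely_integrable_on {a..b}" if "0 \<le> a" for a b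
    unfolding h_def by (intro absolutely_integrable_continuous_mult cE L2_half_integrable_interval[OF g that])
  define J where "J t = integral {0..t} h" for t
  have acJ: "ac {0..} J h"
    using ac_primitive[of h 0] hai by (simp add: J_def[abs_def] absolutely_integrable_on_def)
  define C where "C = (1 / (2 * \<kappa>) + (l2 g)\<^sup>2) / 2"
  have C: "C \<ge> 0" using \<kappa> by (simp add: C_def)
  have Jdiff: "cmod (J b - J a) \<le> C * exp (- \<kappa> * a)" if ab: "0 \<le> a" "a \<le> b" for a b
  proof -
    have I1: "((\<lambda>s. exp (- 2 * \<kappa> * (s - a))) has_integral
       (exp (- 2 * \<kappa> * (b - a)) / (- 2 * \<kappa>) - exp (- 2 * \<kappa> * (a - a)) / (- 2 * \<kappa>))) {a..b}"
      using \<kappa> by (intro fundamental_theorem_of_calculus[OF ab(2)])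
        (auto intro!: derivative_eq_intros simp flip: has_real_derivative_iff_has_vector_derivative)
    have I2: "((\<lambda>s. (cmod (g s))\<^sup>2) has_integral (integral {a..b} (\<lambda>s. (cmod (g s))\<^sup>2))) {a..b}"
      using L2_half_sq_interval(1)[OF g ab(1), of b] by (simp add: absolutely_integrable_on_def integrable_integral)
    have I: "((\<lambda>s. exp (- \<kappa> * a) * ((exp (- 2 * \<kappa> * (s - a)) + (cmod (g s))\<^sup>2) / 2)) has_integral
      exp (- \<kappa> * a) * ((exp (- 2 * \<kappa> * (b - a)) / (- 2 * \<kappa>) - exp (- 2 * \<kappa> * (a - a)) / (- 2 * \<kappa>)
         + integral {a..b} (\<lambda>s. (cmod (g s))\<^sup>2)) / 2)) {a..b}"
      by (intro has_integral_mult_right has_integral_divide has_integral_add I1 I2)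
    have "cmod (integral {a..b} h) \<le> integral {a..b} (\<lambda>s. exp (- \<kappa> * a) * ((exp (- 2 * \<kappa> * (s - a)) + (cmod (g s))\<^sup>2) / 2))"
    proof (rule integral_norm_bound_integral)
      show "h integrable_on {a..b}" using hai[OF ab(1)] by (simp add: absolutely_integrable_on_def)
      show "(\<lambda>s. exp (- \<kappa> * a) * ((exp (- 2 * \<kappa> * (s - a)) + (cmod (g s))\<^sup>2) / 2)) integrable_on {a..b}"
        using I by blast
      fix s assume "s \<in> {a..b}"
      have "cmod (h s) = exp (- \<kappa> * a) * (exp (- \<kappa> * (s - a)) * cmod (g s))"
        by (simp add: h_def norm_mult nE \<kappa>_def[symmetric] algebra_simps flip: exp_add)
      moreover have "exp (- \<kappa> * (s - a)) * cmod (g s) \<le> ((exp (- \<kappa> * (s - a)))\<^sup>2 + (cmod (g s))\<^sup>2) / 2"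
        using sum_squares_bound[of "exp (- \<kappa> * (s - a))" "cmod (g s)"] by simp
      moreover have "(exp (- \<kappa> * (s - a)))\<^sup>2 = exp (- 2 * \<kappa> * (s - a))"
        by (simp add: power2_eq_square algebra_simps flip: exp_add)
      ultimately show "cmod (h s) \<le> exp (- \<kappa> * a) * ((exp (- 2 * \<kappa> * (s - a)) + (cmod (g s))\<^sup>2) / 2)"
        by simp
    qed
    also have "\<dots> = exp (- \<kappa> * a) * ((exp (- 2 * \<kappa> * (b - a)) / (- 2 * \<kappa>) - exp (- 2 * \<kappa> * (a - a)) / (- 2 * \<kappa>)
         + integral {a..b} (\<lambda>s. (cmod (g s))\<^sup>2)) / 2)"
      using I by (rule integral_unique)
    also have "\<dots> \<le> exp (- \<kappa> * a) * C"
      unfolding C_def using \<kappa>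
      by (intro mult_left_mono divide_right_mono add_mono L2_half_sq_interval(2)[OF g ab(1)])
         (auto simp: field_simps)
    finally show ?thesis using ac_integral[OF acJ, of a b] ab by (simp add: mult.commute)
  qed
  have "Cauchy (\<lambda>n. J (real n))"
  proof (rule CauchyI)
    fix e :: real assume e: "e > 0"
    have "((\<lambda>n. C * exp (- \<kappa> * real n)) \<longlonglongrightarrow> C * 0)"
      using \<kappa> by (intro tendsto_mult tendsto_const filterlim_compose[OF exp_at_bot]
        filterlim_tendsto_neg_mult_at_bot[OF tendsto_const] filterlim_real_sequentially) auto
    then have "\<forall>\<^sub>F n in sequentially. C * exp (- \<kappa> * real n) < e"
      using e by (intro order_tendstoD) auto
    then obtain M where M: "\<And>n. n \<ge> M \<Longrightarrow> C * exp (- \<kappa> * real n) < e"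
      by (auto simp: eventually_sequentially)
    have *: "cmod (J (real m) - J (real n)) < e" if "m \<ge> M" "n \<ge> m" for m n
      using Jdiff[of "real m" "real n"] M[of m] that by (simp add: norm_minus_commute)
    show "\<exists>M. \<forall>m\<ge>M. \<forall>n\<ge>M. norm (J (real m) - J (real n)) < e"
    proof (intro exI allI impI)
      fix m n assume "m \<ge> M" "n \<ge> M"
      then show "norm (J (real m) - J (real n)) < e"
        using *[of m n] *[of n m] by (cases "m \<le> n") (auto simp: norm_minus_commute)
    qed
  qed
  \<comment> \<open>\<open>J0\<close> is the integral of \<open>h\<close> over the whole half-line.
    The tail \<open>J0 - J t\<close> decays like exp (- \<kappa> t), which compensates the growth of
    \<open>E \<mu>\<close> in \<open>z\<close>.\<close>
  then obtain J0 where J0: "(\<lambda>n. J (real n)) \<longlonglongrightarrow> J0"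
    using convergent_eq_Cauchy[of "\<lambda>n. J (real n)"] by auto
  have Jlim: "cmod (J0 - J t) \<le> C * exp (- \<kappa> * t)" if t: "0 \<le> t" for t
  proof -
    obtain N :: nat where N: "t \<le> real N" using real_arch_simple by blast
    have "(\<lambda>n. cmod (J (real n) - J t)) \<longlonglongrightarrow> cmod (J0 - J t)" by (intro tendsto_intros J0)
    then show ?thesis
      by (rule LIMSEQ_le_const2) (use Jdiff[OF t] N in \<open>auto intro!: exI[of _ N]\<close>)
  qed
  define z where "z t = (J0 - J t) * E \<mu> t" for t
  have zb: "cmod (z t) \<le> C" if "0 \<le> t" for t
  proof -
    have "cmod (z t) = cmod (J0 - J t) * exp (\<kappa> * t)" by (simp add: z_def norm_mult nE \<kappa>_def)
    also have "\<dots> \<le> C * exp (- \<kappa> * t) * exp (\<kappa> * t)" by (rule mult_right_mono[OF Jlim[OF that]]) simp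
    also have "\<dots> = C" by (simp flip: exp_add)
    finally show ?thesis .
  qed
  have "ac {0..} (\<lambda>t. J0 - J t) (\<lambda>t. 0 - h t)" by (intro ac_diff ac_const acJ)
  then have "ac {0..} z (\<lambda>t. (0 - h t) * E \<mu> t + (J0 - J t) * (\<mu> * E \<mu> t))"
    unfolding z_def using absolutely_integrable_continuous_mult[OF continuous_on_const hai[of 0], of _ "-1"]
    by (intro ac_mult acE continuous_intros cE) auto
  then have acz: "ac {0..} z (\<lambda>t. \<mu> * z t - g t)"
  proof (rule ac_cong)
    fix t
    have "h t * E \<mu> t = (E (- \<mu>) t * E \<mu> t) * g t" by (simp add: h_def)
    then have "h t * E \<mu> t = g t" by (simp only: EE mult_1)
    then show "(0 - h t) * E \<mu> t + (J0 - J t) * (\<mu> * E \<mu> t) = \<mu> * z t - g t"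
      by (simp add: z_def algebra_simps)
  qed (auto simp: is_interval_ci)
  have cz: "continuous_on {0..} z" by (rule ac_continuous[OF acz])
  define I where "I t = 0 + integral {0..t} (\<lambda>s. E \<mu> s * z s)" for t
  have ezc: "continuous_on {0..} (\<lambda>s. E \<mu> s * z s)" by (intro continuous_intros cE cz)
  have acI: "ac {0..} I (\<lambda>s. E \<mu> s * z s)"
    unfolding I_def[abs_def]
    by (rule ac_primitive) (auto intro!: integrable_continuous_real intro: continuous_on_subset[OF ezc])
  define y where "y t = I t * E (- \<mu>) t" for t
  define y1 where "y1 t = z t - \<mu> * y t" for t
  have "ac {0..} y (\<lambda>t. (E \<mu> t * z t) * E (- \<mu>) t + I t * (- \<mu> * E (- \<mu>) t))"
    unfolding y_def
    by (intro ac_mult acI acE absolutely_integrable_continuous_Icc continuous_intros cE continuous_on_subset[OF cz]) auto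
  then have acy: "ac {0..} y y1"
  proof (rule ac_cong)
    fix t
    have "E \<mu> t * z t * E (- \<mu>) t = (E \<mu> t * E (- \<mu>) t) * z t" by simp
    then have "E \<mu> t * z t * E (- \<mu>) t = z t" by (simp only: EE mult_1)
    then show "E \<mu> t * z t * E (- \<mu>) t + I t * (- \<mu> * E (- \<mu>) t) = y1 t"
      by (simp add: y1_def y_def)
  qed (auto simp: is_interval_ci)
  have acy1: "ac {0..} y1 (\<lambda>t. (\<mu> * z t - g t) - \<mu> * y1 t)"
    unfolding y1_def[abs_def] using ac_diff[OF acz ac_cmult[OF acy, of \<mu>]] by (simp add: y1_def[abs_def])
  have yb: "cmod (y t) \<le> C / \<kappa>" if t: "0 \<le> t" for t
  proof -
    have ie: "((\<lambda>s. C * exp (\<kappa> * s)) has_integral (C * exp (\<kappa> * t) / \<kappa> - C * exp (\<kappa> * 0) / \<kappa>)) {0..t}"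
      using \<kappa> by (intro fundamental_theorem_of_calculus[OF t])
        (auto intro!: derivative_eq_intros simp flip: has_real_derivative_iff_has_vector_derivative)
    have "cmod (integral {0..t} (\<lambda>s. E \<mu> s * z s)) \<le> integral {0..t} (\<lambda>s. C * exp (\<kappa> * s))"
    proof (rule integral_norm_bound_integral)
      show "(\<lambda>s. E \<mu> s * z s) integrable_on {0..t}"
        by (intro integrable_continuous_real continuous_on_subset[OF ezc]) auto
      show "(\<lambda>s. C * exp (\<kappa> * s)) integrable_on {0..t}" using ie by blast
      show "cmod (E \<mu> s * z s) \<le> C * exp (\<kappa> * s)" if "s \<in> {0..t}" for s
        using zb[of s] that by (simp add: norm_mult nE \<kappa>_def mult.commute[of C] mult_left_mono)
    qed
    also have "\<dots> = C * exp (\<kappa> * t) / \<kappa> - C * exp (\<kappa> * 0) / \<kappa>" by (rule integral_unique[OF ie])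
    also have "\<dots> \<le> C / \<kappa> * exp (\<kappa> * t)" using C \<kappa> by simp
    finally have "cmod (I t) * exp (- \<kappa> * t) \<le> C / \<kappa> * exp (\<kappa> * t) * exp (- \<kappa> * t)"
      unfolding I_def by (intro mult_right_mono) auto
    also have "\<dots> = C / \<kappa>" by (simp flip: exp_add)
    finally show ?thesis by (simp add: y_def norm_mult nE \<kappa>_def)
  qed
  show thesis
  proof
    have "ac {0..} y1 (\<lambda>t. (of_real 0 - - (\<mu>\<^sup>2)) * y t - g t)"
      by (rule ac_cong[OF acy1]) (auto simp: y1_def is_interval_ci power2_eq_square algebra_simps)
    with acy show "edge_ode (\<lambda>t. 0) (- (\<mu>\<^sup>2)) g y y1" by (simp add: edge_ode_def)
    show "cmod (y t) \<le> C / \<kappa> + (C + cmod \<mu> * (C / \<kappa>))" if "0 \<le> t" for t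
      using yb[OF that] C \<kappa> by (smt (verit) divide_nonneg_pos mult_nonneg_nonneg norm_ge_zero)
    show "cmod (y1 t) \<le> C / \<kappa> + (C + cmod \<mu> * (C / \<kappa>))" if "0 \<le> t" for t
    proof -
      have "cmod (y1 t) \<le> cmod (z t) + cmod \<mu> * cmod (y t)"
        unfolding y1_def by (metis norm_triangle_ineq4 norm_mult)
      also have "\<dots> \<le> C + cmod \<mu> * (C / \<kappa>)"
        by (intro add_mono mult_left_mono zb yb that) auto
      finally show ?thesis using C \<kappa> by (smt (verit) divide_nonneg_pos)
    qed
  qed
qed

lemma ac_glue:
  assumes f: "ac {0..1} f f'" and g: "ac {1..} g g'" and eq: "f 1 = g 1"
    and w: "\<And>t. t \<in> {0..1} \<Longrightarrow> w t = f' t" "\<And>t. 1 < t \<Longrightarrow> w t = g' t"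
  shows "ac {0..} (\<lambda>t. if t \<le> 1 then f t else g t) w"
proof -
  let ?u = "\<lambda>t. if t \<le> 1 then f t else g t"
  have A: "(w has_integral (f b - f a)) {a..b}" if "0 \<le> a" "a \<le> b" "b \<le> 1" for a b
    by (rule has_integral_eq[OF _ acD[OF f, of a b]]) (use that w in auto)
  have B: "(w has_integral (g b - g a)) {a..b}" if "1 \<le> a" "a \<le> b" for a b
    by (rule has_integral_spike_finite[OF _ _ acD[OF g, of a b], of "{1}"]) (use that w in auto)
  show ?thesis unfolding ac_def
  proof (intro ballI impI)
    fix a b :: real assume ab: "a \<in> {0..}" "b \<in> {0..}" "a \<le> b"
    consider "b \<le> 1" | "1 < a" | "a \<le> 1" "1 < b" by linarith
    then show "(w has_integral ?u b - ?u a) {a..b}"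
    proof cases
      case 1 then show ?thesis using A[of a b] ab by auto
    next
      case 2 then show ?thesis using B[of a b] ab by auto
    next
      case 3
      have "(w has_integral ((f 1 - f a) + (g b - g 1))) {a..b}"
        by (rule has_integral_combine[of a 1 b]) (use 3 ab A[of a 1] B[of 1 b] in auto)
      then show ?thesis using 3 eq by simp
    qed
  qed
qed

text \<open>Common ground of \<alpha> Q, its rescalings with \<epsilon> \<le> 1 and the zero
  potential, so that the edge lemmas apply to both operators alike.\<close>

definition pot :: "(real \<Rightarrow> real) \<Rightarrow> bool" where
  "pot V \<longleftrightarrow> continuous_on {0..} V \<and> (\<forall>t\<ge>1. V t = 0)"

definition edge_sol :: "(real \<Rightarrow> real) \<Rightarrow> complex \<Rightarrow> (real \<Rightarrow> complex) \<Rightarrow> (real \<Rightarrow> complex) \<Rightarrow> (real \<Rightarrow> complex) \<Rightarrow> bool" where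
  "edge_sol V \<zeta> g u u1 \<longleftrightarrow> u \<in> L2_half \<and> edge_ode V \<zeta> g u u1"

text \<open>Beyond 1 the potential vanishes, so a free solution already solves the equation there;
  the initial value problem at 1 continues it back to the vertex. The behaviour at infinity, and
  hence square integrability, is untouched.\<close>

lemma extend_free_solution:
  assumes V: "pot V" and g: "g \<in> L2_half" and y: "y \<in> L2_half" "edge_ode (\<lambda>t. 0) \<zeta> g y y1"
  obtains u u1 where "edge_sol V \<zeta> g u u1" "\<And>t. 1 \<le> t \<Longrightarrow> u t = y t" "\<And>t. 1 \<le> t \<Longrightarrow> u1 t = y1 t"
proof -
  have cV: "continuous_on {0..1} (\<lambda>t. complex_of_real (V t) - \<zeta>)"
    using V by (auto simp: pot_def intro!: continuous_intros intro: continuous_on_subset)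
  obtain a a1 where a: "a 1 = y 1" "a1 1 = y1 1" "ac {0..1} a a1"
      "ac {0..1} a1 (\<lambda>t. (of_real (V t) - \<zeta>) * a t - g t)"
    using linear_ivp_backward[OF cV L2_half_integrable_interval[OF g order_refl]] by metis
  define u where "u t = (if t \<le> 1 then a t else y t)" for t
  define u1 where "u1 t = (if t \<le> 1 then a1 t else y1 t)" for t
  have yac: "ac {1..} y y1" "ac {1..} y1 (\<lambda>t. (of_real 0 - \<zeta>) * y t - g t)"
    using y(2) by (auto simp: edge_ode_def intro: ac_subset)
  have ode: "edge_ode V \<zeta> g u u1" unfolding edge_ode_def
  proof
    show "ac {0..} u u1" unfolding u_def[abs_def]
      by (rule ac_glue[OF a(3) yac(1) a(1)]) (auto simp: u1_def)
    show "ac {0..} u1 (\<lambda>t. (of_real (V t) - \<zeta>) * u t - g t)" unfolding u1_def[abs_def]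
      by (rule ac_glue[OF a(4) yac(2) a(2)]) (use V in \<open>auto simp: u_def pot_def\<close>)
  qed
  then have cu: "continuous_on {0..} u" by (auto simp: edge_ode_def intro: ac_continuous)
  have sq: "(\<lambda>t. (cmod (u t))\<^sup>2) integrable_on {c..d}" if "0 \<le> c" for c d
    by (intro integrable_continuous_real continuous_intros continuous_on_subset[OF cu]) (use that in auto)
  define K where "K = integral {0..1} (\<lambda>t. (cmod (u t))\<^sup>2) + (l2 y)\<^sup>2"
  have K0: "0 \<le> integral {0..1} (\<lambda>t. (cmod (u t))\<^sup>2)" by (intro integral_nonneg sq) auto
  then have K: "K \<ge> 0" by (simp add: K_def)
  have "u \<in> L2_half"
  proof (rule L2_halfI_continuous(1)[OF cu, of "sqrt K"])
    fix T :: real assume T: "0 \<le> T"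
    define T' where "T' = max T 1"
    have "integral {0..T} (\<lambda>t. (cmod (u t))\<^sup>2) \<le> integral {0..T'} (\<lambda>t. (cmod (u t))\<^sup>2)"
      by (intro integral_subset_le sq) (auto simp: T'_def)
    also have "\<dots> = integral {0..1} (\<lambda>t. (cmod (u t))\<^sup>2) + integral {1..T'} (\<lambda>t. (cmod (u t))\<^sup>2)"
      by (rule Henstock_Kurzweil_Integration.integral_combine[symmetric]) (auto simp: T'_def sq)
    also have "integral {1..T'} (\<lambda>t. (cmod (u t))\<^sup>2) = integral {1..T'} (\<lambda>t. (cmod (y t))\<^sup>2)"
      by (rule Henstock_Kurzweil_Integration.integral_cong) (use a in \<open>auto simp: u_def\<close>)
    also have "\<dots> \<le> (l2 y)\<^sup>2" by (rule L2_half_sq_interval(2)[OF y(1)]) simp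
    finally show "integral {0..T} (\<lambda>t. (cmod (u t))\<^sup>2) \<le> (sqrt K)\<^sup>2" using K by (simp add: K_def)
  qed (use K in simp)
  with ode show thesis by (intro that[of u u1]) (auto simp: edge_sol_def u_def u1_def a dest: antisym)
qed

lemma csqrt_Re_pos:
  assumes "Im \<zeta> \<noteq> 0" shows "Re (csqrt (- \<zeta>)) > 0"
proof -
  have "Re (csqrt (- \<zeta>)) \<noteq> 0"
  proof
    assume "Re (csqrt (- \<zeta>)) = 0"
    then have "Im ((csqrt (- \<zeta>))\<^sup>2) = 0" by (simp add: power2_eq_square)
    then show False using assms by simp
  qed
  moreover have "Re (csqrt (- \<zeta>)) \<ge> 0" using csqrt_principal[of "- \<zeta>"] by auto
  ultimately show ?thesis by simp
qed

lemma edge_sol_exists: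
  assumes V: "pot V" and \<zeta>: "Im \<zeta> \<noteq> 0" and g: "g \<in> L2_half"
  obtains u u1 where "edge_sol V \<zeta> g u u1"
proof -
  obtain y y1 B where y: "edge_ode (\<lambda>t. 0) (- ((csqrt (- \<zeta>))\<^sup>2)) g y y1"
    "\<And>t. 0 \<le> t \<Longrightarrow> cmod (y t) \<le> B" "\<And>t. 0 \<le> t \<Longrightarrow> cmod (y1 t) \<le> B"
    using half_line_particular_solution[OF csqrt_Re_pos[OF \<zeta>] g] by blast
  have "y \<in> L2_half"
    by (rule edge_bounded_imp_L2[OF continuous_on_const _ g y]) (use \<zeta> in simp_all)
  moreover have "edge_ode (\<lambda>t. 0) \<zeta> g y y1" using y(1) by simp
  ultimately show thesis by (rule extend_free_solution[OF V g]) (rule that)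
qed

text \<open>The decaying exponential, continued inwards through the potential. Its value at 1 is
  still explicit, which certifies that the solution is nontrivial.\<close>

lemma edge_sol_homogeneous:
  assumes V: "pot V" and \<zeta>: "Im \<zeta> \<noteq> 0"
  obtains h h1 where "edge_sol V \<zeta> (\<lambda>t. 0) h h1" "h 1 \<noteq> 0"
proof -
  let ?\<mu> = "csqrt (- \<zeta>)"
  let ?y = "\<lambda>t. exp (- ?\<mu> * of_real (t - 0))"
  have ac: "ac {0..} ?y (\<lambda>t. - ?\<mu> * ?y t)" by (rule ac_exp) (simp add: is_interval_ci)
  have "- ?\<mu> * (- ?\<mu> * z) = (of_real 0 - \<zeta>) * z - 0" for z
    by (metis diff_0 diff_zero minus_mult_minus mult.assoc of_real_0 power2_csqrt power2_eq_square)
  with ac ac_cmult[OF ac, of "- ?\<mu>"] have ode: "edge_ode (\<lambda>t. 0) \<zeta> (\<lambda>t. 0) ?y (\<lambda>t. - ?\<mu> * ?y t)"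
    unfolding edge_ode_def by simp
  have le: "cmod (?y t) \<le> 1" if "0 \<le> t" for t
    using csqrt_Re_pos[OF \<zeta>] that by (simp add: norm_exp_eq_Re)
  have "?y \<in> L2_half"
  proof (rule edge_bounded_imp_L2[OF _ \<zeta> L2_half_zero ode, of "1 + cmod ?\<mu>"])
    fix t :: real assume t: "0 \<le> t"
    show "cmod (?y t) \<le> 1 + cmod ?\<mu>" using le[OF t] norm_ge_zero[of ?\<mu>] by linarith
    have "cmod (- ?\<mu> * ?y t) \<le> cmod ?\<mu> * 1"
      unfolding norm_mult norm_minus_cancel by (rule mult_left_mono[OF le[OF t]]) simp
    then show "cmod (- ?\<mu> * ?y t) \<le> 1 + cmod ?\<mu>" by linarith
  qed simp
  then obtain h h1 where "edge_sol V \<zeta> (\<lambda>t. 0) h h1" "\<And>t. 1 \<le> t \<Longrightarrow> h t = ?y t"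
    by (rule extend_free_solution[OF V L2_half_zero _ ode]) auto
  then show thesis by (intro that[of h h1]) auto
qed

text \<open>The same factorization as for the particular solution: \<open>d1 + \<mu> d\<close> is a
  multiple of the growing exponential, so \<open>d\<close> is a combination of both exponentials.
  Square integrability excludes the growing one, and the vanishing of its coefficient is precisely
  the relation \<open>d1 e = - \<mu> * d e\<close>.\<close>

lemma free_decay:
  assumes \<mu>: "Re \<mu> > 0" and e: "0 \<le> e" and d: "d \<in> L2_half"
    and ac: "ac {e..} d d1" "ac {e..} d1 (\<lambda>t. \<mu>\<^sup>2 * d t)"
  shows "d1 e = - \<mu> * d e" "\<And>t. e \<le> t \<Longrightarrow> d t = d e * exp (- \<mu> * of_real (t - e))"
proof -
  have \<mu>0: "\<mu> \<noteq> 0" using \<mu> by auto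
  define E where "E c t = exp (c * of_real (t - e))" for c :: complex and t
  have acE: "ac {e..t} (E c) (\<lambda>t. c * E c t)" for c t
    unfolding E_def[abs_def] by (rule ac_exp) (simp add: is_interval_cc)
  have cE: "continuous_on S (E c)" for c S unfolding E_def[abs_def] by (intro continuous_intros)
  have E0: "E c e = 1" for c by (simp add: E_def)
  have EE: "E (-c) t * E c t = 1" for c t by (simp add: E_def flip: exp_add)
  have acI: "ac {e..t} d d1" "ac {e..t} d1 (\<lambda>t. \<mu>\<^sup>2 * d t)" for t
    using ac by (auto intro: ac_subset)
  note c = ac_continuous_Icc[OF acI(1)] ac_continuous_Icc[OF acI(2)]
  define p where "p t = d1 t + \<mu> * d t" for t
  have acp: "ac {e..t} p (\<lambda>t. \<mu>\<^sup>2 * d t + \<mu> * d1 t)" for t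
    unfolding p_def[abs_def] by (intro ac_add ac_cmult acI)
  note cp = ac_continuous_Icc[OF acp]
  have pt: "p t = p e * E \<mu> t" if t: "e \<le> t" for t
  proof -
    have "ac {e..t} (\<lambda>t. p t * E (- \<mu>) t) (\<lambda>t. (\<mu>\<^sup>2 * d t + \<mu> * d1 t) * E (- \<mu>) t + p t * (- \<mu> * E (- \<mu>) t))"
      by (intro ac_mult_Icc acp acE absolutely_integrable_continuous_Icc continuous_intros c cE)
    then have "ac {e..t} (\<lambda>t. p t * E (- \<mu>) t) (\<lambda>t. 0)"
      by (rule ac_cong) (auto simp: p_def algebra_simps power2_eq_square is_interval_cc)
    then have "p t * E (- \<mu>) t = p e * E (- \<mu>) e" using ac_integral[of _ _ "\<lambda>t. 0" e t] t by fastforce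
    then have "p t * (E (- \<mu>) t * E \<mu> t) = p e * E \<mu> t" by (simp add: E0)
    then show ?thesis by (simp add: EE)
  qed
  define k where "k = p e / (2 * \<mu>)"
  define A where "A = d e - k"
  have dt: "d t = A * E (- \<mu>) t + k * E \<mu> t" if t: "e \<le> t" for t
  proof -
    have E2: "E \<mu> s * E \<mu> s = E (2 * \<mu>) s" for s by (simp add: E_def mult.assoc flip: exp_add)
    have "ac {e..t} (\<lambda>t. d t * E \<mu> t - k * E (2 * \<mu>) t)
       (\<lambda>t. (d1 t * E \<mu> t + d t * (\<mu> * E \<mu> t)) - k * ((2 * \<mu>) * E (2 * \<mu>) t))"
      by (intro ac_diff ac_cmult ac_mult_Icc acI acE absolutely_integrable_continuous_Icc continuous_intros c cE)
    then have "ac {e..t} (\<lambda>t. d t * E \<mu> t - k * E (2 * \<mu>) t) (\<lambda>t. 0)"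
    proof (rule ac_cong)
      fix s assume s: "s \<in> {e..t}"
      have "d1 s * E \<mu> s + d s * (\<mu> * E \<mu> s) = p s * E \<mu> s" by (simp add: p_def algebra_simps)
      also have "\<dots> = p e * E (2 * \<mu>) s" using pt[of s] s by (simp add: E2[symmetric])
      also have "\<dots> = k * ((2 * \<mu>) * E (2 * \<mu>) s)" using \<mu>0 by (simp add: k_def)
      finally show "(d1 s * E \<mu> s + d s * (\<mu> * E \<mu> s)) - k * ((2 * \<mu>) * E (2 * \<mu>) s) = 0" by simp
    qed (auto simp: is_interval_cc)
    then have "d t * E \<mu> t - k * E (2 * \<mu>) t = d e * E \<mu> e - k * E (2 * \<mu>) e"
      using ac_integral[of _ _ "\<lambda>t. 0" e t] t by fastforce
    then have "d t * E \<mu> t = A + k * E (2 * \<mu>) t" by (simp add: E0 A_def algebra_simps)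
    then have "d t * E \<mu> t * E (- \<mu>) t = (A + k * (E \<mu> t * E \<mu> t)) * E (- \<mu>) t" by (simp add: E2)
    then have "d t * (E (- \<mu>) t * E \<mu> t) = A * E (- \<mu>) t + k * E \<mu> t * (E (- \<mu>) t * E \<mu> t)"
      by (simp add: algebra_simps)
    then show ?thesis by (simp add: EE)
  qed
  have nE: "cmod (E c t) = exp (Re c * (t - e))" for c t by (simp add: E_def norm_exp_eq_Re)
  have k0: "k = 0"
  proof (rule ccontr)
    assume k: "k \<noteq> 0"
    \<comment> \<open>Beyond \<open>T\<close> the growing part exceeds 1 + |A|, while |d| is below 1
      at some point there and the decaying part is at most |A|.\<close>
    define T where "T = max e (e + (1 + cmod A) / (cmod k * Re \<mu>))"
    obtain t where t: "t \<ge> T" "cmod (d t) < 1" using L2_half_small_point[OF d, of 1 T] by auto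
    then have te: "t \<ge> e" "(1 + cmod A) / (cmod k * Re \<mu>) \<le> t - e" by (auto simp: T_def)
    have "cmod k * exp (Re \<mu> * (t - e)) = cmod (k * E \<mu> t)" by (simp add: norm_mult nE)
    also have "k * E \<mu> t = d t - A * E (- \<mu>) t" using dt[OF te(1)] by simp
    also have "cmod \<dots> \<le> cmod (d t) + cmod A * exp (- (Re \<mu> * (t - e)))"
      using norm_triangle_ineq4[of "d t" "A * E (- \<mu>) t"] by (simp add: norm_mult nE)
    also have "\<dots> \<le> cmod (d t) + cmod A * 1"
      using \<mu> te by (intro add_left_mono mult_left_mono) auto
    also have "\<dots> < 1 + cmod A" using t by simp
    finally have "cmod k * exp (Re \<mu> * (t - e)) < 1 + cmod A" .
    moreover have "1 + cmod A \<le> cmod k * (Re \<mu> * (t - e))"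
      using te(2) k \<mu> by (simp add: field_simps)
    moreover have "cmod k * (Re \<mu> * (t - e)) \<le> cmod k * exp (Re \<mu> * (t - e))"
    proof (rule mult_left_mono)
      show "Re \<mu> * (t - e) \<le> exp (Re \<mu> * (t - e))"
        using exp_ge_add_one_self[of "Re \<mu> * (t - e)"] by linarith
    qed simp
    ultimately show False by linarith
  qed
  then have "p e = 0" using \<mu>0 by (simp add: k_def)
  then show "d1 e = - \<mu> * d e" by (simp add: p_def eq_neg_iff_add_eq_0)
  show "d t = d e * exp (- \<mu> * of_real (t - e))" if "e \<le> t" for t
    using dt[OF that] k0 by (simp add: A_def E_def)
qed

subsection \<open>Smooth step functions\<close>

text \<open>The functions p(1/x) exp(-1/x), extended by 0, form a class closed under
  differentiation. This matches \<open>smooth_on\<close>, which asks for a whole sequence of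
  derivatives.\<close>

definition exp_recip :: "real poly \<Rightarrow> real \<Rightarrow> real" where
  "exp_recip p x = (if 0 < x then poly p (1 / x) * exp (- (1 / x)) else 0)"

lemma poly_times_exp_tendsto_0: "((\<lambda>y. poly p y * exp (- y)) \<longlongrightarrow> (0::real)) at_top"
proof -
  have "((\<lambda>y. \<Sum>i\<le>degree p. coeff p i * (y ^ i / exp y)) \<longlongrightarrow> (\<Sum>i\<le>degree p. coeff p i * 0)) at_top"
    by (intro tendsto_sum tendsto_mult tendsto_const tendsto_power_div_exp_0)
  moreover have "(\<Sum>i\<le>degree p. coeff p i * (y ^ i / exp y)) = poly p y * exp (- y)" for y
    by (simp add: poly_altdef sum_distrib_right exp_minus divide_inverse mult.assoc)
  ultimately show ?thesis by simp
qed

text \<open>In y = 1/x the derivative multiplies by y^2 and turns p into p - p'. At 0 the right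
  difference quotient is y p(y) exp(-y), which tends to 0 as y tends to infinity.\<close>

lemma exp_recip_deriv:
  "(exp_recip p has_real_derivative exp_recip ([:0, 0, 1:] * (p - pderiv p)) x) (at x)"
proof -
  consider "x > 0" | "x < 0" | "x = 0" by linarith
  then show ?thesis
  proof cases
    case 1
    have "((\<lambda>x. poly p (1 / x) * exp (- (1 / x))) has_real_derivative
       exp_recip ([:0, 0, 1:] * (p - pderiv p)) x) (at x)"
      using 1 by (auto intro!: derivative_eq_intros DERIV_chain2[OF poly_DERIV]
         simp: exp_recip_def field_simps power2_eq_square)
    then show ?thesis
      by (rule has_field_derivative_transform_within_open[of _ _ _ "{0<..}"])
         (use 1 in \<open>auto simp: exp_recip_def\<close>)
  next
    case 2
    have "((\<lambda>x. 0) has_real_derivative exp_recip ([:0, 0, 1:] * (p - pderiv p)) x) (at x)"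
      using 2 by (simp add: exp_recip_def)
    then show ?thesis
      by (rule has_field_derivative_transform_within_open[of _ _ _ "{..<0}"])
         (use 2 in \<open>auto simp: exp_recip_def\<close>)
  next
    case 3
    have "((\<lambda>h. exp_recip p h / h) \<longlongrightarrow> 0) (at_right 0)"
    proof -
      have "((\<lambda>h. poly ([:0, 1:] * p) (inverse h) * exp (- inverse h)) \<longlongrightarrow> 0) (at_right (0::real))"
        by (rule filterlim_compose[OF poly_times_exp_tendsto_0 filterlim_inverse_at_top_right])
      moreover have "\<forall>\<^sub>F h in at_right 0. poly ([:0, 1:] * p) (inverse h) * exp (- inverse h) = exp_recip p h / h"
        by (rule eventually_at_right_less[THEN eventually_mono]) (simp add: exp_recip_def field_simps)
      ultimately show ?thesis by (rule Lim_transform_eventually)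
    qed
    moreover have "((\<lambda>h. exp_recip p h / h) \<longlongrightarrow> 0) (at_left 0)"
      by (rule tendsto_eventually) (auto simp: eventually_at_filter exp_recip_def)
    ultimately have "((\<lambda>h. exp_recip p h / h) \<longlongrightarrow> 0) (at 0)"
      by (simp add: filterlim_at_split)
    then show ?thesis using 3 by (simp add: has_field_derivative_iff exp_recip_def)
  qed
qed

text \<open>Generated by the flat functions at 0 and their reflections at 1, so it contains bumps
  supported in the unit interval. Closure under sums, products and negation makes it closed under
  differentiation, whence one choice of derivative can be iterated.\<close>

inductive_set bump_algebra :: "(real \<Rightarrow> real) set" where
  left: "exp_recip p \<in> bump_algebra"
| right: "(\<lambda>x. exp_recip p (1 - x)) \<in> bump_algebra"
| add: "f \<in> bump_algebra \<Longrightarrow> g \<in> bump_algebra \<Longrightarrow> (\<lambda>x. f x + g x) \<in> bump_algebra"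
| mult: "f \<in> bump_algebra \<Longrightarrow> g \<in> bump_algebra \<Longrightarrow> (\<lambda>x. f x * g x) \<in> bump_algebra"
| minus: "f \<in> bump_algebra \<Longrightarrow> (\<lambda>x. - f x) \<in> bump_algebra"

lemma bump_algebra_deriv:
  "f \<in> bump_algebra \<Longrightarrow> \<exists>g\<in>bump_algebra. \<forall>x. (f has_real_derivative g x) (at x)"
proof (induction rule: bump_algebra.induct)
  case (left p)
  then show ?case using exp_recip_deriv bump_algebra.left by blast
next
  case (right p)
  define q where "q = [:0, 0, 1:] * (p - pderiv p)"
  have d: "((\<lambda>x. exp_recip p (1 - x)) has_real_derivative - exp_recip q (1 - x)) (at x)" for x
  proof -
    have 1: "((\<lambda>x. 1 - x) has_real_derivative -1) (at x)" by (auto intro!: derivative_eq_intros)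
    show ?thesis using DERIV_chain2[OF exp_recip_deriv[of p, folded q_def] 1] by simp
  qed
  show ?case
    by (rule bexI[of _ "\<lambda>x. - exp_recip q (1 - x)"]; intro allI d bump_algebra.minus bump_algebra.right)
next
  case (add f g)
  then obtain f' g' where "f' \<in> bump_algebra" "g' \<in> bump_algebra"
     "\<And>x. (f has_real_derivative f' x) (at x)" "\<And>x. (g has_real_derivative g' x) (at x)" by blast
  then show ?case
    by (intro bexI[of _ "\<lambda>x. f' x + g' x"] allI DERIV_add bump_algebra.add)
next
  case (mult f g)
  then obtain f' g' where "f' \<in> bump_algebra" "g' \<in> bump_algebra"
     "\<And>x. (f has_real_derivative f' x) (at x)" "\<And>x. (g has_real_derivative g' x) (at x)" by blast
  then show ?case
    by (intro bexI[of _ "\<lambda>x. f' x * g x + g' x * f x"] allI DERIV_mult bump_algebra.add bump_algebra.mult mult.hyps)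
next
  case (minus f)
  then obtain f' where "f' \<in> bump_algebra" "\<And>x. (f has_real_derivative f' x) (at x)" by blast
  then show ?case
    by (intro bexI[of _ "\<lambda>x. - f' x"] allI DERIV_minus bump_algebra.minus)
qed

lemma bump_algebra_smooth:
  assumes "f \<in> bump_algebra" shows "smooth_on UNIV f"
proof -
  obtain d where d: "\<And>f. f \<in> bump_algebra \<Longrightarrow> d f \<in> bump_algebra"
    "\<And>f x. f \<in> bump_algebra \<Longrightarrow> (f has_real_derivative d f x) (at x)"
    using bump_algebra_deriv by metis
  define D where "D k = (d ^^ k) f" for k
  have "D k \<in> bump_algebra" for k by (induction k) (auto simp: D_def assms d)
  then show ?thesis unfolding smooth_on_def
    by (intro exI[of _ D]) (auto simp: D_def simp flip: has_real_derivative_iff_has_vector_derivative intro: d)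
qed

lemma smooth_on_UNIV_deriv:
  assumes "smooth_on UNIV (f :: real \<Rightarrow> real)"
  shows "(f has_real_derivative deriv f t) (at t)" "smooth_on UNIV (deriv f)"
proof -
  obtain D where D: "D 0 = f" "\<And>k t. (D k has_vector_derivative D (Suc k) t) (at t)"
    using assms by (auto simp: smooth_on_def)
  have d: "(f has_real_derivative D 1 t) (at t)" for t
    using D(2)[of 0 t] D(1) by (simp add: has_real_derivative_iff_has_vector_derivative)
  then have e: "deriv f = D 1" by (auto intro: DERIV_imp_deriv)
  show "(f has_real_derivative deriv f t) (at t)" using d by (simp add: e)
  show "smooth_on UNIV (deriv f)"
    unfolding smooth_on_def e by (intro exI[of _ "\<lambda>k. D (Suc k)"]) (use D in auto)
qed

lemma smooth_on_UNIV_continuous: "smooth_on UNIV (f :: real \<Rightarrow> real) \<Longrightarrow> continuous_on S f"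
  by (meson DERIV_isCont continuous_at_imp_continuous_on smooth_on_UNIV_deriv(1))

lemma smooth_on_UNIV_diff_affine:
  assumes "smooth_on UNIV (f :: real \<Rightarrow> real)"
  shows "smooth_on UNIV (\<lambda>t. f (c * (t - a)) - f (c * (t - b)))"
proof -
  obtain D where D: "D 0 = f" "\<And>k t. (D k has_vector_derivative D (Suc k) t) (at t)"
    using assms by (auto simp: smooth_on_def)
  have d: "(D k has_real_derivative D (Suc k) t) (at t)" for k t
    using D(2) by (simp add: has_real_derivative_iff_has_vector_derivative)
  have "((\<lambda>t. c ^ k * (D k (c * (t - a)) - D k (c * (t - b)))) has_real_derivative
     c ^ Suc k * (D (Suc k) (c * (t - a)) - D (Suc k) (c * (t - b)))) (at t)" for k t
    by (auto intro!: derivative_eq_intros DERIV_chain2[OF d] simp: algebra_simps)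
  then show ?thesis unfolding smooth_on_def
    by (intro exI[of _ "\<lambda>k t. c ^ k * (D k (c * (t - a)) - D k (c * (t - b)))"])
       (auto simp: D(1) simp flip: has_real_derivative_iff_has_vector_derivative)
qed

text \<open>The normalized integral of a nonnegative bump. Monotonicity is recorded because the
  derivatives of the rescaled steps have to be nonnegative kernels of mass 1.\<close>

lemma smooth_step_exists:
  obtains \<theta> :: "real \<Rightarrow> real" where "smooth_on UNIV \<theta>" "\<And>x. x \<le> 0 \<Longrightarrow> \<theta> x = 0" "\<And>x. 1 \<le> x \<Longrightarrow> \<theta> x = 1"
    "\<And>x. 0 \<le> deriv \<theta> x" "\<And>x. 0 \<le> \<theta> x" "\<And>x. \<theta> x \<le> 1"
proof -
  define \<beta> where "\<beta> x = exp_recip 1 x * exp_recip 1 (1 - x)" for x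
  have mem: "\<beta> \<in> bump_algebra" unfolding \<beta>_def[abs_def] by (intro bump_algebra.intros)
  have \<beta>s: "smooth_on UNIV \<beta>" by (rule bump_algebra_smooth[OF mem])
  have c\<beta>: "continuous_on S \<beta>" for S by (rule smooth_on_UNIV_continuous[OF \<beta>s])
  have \<beta>0: "\<beta> x \<ge> 0" "x \<le> 0 \<Longrightarrow> \<beta> x = 0" "1 \<le> x \<Longrightarrow> \<beta> x = 0" for x
    by (auto simp: \<beta>_def exp_recip_def)
  define c where "c = integral {-1..1} \<beta>"
  have "c \<noteq> 0"
  proof
    assume "c = 0"
    then have "(\<beta> has_integral 0) (cbox (-1) 1)"
      using integrable_integral[OF integrable_continuous_real[OF c\<beta>, of "-1" 1]] by (simp add: c_def)
    then have "\<beta> (1/2) = 0"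
      by (rule has_integral_0_cbox_imp_0[rotated 2]) (auto simp: \<beta>0 c\<beta>)
    then show False by (simp add: \<beta>_def exp_recip_def)
  qed
  moreover have "c \<ge> 0" unfolding c_def
    by (rule integral_nonneg[OF integrable_continuous_real[OF c\<beta>]]) (simp add: \<beta>0)
  ultimately have c: "c > 0" by simp
  \<comment> \<open>Starting at -1 instead of 0 makes every x \<ge> 0 an interior point of the
    interval of integration, so that the two-sided derivative exists at 0 as well.\<close>
  define I where "I x = integral {-1..x} \<beta>" for x
  have I0: "I x = 0" if "x \<le> 0" for x
    unfolding I_def using that \<beta>0(2) by (subst Henstock_Kurzweil_Integration.integral_cong[of _ _ "\<lambda>_. 0"]) auto
  have dI: "(I has_real_derivative \<beta> x) (at x)" for x
  proof (cases "x < 0")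
    case True
    have "((\<lambda>x. 0) has_real_derivative \<beta> x) (at x)" using True \<beta>0(2) by simp
    then show ?thesis
      by (rule has_field_derivative_transform_within_open[of _ _ _ "{..<0}"]) (use True I0 in auto)
  next
    case False
    have "(I has_real_derivative \<beta> x) (at x within {-1..x+1})"
      unfolding I_def by (rule integral_has_real_derivative[OF c\<beta>]) (use False in auto)
    moreover have "at x within {-1..x+1} = at x"
      by (rule at_within_interior) (use False in auto)
    ultimately show ?thesis by simp
  qed
  define \<theta> where "\<theta> x = I x / c" for x
  have d\<theta>: "(\<theta> has_real_derivative \<beta> x / c) (at x)" for x
    unfolding \<theta>_def using c by (auto intro!: derivative_eq_intros dI)
  then have e: "deriv \<theta> x = \<beta> x / c" for x by (rule DERIV_imp_deriv)
  have \<theta>1: "\<theta> x = 1" if "1 \<le> x" for x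
  proof -
    have "I x = integral {-1..1} \<beta> + integral {1..x} \<beta>"
      unfolding I_def using that
      by (intro Henstock_Kurzweil_Integration.integral_combine[symmetric] integrable_continuous_real c\<beta>) auto
    also have "integral {1..x} \<beta> = 0"
      using \<beta>0(3) by (subst Henstock_Kurzweil_Integration.integral_cong[of _ _ "\<lambda>_. 0"]) auto
    finally show ?thesis using c by (simp add: \<theta>_def c_def)
  qed
  have \<theta>0: "\<theta> x = 0" if "x \<le> 0" for x using I0[OF that] by (simp add: \<theta>_def)
  have mono: "\<theta> x \<le> \<theta> y" if "x \<le> y" for x y
    by (rule DERIV_nonneg_imp_nondecreasing[OF that]) (use d\<theta> \<beta>0(1) c in \<open>metis divide_nonneg_pos\<close>)
  show thesis
  proof
    obtain D where D: "D 0 = \<beta>" "\<And>k t. (D k has_vector_derivative D (Suc k) t) (at t)"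
      using \<beta>s by (auto simp: smooth_on_def)
    define D' where "D' k = (case k of 0 \<Rightarrow> \<theta> | Suc m \<Rightarrow> (\<lambda>t. D m t / c))" for k
    have "(D' k has_vector_derivative D' (Suc k) t) (at t)" for k t
    proof (cases k)
      case 0 then show ?thesis using d\<theta> D(1) by (simp add: D'_def has_real_derivative_iff_has_vector_derivative)
    next
      case (Suc m)
      then show ?thesis using has_vector_derivative_divide[OF D(2)[of m t], of c] by (simp add: D'_def)
    qed
    then show "smooth_on UNIV \<theta>" unfolding smooth_on_def
      by (intro exI[of _ D']) (auto simp: D'_def)
    show "0 \<le> deriv \<theta> x" for x using e \<beta>0(1) c by simp
    show "0 \<le> \<theta> x" for x using mono[of "min x 0" x] \<theta>0[of "min x 0"] by simp
    show "\<theta> x \<le> 1" for x using mono[of x "max x 1"] \<theta>1[of "max x 1"] by simp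
  qed (use \<theta>0 \<theta>1 in auto)
qed

subsection \<open>Weak derivatives\<close>

text \<open>Weak derivatives are stated with Lebesgue integrals over \<open>half_line\<close>,
  \<open>ac\<close> with gauge integrals. For integrands that vanish outside a compact interval the
  two agree.\<close>

lemma half_line_integral_compact:
  fixes f :: "real \<Rightarrow> complex"
  assumes m: "f \<in> borel_measurable half_line" and i: "f absolutely_integrable_on {a..b}"
    and z: "\<And>t. 0 \<le> t \<Longrightarrow> t \<notin> {a..b} \<Longrightarrow> f t = 0" and a: "0 \<le> a"
  shows "(LINT t|half_line. f t) = integral {a..b} f"
proof -
  have e: "(\<lambda>t. indicator {0..} t *\<^sub>R f t) = (\<lambda>t. indicator {a..b} t *\<^sub>R f t)"
    using z a by (auto simp: fun_eq_iff indicator_def)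
  have m': "(\<lambda>t. indicator {a..b} t *\<^sub>R f t) \<in> borel_measurable lborel"
    using m unfolding borel_measurable_half_line_iff e .
  have "(LINT t|half_line. f t) = (LINT t|lborel. indicator {a..b} t *\<^sub>R f t)"
    by (simp add: integral_half_line_eq set_lebesgue_integral_def e)
  also have "\<dots> = (LINT t|lebesgue. indicator {a..b} t *\<^sub>R f t)"
    by (rule integral_completion[OF m', symmetric])
  also have "\<dots> = integral {a..b} f"
    using set_lebesgue_integral_eq_integral(2)[OF i] by (simp add: set_lebesgue_integral_def)
  finally show ?thesis .
qed

lemma continuous_measurable_open_half_line:
  fixes f :: "real \<Rightarrow> complex"
  assumes "continuous_on {0<..} f" shows "f \<in> borel_measurable half_line"
proof -
  have "(\<lambda>t. indicator {0..} t *\<^sub>R f t) = (\<lambda>t. indicator {0<..} t *\<^sub>R f t + indicator {0} t *\<^sub>R f 0)"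
    by (auto simp: fun_eq_iff indicator_def)
  moreover have "(\<lambda>t. indicator {0<..} t *\<^sub>R f t) \<in> borel_measurable borel"
    by (rule borel_measurable_continuous_on_indicator[OF _ assms]) auto
  ultimately show ?thesis unfolding borel_measurable_half_line_iff by simp
qed

text \<open>The interval given by the definition is enlarged so that the function and its derivative
  vanish at the end points as well, and so that it is nondegenerate even if the given one is
  empty.\<close>

lemma test_functionE:
  assumes "\<eta> \<in> test_functions"
  obtains a b where "0 < a" "a < b" "\<And>t. t \<notin> {a<..<b} \<Longrightarrow> \<eta> t = 0"
    "\<And>t. t \<notin> {a<..<b} \<Longrightarrow> deriv \<eta> t = 0" "smooth_on UNIV \<eta>"
proof -
  obtain a b where ab: "0 < a" "\<And>t. t \<notin> {a..b} \<Longrightarrow> \<eta> t = 0" and s: "smooth_on UNIV \<eta>"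
    using assms by (auto simp: test_functions_def)
  have d0: "deriv \<eta> t = 0" if t: "t < a \<or> b < t" for t
  proof -
    have "((\<lambda>t. 0) has_real_derivative 0) (at t)" by simp
    then have "(\<eta> has_real_derivative 0) (at t)"
      by (rule has_field_derivative_transform_within_open[of _ _ _ "{..<a} \<union> {b<..}"])
         (use t ab in \<open>auto simp: open_Un\<close>)
    then show ?thesis by (rule DERIV_imp_deriv)
  qed
  show thesis
  proof (rule that[of "a/2" "max a b + 1"])
    fix t assume "t \<notin> {a / 2<..<max a b + 1}"
    then have "t < a \<or> b < t" using ab(1) by (auto simp: max_def split: if_splits)
    then show "\<eta> t = 0" "deriv \<eta> t = 0" using ab(2) d0 by auto
  qed (use ab(1) s in auto)
qed

lemma test_function_deriv:
  assumes "\<eta> \<in> test_functions" shows "deriv \<eta> \<in> test_functions"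
proof -
  obtain a b where "0 < a" "\<And>t. t \<notin> {a<..<b} \<Longrightarrow> deriv \<eta> t = 0" "smooth_on UNIV \<eta>"
    using assms by (rule test_functionE) blast
  then show ?thesis unfolding test_functions_def
    by (intro CollectI conjI smooth_on_UNIV_deriv(2) exI[of _ a] exI[of _ b] allI impI) auto
qed

text \<open>All assumptions on u and its derivative concern intervals away from 0, since the
  derivative of a function that is C1 only on the open half-line might a priori blow up at the
  vertex.\<close>

lemma half_line_test_parts:
  assumes \<eta>: "\<eta> \<in> test_functions" and u: "continuous_on {0<..} u"
    and u1: "u1 \<in> borel_measurable half_line" "\<And>a b. 0 < a \<Longrightarrow> u1 absolutely_integrable_on {a..b}"
    and ac: "\<And>a b. 0 < a \<Longrightarrow> ac {a..b} u u1"
  shows "(LINT t|half_line. deriv \<eta> t *\<^sub>R u t) = - (LINT t|half_line. \<eta> t *\<^sub>R u1 t)"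
proof -
  obtain a b where ab: "0 < a" "a < b" "\<And>t. t \<notin> {a<..<b} \<Longrightarrow> \<eta> t = 0"
    "\<And>t. t \<notin> {a<..<b} \<Longrightarrow> deriv \<eta> t = 0" and s: "smooth_on UNIV \<eta>"
    using \<eta> by (rule test_functionE) blast
  have c: "continuous_on S \<eta>" "continuous_on S (deriv \<eta>)" for S
    using s by (auto intro: smooth_on_UNIV_continuous smooth_on_UNIV_deriv(2))
  have cu: "continuous_on {a..b} u" by (rule continuous_on_subset[OF u]) (use ab in auto)
  have ac\<eta>: "ac {a..b} (\<lambda>t. of_real (\<eta> t)) (\<lambda>t. of_real (deriv \<eta> t))"
  proof (rule acI_vector_derivative)
    fix t
    show "((\<lambda>t. complex_of_real (\<eta> t)) has_vector_derivative of_real (deriv \<eta> t)) (at t within {a..b})"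
      using smooth_on_UNIV_deriv(1)[OF s, of t]
      by (intro has_vector_derivative_of_real has_vector_derivative_at_within)
         (simp add: has_real_derivative_iff_has_vector_derivative)
  qed (simp add: is_interval_cc)
  have "ac {a..b} (\<lambda>t. u t * of_real (\<eta> t)) (\<lambda>t. u1 t * of_real (\<eta> t) + u t * of_real (deriv \<eta> t))"
    by (rule ac_mult_Icc[OF ac[OF ab(1)] u1(2)[OF ab(1)] ac\<eta>]) (intro continuous_intros c)
  from acD[OF this, of a b] have
    I: "((\<lambda>t. u1 t * of_real (\<eta> t) + u t * of_real (deriv \<eta> t)) has_integral 0) {a..b}"
    using ab by simp
  have mu: "u \<in> borel_measurable half_line" by (rule continuous_measurable_open_half_line[OF u])
  have m\<eta>: "\<eta> \<in> borel_measurable half_line" "deriv \<eta> \<in> borel_measurable half_line"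
    by (auto intro: continuous_measurable_half_line c)
  have ai1: "(\<lambda>t. deriv \<eta> t *\<^sub>R u t) absolutely_integrable_on {a..b}"
    by (intro absolutely_integrable_continuous_Icc continuous_intros c cu)
  have ai2: "(\<lambda>t. \<eta> t *\<^sub>R u1 t) absolutely_integrable_on {a..b}"
    using absolutely_integrable_continuous_mult[OF continuous_on_of_real[OF c(1)] u1(2)[OF ab(1)], of b]
    by (simp add: scaleR_conv_of_real)
  have 1: "(LINT t|half_line. deriv \<eta> t *\<^sub>R u t) = integral {a..b} (\<lambda>t. deriv \<eta> t *\<^sub>R u t)"
    by (rule half_line_integral_compact[OF _ ai1])
       (use ab in \<open>auto intro!: borel_measurable_scaleR mu m\<eta>\<close>)
  have 2: "(LINT t|half_line. \<eta> t *\<^sub>R u1 t) = integral {a..b} (\<lambda>t. \<eta> t *\<^sub>R u1 t)"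
    by (rule half_line_integral_compact[OF _ ai2])
       (use ab u1 in \<open>auto intro!: borel_measurable_scaleR m\<eta>\<close>)
  have "integral {a..b} (\<lambda>t. \<eta> t *\<^sub>R u1 t) + integral {a..b} (\<lambda>t. deriv \<eta> t *\<^sub>R u t) =
      integral {a..b} (\<lambda>t. \<eta> t *\<^sub>R u1 t + deriv \<eta> t *\<^sub>R u t)"
    using ai1 ai2 by (intro integral_add[symmetric]) (auto simp: absolutely_integrable_on_def)
  also have "\<dots> = 0" using I by (intro integral_unique) (simp add: scaleR_conv_of_real mult.commute)
  finally show ?thesis unfolding 1 2 by (simp add: eq_neg_iff_add_eq_0 add.commute)
qed

text \<open>Testing with smoothed indicators of an interval reads off u at the two end points, where
  its continuity is used. The function v enters only through its integral, so square integrability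
  suffices for it.\<close>

lemma weak_deriv_imp_ac:
  assumes wd: "weak_deriv u v" and u: "continuous_on {0<..} u" and v: "v \<in> L2_half"
    and ab: "0 < a" "a \<le> b"
  shows "(v has_integral (u b - u a)) {a..b}"
proof -
  obtain \<theta> :: "real \<Rightarrow> real" where \<theta>: "smooth_on UNIV \<theta>" "\<And>x. x \<le> 0 \<Longrightarrow> \<theta> x = 0" "\<And>x. 1 \<le> x \<Longrightarrow> \<theta> x = 1"
    "\<And>x. 0 \<le> deriv \<theta> x" "\<And>x. 0 \<le> \<theta> x" "\<And>x. \<theta> x \<le> 1"
    by (rule smooth_step_exists) blast
  note d\<theta> = smooth_on_UNIV_deriv(1)[OF \<theta>(1)]
  have cd\<theta>: "continuous_on S (deriv \<theta>)" for S
    by (rule smooth_on_UNIV_continuous[OF smooth_on_UNIV_deriv(2)[OF \<theta>(1)]])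
  define \<eta> where "\<eta> n t = \<theta> (real (Suc n) * (t - a)) - \<theta> (real (Suc n) * (t - b))" for n :: nat and t
  define k where "k c n t = real (Suc n) * deriv \<theta> (real (Suc n) * (t - c))" for c and n :: nat and t
  have dk: "((\<lambda>t. \<theta> (real (Suc n) * (t - c))) has_real_derivative k c n t) (at t)" for c n t
  proof -
    have "((\<lambda>t. real (Suc n) * (t - c)) has_real_derivative real (Suc n)) (at t)"
      by (auto intro!: derivative_eq_intros)
    from DERIV_chain2[OF d\<theta> this] show ?thesis by (simp add: k_def mult.commute)
  qed
  have d\<eta>: "deriv (\<eta> n) t = k a n t - k b n t" for n t
    unfolding \<eta>_def[abs_def] by (intro DERIV_imp_deriv DERIV_diff dk)
  have ge: "1 \<le> real (Suc n) * x" if "1 \<le> x" for n x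
    using mult_mono[of 1 "real (Suc n)" 1 x] that by simp
  have le: "real (Suc n) * x \<le> 0" if "x \<le> 0" for n x using that by (simp add: mult_nonneg_nonpos)
  \<comment> \<open>The smoothed jump at \<open>b\<close> is completed after a length 1 / (n + 1),
    hence before b + 1.\<close>
  have \<eta>0: "\<eta> n t = 0" if "t \<notin> {a..b+1}" for n t
  proof (cases "t < a")
    case True then show ?thesis unfolding \<eta>_def using le[of "t - a" n] le[of "t - b" n] ab \<theta>(2) by simp
  next
    case False
    then show ?thesis unfolding \<eta>_def using that ge[of "t - a" n] ge[of "t - b" n] ab \<theta>(3) by simp
  qed
  have test: "\<eta> n \<in> test_functions" for n
    unfolding test_functions_def using smooth_on_UNIV_diff_affine[OF \<theta>(1), of "real (Suc n)" a b] \<eta>0 ab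
    by (auto simp: \<eta>_def[abs_def])
  have \<eta>1: "\<bar>\<eta> n t\<bar> \<le> 1" for n t
    unfolding \<eta>_def using \<theta>(5,6)[of "real (Suc n) * (t - a)"] \<theta>(5,6)[of "real (Suc n) * (t - b)"] by linarith
  have wd': "(LINT t|half_line. deriv (\<eta> n) t *\<^sub>R u t) = - (LINT t|half_line. \<eta> n t *\<^sub>R v t)" for n
    using wd test by (simp add: weak_deriv_def)
  have ck: "continuous_on S (k c n)" for S c n
    unfolding k_def by (intro continuous_intros continuous_on_compose2[OF cd\<theta>[of UNIV]]) auto
  have c\<eta>: "continuous_on S (\<eta> n)" for S n
    using test[of n] by (intro smooth_on_UNIV_continuous) (simp add: test_functions_def)
  have mv: "v \<in> borel_measurable half_line" by (rule L2_half_meas[OF v])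
  have m\<eta>: "\<eta> n \<in> borel_measurable half_line" for n by (intro continuous_measurable_half_line c\<eta>)
  text \<open>\<open>\<eta> n\<close> tends to the indicator of \<open>(a, b]\<close>, and its derivative to the difference of the
    unit masses at \<open>a\<close> and \<open>b\<close>.\<close>
  have R: "(\<lambda>n. LINT t|half_line. \<eta> n t *\<^sub>R v t) \<longlonglongrightarrow> (LINT t|half_line. indicator {a<..b} t *\<^sub>R v t)"
  proof (rule integral_dominated_convergence[where w="\<lambda>t. indicator {a..b+1} t + (cmod (v t))\<^sup>2"])
    show "(\<lambda>t. indicator {a<..b} t *\<^sub>R v t) \<in> borel_measurable half_line"
      using mv by (intro borel_measurable_scaleR) (auto simp: half_line_def intro: measurable_restrict_space1)
    show "(\<lambda>t. \<eta> n t *\<^sub>R v t) \<in> borel_measurable half_line" for n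
      by (intro borel_measurable_scaleR m\<eta> mv)
    have "integrable half_line (\<lambda>t. indicator {a..b+1} t :: real)"
      unfolding integrable_half_line_iff set_integrable_def
      by (rule Bochner_Integration.integrable_bound[where f="indicator {a..b+1} :: real \<Rightarrow> real"])
         (auto simp: indicator_def emeasure_lborel_Icc_eq intro!: integrable_real_indicator)
    then show "integrable half_line (\<lambda>t. indicator {a..b+1} t + (cmod (v t))\<^sup>2 :: real)"
      using L2_half_int[OF v] by simp
    show "AE t in half_line. (\<lambda>n. \<eta> n t *\<^sub>R v t) \<longlonglongrightarrow> indicator {a<..b} t *\<^sub>R v t"
    proof (rule AE_I2)
      fix t
      have "\<forall>\<^sub>F n in sequentially. \<eta> n t = indicator {a<..b} t"
      proof -
        have big: "\<forall>\<^sub>F n in sequentially. \<theta> (real (Suc n) * x) = 1" if x: "0 < x" for x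
        proof -
          obtain N :: nat where N: "1 / x < real N" using reals_Archimedean2 by blast
          show ?thesis
          proof (rule eventually_sequentiallyI[of N])
            fix n assume "N \<le> n"
            then have "1 / x \<le> real (Suc n)" using N by linarith
            then show "\<theta> (real (Suc n) * x) = 1" using x by (intro \<theta>(3)) (simp only: pos_divide_le_eq)
          qed
        qed
        consider "t \<le> a" | "a < t" "t \<le> b" | "b < t" by linarith
        then show ?thesis
        proof cases
          case 1
          then have "\<eta> n t = 0" for n unfolding \<eta>_def using le[of "t - a" n] le[of "t - b" n] ab \<theta>(2) by simp
          then show ?thesis using 1 by (simp add: indicator_def)
        next
          case 2
          then have "\<theta> (real (Suc n) * (t - b)) = 0" for n using le[of "t - b" n] \<theta>(2) by simp
          then show ?thesis using big[of "t - a"] 2 by (simp add: \<eta>_def indicator_def)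
        next
          case 3
          then show ?thesis using big[of "t - a"] big[of "t - b"] ab
            by (auto simp: \<eta>_def indicator_def elim: eventually_elim2)
        qed
      qed
      then show "(\<lambda>n. \<eta> n t *\<^sub>R v t) \<longlonglongrightarrow> indicator {a<..b} t *\<^sub>R v t"
        by (intro tendsto_eventually) (auto elim: eventually_mono)
    qed
    show "AE t in half_line. norm (\<eta> n t *\<^sub>R v t) \<le> indicator {a..b+1} t + (cmod (v t))\<^sup>2" for n
    proof (rule AE_I2)
      fix t
      have "cmod (v t) \<le> 1 + (cmod (v t))\<^sup>2"
        using sum_squares_bound[of 1 "cmod (v t)"]
        by (simp add: power2_eq_square) (use norm_ge_zero[of "v t"] in linarith)
      moreover have "\<bar>\<eta> n t\<bar> * cmod (v t) \<le> 1 * cmod (v t)" by (rule mult_right_mono[OF \<eta>1]) simp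
      ultimately show "norm (\<eta> n t *\<^sub>R v t) \<le> indicator {a..b+1} t + (cmod (v t))\<^sup>2"
        using \<eta>0[of t n] by (auto simp: indicator_def)
    qed
  qed
  have cu: "continuous_on {a..b+1} u" by (rule continuous_on_subset[OF u]) (use ab in auto)
  \<comment> \<open>\<open>k c n\<close> is nonnegative, has integral 1 and lives on the interval
    from c to c + 1 / (n + 1): a one-sided approximate identity. The support is found by recognizing
    the step as locally constant outside this interval.\<close>
  have delta: "(\<lambda>n. integral {a..b+1} (\<lambda>t. k c n t *\<^sub>R u t)) \<longlonglongrightarrow> u c" if c: "a \<le> c" "c \<le> b" for c
  proof (rule LIMSEQ_I)
    fix e :: real assume e: "0 < e"
    obtain \<delta> where \<delta>: "\<delta> > 0" "\<And>t. t \<in> {a..b+1} \<Longrightarrow> dist t c < \<delta> \<Longrightarrow> dist (u t) (u c) < e / 2"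
      using cu[unfolded continuous_on_iff, rule_format, of c "e / 2"] e c by auto
    obtain N :: nat where N: "1 / \<delta> < real N" using reals_Archimedean2 by blast
    show "\<exists>N. \<forall>n\<ge>N. norm (integral {a..b+1} (\<lambda>t. k c n t *\<^sub>R u t) - u c) < e"
    proof (intro exI[of _ N] allI impI)
      fix n assume n: "n \<ge> N"
      have Ik: "(k c n has_integral (\<theta> (real (Suc n) * (b + 1 - c)) - \<theta> (real (Suc n) * (a - c)))) {a..b+1}"
      proof (rule fundamental_theorem_of_calculus)
        show "((\<lambda>t. \<theta> (real (Suc n) * (t - c))) has_vector_derivative k c n t) (at t within {a..b+1})" for t
          using has_field_derivative_at_within[OF dk]
          by (simp only: has_real_derivative_iff_has_vector_derivative)
      qed (use ab in simp)
      moreover have "\<theta> (real (Suc n) * (b + 1 - c)) = 1" using c ge[of "b + 1 - c" n] by (intro \<theta>(3)) auto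
      moreover have "\<theta> (real (Suc n) * (a - c)) = 0" using c le[of "a - c" n] by (intro \<theta>(2)) auto
      ultimately have Ik: "(k c n has_integral 1) {a..b+1}" by simp
      have I1: "((\<lambda>t. k c n t *\<^sub>R u t) has_integral (integral {a..b+1} (\<lambda>t. k c n t *\<^sub>R u t))) {a..b+1}"
        by (intro integrable_integral integrable_continuous_real continuous_intros ck cu)
      have I2: "((\<lambda>t. k c n t *\<^sub>R u c) has_integral (1 *\<^sub>R u c)) {a..b+1}"
        by (rule has_integral_scaleR_left[OF Ik])
      have I3: "((\<lambda>t. k c n t *\<^sub>R u t - k c n t *\<^sub>R u c) has_integral
          (integral {a..b+1} (\<lambda>t. k c n t *\<^sub>R u t) - u c)) {a..b+1}"
        using has_integral_diff[OF I1 I2] by simp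
      have I4: "((\<lambda>t. k c n t * (e / 2)) has_integral (1 * (e / 2))) {a..b+1}"
        by (rule has_integral_mult_left[OF Ik])
      have "norm (integral {a..b+1} (\<lambda>t. k c n t *\<^sub>R u t - k c n t *\<^sub>R u c))
          \<le> integral {a..b+1} (\<lambda>t. k c n t * (e / 2))"
      proof (rule integral_norm_bound_integral)
        fix t assume t: "t \<in> {a..b+1}"
        have k0: "0 \<le> k c n t" unfolding k_def using \<theta>(4) by simp
        show "norm (k c n t *\<^sub>R u t - k c n t *\<^sub>R u c) \<le> k c n t * (e / 2)"
        proof (cases "k c n t = 0")
          case False
          have "\<not> (t < c)"
          proof
            assume "t < c"
            have "((\<lambda>x. 0) has_real_derivative 0) (at t)" by simp
            then have "((\<lambda>t. \<theta> (real (Suc n) * (t - c))) has_real_derivative 0) (at t)"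
              by (rule has_field_derivative_transform_within_open[of _ _ _ "{..<c}"])
                 (use \<open>t < c\<close> \<theta>(2) le in auto)
            then show False using DERIV_unique[OF dk] False by blast
          qed
          moreover have "\<not> (c + 1 / real (Suc n) < t)"
          proof
            assume *: "c + 1 / real (Suc n) < t"
            have "((\<lambda>x. 1) has_real_derivative 0) (at t)" by simp
            then have "((\<lambda>t. \<theta> (real (Suc n) * (t - c))) has_real_derivative 0) (at t)"
            proof (rule has_field_derivative_transform_within_open[of _ _ _ "{c + 1 / real (Suc n)<..}"])
              fix s assume "s \<in> {c + 1 / real (Suc n)<..}"
              then have "1 / real (Suc n) \<le> s - c" by simp
              then have "1 \<le> real (Suc n) * (s - c)" by (simp add: divide_le_eq mult.commute)
              then show "1 = \<theta> (real (Suc n) * (s - c))" using \<theta>(3) by simp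
            qed (use * in auto)
            then show False using DERIV_unique[OF dk] False by blast
          qed
          moreover have "1 / real (Suc n) < \<delta>"
          proof -
            have "1 / \<delta> < real (Suc n)" using N n by linarith
            then show ?thesis using \<delta>(1) by (simp add: field_simps)
          qed
          ultimately have "dist t c < \<delta>" by (auto simp: dist_real_def)
          then have "norm (u t - u c) \<le> e / 2" using \<delta>(2)[OF t] by (simp add: dist_norm)
          then show ?thesis
            unfolding scaleR_diff_right[symmetric] norm_scaleR abs_of_nonneg[OF k0]
            by (rule mult_left_mono[OF _ k0])
        qed simp
      qed (use I3 I4 in blast)+
      then have "norm (integral {a..b+1} (\<lambda>t. k c n t *\<^sub>R u t) - u c) \<le> e / 2"
        unfolding integral_unique[OF I3] integral_unique[OF I4] by simp
      then show "norm (integral {a..b+1} (\<lambda>t. k c n t *\<^sub>R u t) - u c) < e" using e by linarith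
    qed
  qed
  have L: "(LINT t|half_line. deriv (\<eta> n) t *\<^sub>R u t) =
      integral {a..b+1} (\<lambda>t. k a n t *\<^sub>R u t) - integral {a..b+1} (\<lambda>t. k b n t *\<^sub>R u t)" for n
  proof -
    have d0: "deriv (\<eta> n) t = 0" if t: "t \<notin> {a..b+1}" for t
    proof -
      have "((\<lambda>t. 0) has_real_derivative 0) (at t)" by simp
      then have "(\<eta> n has_real_derivative 0) (at t)"
        by (rule has_field_derivative_transform_within_open[of _ _ _ "- {a..b+1}"])
           (use t \<eta>0 in auto)
      then show ?thesis by (rule DERIV_imp_deriv)
    qed
    have "continuous_on S (deriv (\<eta> n))" for S
      unfolding d\<eta>[abs_def] by (intro continuous_intros ck)
    note cd = this
    have "(LINT t|half_line. deriv (\<eta> n) t *\<^sub>R u t) = integral {a..b+1} (\<lambda>t. deriv (\<eta> n) t *\<^sub>R u t)"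
    proof (rule half_line_integral_compact)
      show "(\<lambda>t. deriv (\<eta> n) t *\<^sub>R u t) \<in> borel_measurable half_line"
        by (intro borel_measurable_scaleR continuous_measurable_half_line cd continuous_measurable_open_half_line u)
      show "(\<lambda>t. deriv (\<eta> n) t *\<^sub>R u t) absolutely_integrable_on {a..b+1}"
        by (intro absolutely_integrable_continuous_Icc continuous_intros cd cu)
    qed (use d0 ab in auto)
    also have "\<dots> = integral {a..b+1} (\<lambda>t. k a n t *\<^sub>R u t - k b n t *\<^sub>R u t)"
      by (simp add: d\<eta> scaleR_diff_left)
    also have "\<dots> = integral {a..b+1} (\<lambda>t. k a n t *\<^sub>R u t) - integral {a..b+1} (\<lambda>t. k b n t *\<^sub>R u t)"
      by (intro Henstock_Kurzweil_Integration.integral_diff integrable_continuous_real continuous_intros ck cu)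
    finally show ?thesis .
  qed
  have "(\<lambda>n. LINT t|half_line. deriv (\<eta> n) t *\<^sub>R u t) \<longlonglongrightarrow> u a - u b"
    unfolding L using ab by (intro tendsto_diff delta) auto
  moreover have "(\<lambda>n. LINT t|half_line. deriv (\<eta> n) t *\<^sub>R u t) \<longlonglongrightarrow> - (LINT t|half_line. indicator {a<..b} t *\<^sub>R v t)"
    unfolding wd' by (intro tendsto_minus R)
  ultimately have "u a - u b = - (LINT t|half_line. indicator {a<..b} t *\<^sub>R v t)"
    by (rule LIMSEQ_unique)
  moreover have "(LINT t|half_line. indicator {a<..b} t *\<^sub>R v t) = integral {a..b} (\<lambda>t. indicator {a<..b} t *\<^sub>R v t)"
  proof (rule half_line_integral_compact)
    show "(\<lambda>t. indicator {a<..b} t *\<^sub>R v t) \<in> borel_measurable half_line"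
      using mv by (intro borel_measurable_scaleR) (auto simp: half_line_def intro: measurable_restrict_space1)
    have "v absolutely_integrable_on {a<..b}"
      by (rule set_integrable_subset[OF L2_half_integrable_interval[OF v, of a b]]) (use ab in auto)
    then have "(\<lambda>t. indicator {a<..b} t *\<^sub>R v t) absolutely_integrable_on UNIV"
      unfolding set_integrable_def by simp
    then show "(\<lambda>t. indicator {a<..b} t *\<^sub>R v t) absolutely_integrable_on {a..b}"
      by (rule set_integrable_subset) auto
  qed (use ab in \<open>auto simp: indicator_def\<close>)
  moreover have "integral {a..b} (\<lambda>t. indicator {a<..b} t *\<^sub>R v t) = integral {a..b} v"
    by (rule integral_spike[of "{a}"]) (auto simp: indicator_def)
  ultimately have "integral {a..b} v = u b - u a" by (simp add: algebra_simps)
  moreover have "v integrable_on {a..b}"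
    using L2_half_integrable_interval[OF v, of a b] ab by (simp add: absolutely_integrable_on_def)
  ultimately show ?thesis by (simp add: has_integral_iff)
qed

lemma ac_has_vector_derivative_at:
  assumes "ac {0..} u u1" "continuous_on {0..} u1" "0 < t"
  shows "(u has_vector_derivative u1 t) (at t)"
proof -
  have "at t within {0..} = at t" by (rule at_within_interior) (use assms(3) in auto)
  then show ?thesis using ac_vector_derivative[OF assms(1,2), of t] assms(3) by simp
qed

text \<open>\<open>vertex_deriv\<close> is defined through \<open>Lim\<close>, which carries
  information only if the limit exists. Here it does, and it is the boundary value of the continuous
  derivative.\<close>

lemma ac_vertex_limit:
  assumes "ac {0..} u u1" "continuous_on {0..} u1"
  shows "Lim (at_right 0) (\<lambda>t. vector_derivative u (at t)) = u1 0"
proof (rule tendsto_Lim)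
  have "(u1 \<longlongrightarrow> u1 0) (at_right 0)"
    using assms(2) by (auto simp: continuous_on_def at_within_Ici_at_right[symmetric])
  moreover have "\<forall>\<^sub>F t in at_right 0. u1 t = vector_derivative u (at t)"
    by (rule eventually_at_right_less[THEN eventually_mono])
       (metis ac_has_vector_derivative_at[OF assms] vector_derivative_at)
  ultimately show "((\<lambda>t. vector_derivative u (at t)) \<longlongrightarrow> u1 0) (at_right 0)"
    by (rule Lim_transform_eventually)
qed simp

text \<open>The weak derivative v is only a class, so the classical derivative D of the regular
  representative takes its place: testing with \<eta>' shows that D, too, has weak derivative w.
  Thus D is the integral of w away from 0, and since w is integrable up to 0, D extends continuously
  to the vertex.\<close>

lemma W22_regular:
  assumes W: "W22_derivs u v w" and c: "continuous_on {0..} u" and C1: "u C1_differentiable_on {0<..}"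
  obtains u1 where "ac {0..} u u1" "ac {0..} u1 w"
proof -
  have uv: "weak_deriv u v" and vw: "weak_deriv v w" and w: "w \<in> L2_half"
    using W by (auto simp: W22_derivs_def)
  obtain D where D: "\<And>t. 0 < t \<Longrightarrow> (u has_vector_derivative D t) (at t)" "continuous_on {0<..} D"
    using C1 by (auto simp: C1_differentiable_on_def)
  have wi: "w integrable_on {a..b}" if "0 \<le> a" for a b
    using L2_half_integrable_interval[OF w that, of b] by (simp add: absolutely_integrable_on_def)
  have cD: "D absolutely_integrable_on {a..b}" if "0 < a" for a b
    by (intro absolutely_integrable_continuous_Icc continuous_on_subset[OF D(2)]) (use that in auto)
  have "weak_deriv D w" unfolding weak_deriv_def
  proof
    fix \<eta> assume \<eta>: "\<eta> \<in> test_functions"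
    have d\<eta>: "deriv \<eta> \<in> test_functions" by (rule test_function_deriv[OF \<eta>])
    have "(LINT t|half_line. deriv (deriv \<eta>) t *\<^sub>R u t) = - (LINT t|half_line. deriv \<eta> t *\<^sub>R D t)"
    proof (rule half_line_test_parts[OF d\<eta> _ continuous_measurable_open_half_line[OF D(2)] cD])
      show "continuous_on {0<..} u" by (rule continuous_on_subset[OF c]) auto
      show "ac {a..b} u D" if "0 < a" for a b
        by (rule acI_vector_derivative)
           (use that D(1) in \<open>auto simp: is_interval_cc intro: has_vector_derivative_at_within\<close>)
    qed
    moreover have "(LINT t|half_line. deriv (deriv \<eta>) t *\<^sub>R u t) = - (LINT t|half_line. deriv \<eta> t *\<^sub>R v t)"
      using uv d\<eta> by (simp add: weak_deriv_def)
    moreover have "(LINT t|half_line. deriv \<eta> t *\<^sub>R v t) = - (LINT t|half_line. \<eta> t *\<^sub>R w t)"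
      using vw \<eta> by (simp add: weak_deriv_def)
    ultimately show "(LINT t|half_line. deriv \<eta> t *\<^sub>R D t) = - (LINT t|half_line. \<eta> t *\<^sub>R w t)" by simp
  qed
  note Dw = weak_deriv_imp_ac[OF this D(2) w]
  define c0 where "c0 = D 1 - integral {0..1} w"
  define u1 where "u1 t = c0 + integral {0..t} w" for t
  have ac1: "ac {0..} u1 w" unfolding u1_def[abs_def] by (rule ac_primitive) (simp add: wi)
  have eq: "u1 t = D t" if t: "0 < t" for t
  proof -
    have "integral {0..t} w - integral {0..1} w = D t - D 1"
    proof (cases "t \<le> 1")
      case True
      have "integral {0..t} w + integral {t..1} w = integral {0..1} w"
        using True t by (intro Henstock_Kurzweil_Integration.integral_combine wi) auto
      then show ?thesis using integral_unique[OF Dw[OF t True]] by (simp add: algebra_simps)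
    next
      case False
      have "integral {0..1} w + integral {1..t} w = integral {0..t} w"
        using False t by (intro Henstock_Kurzweil_Integration.integral_combine wi) auto
      then show ?thesis using integral_unique[OF Dw[of 1 t]] False by (simp add: algebra_simps)
    qed
    then show ?thesis by (simp add: u1_def c0_def algebra_simps)
  qed
  have "ac {0..} u u1" unfolding ac_def
  proof (intro ballI impI)
    fix a b :: real assume ab: "a \<in> {0..}" "b \<in> {0..}" "a \<le> b"
    show "(u1 has_integral u b - u a) {a..b}"
    proof (rule fundamental_theorem_of_calculus_interior[OF ab(3)])
      show "continuous_on {a..b} u" by (rule continuous_on_subset[OF c]) (use ab in auto)
      show "(u has_vector_derivative u1 t) (at t)" if "t \<in> {a<..<b}" for t
        using D(1)[of t] eq[of t] that ab by simp
    qed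
  qed
  then show thesis using ac1 that by blast
qed

lemma ac_weak_deriv:
  assumes "ac {0..} u u1" and u1: "u1 \<in> L2_half"
  shows "weak_deriv u u1"
  unfolding weak_deriv_def
proof
  fix \<eta> assume "\<eta> \<in> test_functions"
  then show "(LINT t|half_line. deriv \<eta> t *\<^sub>R u t) = - (LINT t|half_line. \<eta> t *\<^sub>R u1 t)"
  proof (rule half_line_test_parts)
    show "continuous_on {0<..} u" by (rule continuous_on_subset[OF ac_continuous[OF assms(1)]]) auto
    show "u1 \<in> borel_measurable half_line" by (rule L2_half_meas[OF u1])
    show "u1 absolutely_integrable_on {a..b}" if "0 < a" for a b
      by (rule L2_half_integrable_interval[OF u1]) (use that in auto)
    show "ac {a..b} u u1" if "0 < a" for a b
      by (rule ac_subset[OF assms(1)]) (use that in auto)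
  qed
qed

lemma W22_derivsI:
  assumes u: "u \<in> L2_half" "ac {0..} u u1" and w: "w \<in> L2_half" "ac {0..} u1 w"
  shows "W22_derivs u u1 w" "continuous_on {0..} u" "u C1_differentiable_on {0<..}"
proof -
  have u1: "u1 \<in> L2_half" by (rule L2_half_deriv[OF u w])
  show "W22_derivs u u1 w" unfolding W22_derivs_def
    using u w u1 by (auto intro: ac_weak_deriv)
  show "continuous_on {0..} u" by (rule ac_continuous[OF u(2)])
  have c1: "continuous_on {0..} u1" by (rule ac_continuous[OF w(2)])
  show "u C1_differentiable_on {0<..}"
    unfolding C1_differentiable_on_def
    by (intro exI[of _ u1] conjI ballI ac_has_vector_derivative_at[OF u(2) c1] continuous_on_subset[OF c1]) auto
qed

subsection \<open>Schroedinger operators with vertex conditions \<open>f(a) \<in> N\<close>, \<open>f'(a) \<in> N\<^sup>\<bottom>\<close>\<close>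

lemma star_L2_abs_eq_iff:
  assumes "\<And>n. f n \<in> L2_half" "\<And>n. g n \<in> L2_half"
  shows "abs_star_L2 f = abs_star_L2 g \<longleftrightarrow> (\<forall>n. AE t in half_line. f n t = g n t)"
  using Quotient_rel[OF Quotient_star_L2, of f g] assms by (simp add: star_eq_def)

lemma star_L2_repE:
  obtains g where "G = abs_star_L2 g" "\<And>n. g n \<in> L2_half"
proof
  show "G = abs_star_L2 (rep_star_L2 G)" by (simp add: Quotient_abs_rep[OF Quotient_star_L2])
  show "rep_star_L2 G n \<in> L2_half" for n
    using Quotient_rep_reflp[OF Quotient_star_L2, of G] by (simp add: star_eq_def)
qed

lemma abs_star_L2_add:
  "(\<And>n. f n \<in> L2_half) \<Longrightarrow> (\<And>n. g n \<in> L2_half) \<Longrightarrow>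
    abs_star_L2 f + abs_star_L2 g = abs_star_L2 (\<lambda>n t. f n t + g n t)"
  by (rule plus_star_L2.abs_eq) (auto intro: star_eq_refl)

lemma abs_star_L2_scaleC:
  "(\<And>n. f n \<in> L2_half) \<Longrightarrow> scaleC_L2 c (abs_star_L2 f) = abs_star_L2 (\<lambda>n t. c * f n t)"
  by (rule scaleC_L2.abs_eq) (auto intro: star_eq_refl)

lemma abs_star_L2_scaleR:
  "(\<And>n. f n \<in> L2_half) \<Longrightarrow> r *\<^sub>R abs_star_L2 f = abs_star_L2 (\<lambda>n t. of_real r * f n t)"
  by (simp add: scaleR_star_L2_def abs_star_L2_scaleC)

lemma abs_star_L2_diff:
  "(\<And>n. f n \<in> L2_half) \<Longrightarrow> (\<And>n. g n \<in> L2_half) \<Longrightarrow>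
    abs_star_L2 f - abs_star_L2 g = abs_star_L2 (\<lambda>n t. f n t - g n t)"
  by (simp add: minus_star_L2_def abs_star_L2_scaleC L2_half_uminus abs_star_L2_add)

lemma norm_abs_star_L2:
  assumes "\<And>n. f n \<in> L2_half"
  shows "(norm (abs_star_L2 f))\<^sup>2 = (\<Sum>n\<in>UNIV. (l2 (f n))\<^sup>2)"
proof -
  have "star_eq f f" using assms by (rule star_eq_refl)
  then have "cinner_L2 (abs_star_L2 f) (abs_star_L2 f) = (\<Sum>n\<in>UNIV. LINT t|half_line. f n t * cnj (f n t))"
    by (intro cinner_L2.abs_eq)
  also have "\<dots> = (\<Sum>n\<in>UNIV. of_real ((l2 (f n))\<^sup>2))"
  proof (rule sum.cong[OF refl])
    fix n
    have "f n t * cnj (f n t) = complex_of_real ((cmod (f n t))\<^sup>2)" for t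
      using complex_norm_square[of "f n t"] by (simp only: of_real_power)
    then show "(LINT t|half_line. f n t * cnj (f n t)) = complex_of_real ((l2 (f n))\<^sup>2)"
      by (simp only: integral_complex_of_real l2_sq)
  qed
  finally have "Re (cinner_L2 (abs_star_L2 f) (abs_star_L2 f)) = (\<Sum>n\<in>UNIV. (l2 (f n))\<^sup>2)"
    by simp
  then show ?thesis unfolding power2_norm_eq_inner inner_star_L2_def .
qed

lemma l2_le_norm_abs_star_L2:
  assumes "\<And>n. f n \<in> L2_half" shows "l2 (f n) \<le> norm (abs_star_L2 f)"
proof (rule power2_le_imp_le)
  show "(l2 (f n))\<^sup>2 \<le> (norm (abs_star_L2 f))\<^sup>2"
    unfolding norm_abs_star_L2[OF assms] by (rule member_le_sum) auto
qed simp

lemma pot_bounded: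
  assumes "pot V" obtains B where "\<And>t. 0 \<le> t \<Longrightarrow> \<bar>V t\<bar> \<le> B"
proof -
  have "continuous_on {0..1} V" using assms by (auto simp: pot_def intro: continuous_on_subset)
  then have "bounded (V ` {0..1})" by (intro compact_imp_bounded compact_continuous_image) auto
  then obtain B where B: "\<And>t. t \<in> {0..1} \<Longrightarrow> norm (V t) \<le> B" unfolding bounded_iff by blast
  have "\<bar>V t\<bar> \<le> max B 0" if "0 \<le> t" for t
  proof (cases "t \<le> 1")
    case True then show ?thesis using B[of t] that by auto
  next
    case False then show ?thesis using assms by (simp add: pot_def)
  qed
  then show thesis using that by blast
qed

lemma pot_mult_L2:
  assumes V: "pot V" and u: "u \<in> L2_half"
  shows "(\<lambda>t. of_real (V t) * u t) \<in> L2_half"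
proof -
  obtain B where "\<And>t. 0 \<le> t \<Longrightarrow> \<bar>V t\<bar> \<le> B" using pot_bounded[OF V] by blast
  then show ?thesis
    using V by (intro L2_half_bounded_mult[OF u, of _ B]) (auto simp: pot_def intro!: continuous_intros)
qed

lemma edge_rhs_L2:
  assumes "pot V" "u \<in> L2_half" "g \<in> L2_half"
  shows "(\<lambda>t. (of_real (V t) - \<zeta>) * u t - g t) \<in> L2_half"
  using L2_half_diff[OF L2_half_diff[OF pot_mult_L2[OF assms(1,2)] L2_half_scale[OF assms(2), of \<zeta>]] assms(3)]
  by (simp add: left_diff_distrib)

lemma edge_sol_bounded:
  assumes V: "pot V" and g: "g \<in> L2_half" and s: "edge_sol V \<zeta> g u u1" and t: "0 \<le> t"
  defines "K \<equiv> l2 (\<lambda>t. (of_real (V t) - \<zeta>) * u t - g t)"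
  shows "cmod (u1 t) \<le> 2 * l2 u + 2 * K" "cmod (u t) \<le> 3 * l2 u + 4 * K"
  using s t unfolding K_def
  by (auto simp: edge_sol_def edge_ode_def intro!: W22_pointwise_bounds edge_rhs_L2[OF V _ g])

lemma edge_sol_continuous:
  assumes "edge_sol V \<zeta> g u u1" shows "continuous_on {0..} u" "continuous_on {0..} u1"
  using assms by (auto simp: edge_sol_def edge_ode_def intro: ac_continuous)

lemma edge_sol_add:
  assumes "edge_sol V \<zeta> g u u1" "edge_sol V \<zeta> h v v1"
  shows "edge_sol V \<zeta> (\<lambda>t. g t + h t) (\<lambda>t. u t + v t) (\<lambda>t. u1 t + v1 t)"
proof -
  have "ac {0..} (\<lambda>t. u1 t + v1 t) (\<lambda>t. ((of_real (V t) - \<zeta>) * u t - g t) + ((of_real (V t) - \<zeta>) * v t - h t))"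
    using assms by (auto simp: edge_sol_def edge_ode_def intro: ac_add)
  moreover have "((of_real (V t) - \<zeta>) * u t - g t) + ((of_real (V t) - \<zeta>) * v t - h t) =
      (of_real (V t) - \<zeta>) * (u t + v t) - (g t + h t)" for t by (simp add: algebra_simps)
  ultimately show ?thesis
    using assms by (auto simp: edge_sol_def edge_ode_def intro: ac_add L2_half_add)
qed

lemma edge_sol_cmult:
  assumes "edge_sol V \<zeta> g u u1"
  shows "edge_sol V \<zeta> (\<lambda>t. c * g t) (\<lambda>t. c * u t) (\<lambda>t. c * u1 t)"
proof -
  have "ac {0..} (\<lambda>t. c * u1 t) (\<lambda>t. c * ((of_real (V t) - \<zeta>) * u t - g t))"
    using assms by (auto simp: edge_sol_def edge_ode_def intro: ac_cmult)
  moreover have "c * ((of_real (V t) - \<zeta>) * u t - g t) = (of_real (V t) - \<zeta>) * (c * u t) - c * g t" for t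
    by (simp add: algebra_simps)
  ultimately show ?thesis
    using assms by (auto simp: edge_sol_def edge_ode_def intro: ac_cmult L2_half_scale)
qed

text \<open>A real subspace closed under multiplication by i. The real structure gives access to
  orthonormal bases and to the equivalence of injectivity and surjectivity; the factor i is what
  makes the boundary term of the energy identity vanish.\<close>

definition complex_subspace :: "(complex ^ 3) set \<Rightarrow> bool" where
  "complex_subspace N \<longleftrightarrow> subspace N \<and> (\<forall>x\<in>N. (\<chi> n. \<i> * x $ n) \<in> N)"

text \<open>The inner product is the real one; on a complex subspace \<open>N\<close> it has the same orthogonal complement
  as the Hermitian one.\<close>

definition star_sol ::
  "real star_fun \<Rightarrow> (complex ^ 3) set \<Rightarrow> complex \<Rightarrow> complex star_fun \<Rightarrow> complex star_fun \<Rightarrow> complex star_fun \<Rightarrow> bool" where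
  "star_sol V N \<zeta> g f f1 \<longleftrightarrow> (\<forall>n. edge_sol (V n) \<zeta> (g n) (f n) (f1 n)) \<and>
     (\<chi> n. f n 0) \<in> N \<and> (\<forall>p\<in>N. p \<bullet> (\<chi> n. f1 n 0) = 0)"

text \<open>The two descriptions are compared only on functions whose derivative is continuous up to
  the vertex; for those \<open>f1 n 0\<close> is the true vertex derivative.\<close>

definition vertex_condition_of :: "(complex ^ 3) set \<Rightarrow> (complex star_fun \<Rightarrow> bool) \<Rightarrow> bool" where
  "vertex_condition_of N bc \<longleftrightarrow> (\<forall>f f1. (\<forall>n. ac {0..} (f n) (f1 n) \<and> continuous_on {0..} (f1 n)) \<longrightarrow>
     (bc f \<longleftrightarrow> (\<chi> n. f n 0) \<in> N \<and> (\<forall>p\<in>N. p \<bullet> (\<chi> n. f1 n 0) = 0)))"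

text \<open>Equality of classes in L2 gives the differential equation only almost everywhere. Since
  \<open>ac\<close> tolerates changing the derivative on a null set, the equation holds in
  integrated form without exception.\<close>

lemma schroedinger_op_iff:
  assumes V: "\<And>n. pot (V n)" and bc: "vertex_condition_of N bc" and g: "\<And>n. g n \<in> L2_half"
  shows "(F, abs_star_L2 g + scaleC_L2 \<zeta> F) \<in> schroedinger_op V bc \<longleftrightarrow>
    (\<exists>f f1. F = abs_star_L2 f \<and> star_sol V N \<zeta> g f f1)"
proof
  assume "(F, abs_star_L2 g + scaleC_L2 \<zeta> F) \<in> schroedinger_op V bc"
  then obtain f w where *: "\<And>n. \<exists>v. W22_derivs (f n) v (w n)" and reg: "regular_rep f" and b: "bc f"
    and F: "F = abs_star_L2 f"
    and G: "abs_star_L2 g + scaleC_L2 \<zeta> F = abs_star_L2 (\<lambda>n t. - w n t + of_real (V n t) * f n t)"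
    by (auto simp: schroedinger_op_def)
  have f: "f n \<in> L2_half" and w: "w n \<in> L2_half" for n using *[of n] by (auto simp: W22_derivs_def)
  have "\<exists>u1. ac {0..} (f n) u1 \<and> ac {0..} u1 (w n)" for n
    using *[of n] reg W22_regular[of "f n" _ "w n"] unfolding regular_rep_def by metis
  then obtain f1 where f1: "\<And>n. ac {0..} (f n) (f1 n)" "\<And>n. ac {0..} (f1 n) (w n)" by metis
  have "abs_star_L2 g + scaleC_L2 \<zeta> F = abs_star_L2 (\<lambda>n t. g n t + \<zeta> * f n t)"
    unfolding F by (simp add: abs_star_L2_scaleC f abs_star_L2_add g L2_half_scale)
  then have "abs_star_L2 (\<lambda>n t. g n t + \<zeta> * f n t) = abs_star_L2 (\<lambda>n t. - w n t + of_real (V n t) * f n t)"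
    using G by (rule trans[OF sym])
  moreover have "(\<lambda>t. g n t + \<zeta> * f n t) \<in> L2_half"
    "(\<lambda>t. - w n t + of_real (V n t) * f n t) \<in> L2_half" for n
    by (intro L2_half_add g L2_half_scale f L2_half_uminus w pot_mult_L2 V)+
  ultimately have eq: "AE t in half_line. g n t + \<zeta> * f n t = - w n t + of_real (V n t) * f n t" for n
    using star_L2_abs_eq_iff[of "\<lambda>n t. g n t + \<zeta> * f n t" "\<lambda>n t. - w n t + of_real (V n t) * f n t"]
    by blast
  have sol: "edge_sol (V n) \<zeta> (g n) (f n) (f1 n)" for n
  proof -
    obtain Z where Z: "negligible Z"
      "\<And>t. 0 \<le> t \<Longrightarrow> t \<notin> Z \<Longrightarrow> g n t + \<zeta> * f n t = - w n t + of_real (V n t) * f n t"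
      using AE_half_line_negligibleE[OF eq[of n]] by blast
    have "ac {0..} (f1 n) (\<lambda>t. (of_real (V n t) - \<zeta>) * f n t - g n t)"
      unfolding ac_def
    proof (intro ballI impI)
      fix a b :: real assume ab: "a \<in> {0..}" "b \<in> {0..}" "a \<le> b"
      show "((\<lambda>t. (of_real (V n t) - \<zeta>) * f n t - g n t) has_integral f1 n b - f1 n a) {a..b}"
      proof (rule has_integral_spike[OF Z(1) _ acD[OF f1(2) ab]])
        fix t assume t: "t \<in> {a..b} - Z"
        show "(of_real (V n t) - \<zeta>) * f n t - g n t = w n t"
          using Z(2)[of t] t ab by (simp add: algebra_simps)
      qed
    qed
    then show ?thesis using f f1 by (simp add: edge_sol_def edge_ode_def)
  qed
  moreover have "continuous_on {0..} (f1 n)" for n using f1(2) by (rule ac_continuous)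
  ultimately show "\<exists>f f1. F = abs_star_L2 f \<and> star_sol V N \<zeta> g f f1"
    using bc b f1(1) F unfolding vertex_condition_of_def star_sol_def by blast
next
  assume "\<exists>f f1. F = abs_star_L2 f \<and> star_sol V N \<zeta> g f f1"
  then obtain f f1 where F: "F = abs_star_L2 f" and s: "\<And>n. edge_sol (V n) \<zeta> (g n) (f n) (f1 n)"
    and N: "(\<chi> n. f n 0) \<in> N" "\<forall>p\<in>N. p \<bullet> (\<chi> n. f1 n 0) = 0" by (auto simp: star_sol_def)
  define w where "w n t = (of_real (V n t) - \<zeta>) * f n t - g n t" for n t
  have f: "f n \<in> L2_half" "ac {0..} (f n) (f1 n)" "ac {0..} (f1 n) (w n)" for n
    using s[of n] by (auto simp: edge_sol_def edge_ode_def w_def[abs_def])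
  have w: "w n \<in> L2_half" for n unfolding w_def[abs_def] by (rule edge_rhs_L2[OF V f(1) g])
  note W = W22_derivsI[OF f(1,2) w f(3)]
  have "\<forall>n. ac {0..} (f n) (f1 n) \<and> continuous_on {0..} (f1 n)"
    using f(2) ac_continuous[OF f(3)] by blast
  then have "bc f" using bc N unfolding vertex_condition_of_def by blast
  moreover have "regular_rep f" using W by (simp add: regular_rep_def)
  moreover have "\<forall>n. \<exists>v. W22_derivs (f n) v (w n)" using W(1) by blast
  moreover have "abs_star_L2 g + scaleC_L2 \<zeta> F = abs_star_L2 (\<lambda>n t. - w n t + of_real (V n t) * f n t)"
    unfolding F by (simp add: abs_star_L2_scaleC f abs_star_L2_add g L2_half_scale w_def algebra_simps)
  ultimately show "(F, abs_star_L2 g + scaleC_L2 \<zeta> F) \<in> schroedinger_op V bc"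
    unfolding schroedinger_op_def F by blast
qed

text \<open>Summed over the edges, the boundary terms Im (f' cnj f) of the energy identities form
  the real inner product of i f(a) with f'(a). It vanishes because i f(a) lies in \<open>N\<close>
  along with f(a).\<close>

lemma star_sol_bound:
  assumes V: "\<And>n. pot (V n)" and \<zeta>: "Im \<zeta> \<noteq> 0" and g: "\<And>n. g n \<in> L2_half"
    and N: "complex_subspace N" and s: "star_sol V N \<zeta> g f f1"
  shows "norm (abs_star_L2 f) \<le> norm (abs_star_L2 g) / \<bar>Im \<zeta>\<bar>"
proof -
  have e: "edge_sol (V n) \<zeta> (g n) (f n) (f1 n)" for n using s by (simp add: star_sol_def)
  have f: "f n \<in> L2_half" for n using e by (simp add: edge_sol_def)
  have "(\<chi> n. \<i> * (\<chi> n. f n 0) $ n) \<in> N" using N s by (auto simp: complex_subspace_def star_sol_def)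
  then have "(\<chi> n. \<i> * f n 0) \<bullet> (\<chi> n. f1 n 0) = 0" using s by (auto simp: star_sol_def)
  moreover have "(\<chi> n. \<i> * f n 0) \<bullet> (\<chi> n. f1 n 0) = (\<Sum>n\<in>UNIV. Im (f1 n 0 * cnj (f n 0)))"
    by (simp add: inner_vec_def inner_complex_def algebra_simps)
  ultimately have z: "(\<Sum>n\<in>UNIV. Im (f1 n 0 * cnj (f n 0))) = 0" by simp
  let ?b = "\<lambda>n. Im (f1 n 0 * cnj (f n 0))"
  have "(norm (abs_star_L2 f))\<^sup>2 = (\<Sum>n\<in>UNIV. (l2 (f n))\<^sup>2)" by (rule norm_abs_star_L2[OF f])
  also have "\<dots> \<le> (\<Sum>n\<in>UNIV. 2 / \<bar>Im \<zeta>\<bar> * (sgn (Im \<zeta>) * ?b n) + (l2 (g n))\<^sup>2 / (Im \<zeta>)\<^sup>2)"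
  proof (rule sum_mono)
    fix n
    show "(l2 (f n))\<^sup>2 \<le> 2 / \<bar>Im \<zeta>\<bar> * (sgn (Im \<zeta>) * ?b n) + (l2 (g n))\<^sup>2 / (Im \<zeta>)\<^sup>2"
    proof (rule edge_energy_L2[OF _ \<zeta> g _ f])
      show "continuous_on {0..} (V n)" using V by (simp add: pot_def)
      show "edge_ode (V n) \<zeta> (g n) (f n) (f1 n)" using e by (simp add: edge_sol_def)
    qed (rule edge_sol_bounded(1)[OF V g e])
  qed
  also have "\<dots> = 2 / \<bar>Im \<zeta>\<bar> * (sgn (Im \<zeta>) * (\<Sum>n\<in>UNIV. ?b n)) + (\<Sum>n\<in>UNIV. (l2 (g n))\<^sup>2) / (Im \<zeta>)\<^sup>2"
    by (simp only: sum.distrib sum_distrib_left[symmetric] sum_divide_distrib[symmetric])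
  also have "\<dots> = (norm (abs_star_L2 g) / \<bar>Im \<zeta>\<bar>)\<^sup>2"
    unfolding z norm_abs_star_L2[OF g, symmetric] by (simp add: power_divide)
  finally show ?thesis by (rule power2_le_imp_le) simp
qed

lemma star_sol_add:
  assumes N: "complex_subspace N" and s: "star_sol V N \<zeta> g f f1" "star_sol V N \<zeta> h k k1"
  shows "star_sol V N \<zeta> (\<lambda>n t. g n t + h n t) (\<lambda>n t. f n t + k n t) (\<lambda>n t. f1 n t + k1 n t)"
proof -
  have "(\<chi> n. f n 0 + k n 0) = (\<chi> n. f n 0) + (\<chi> n. k n 0)"
    "(\<chi> n. f1 n 0 + k1 n 0) = (\<chi> n. f1 n 0) + (\<chi> n. k1 n 0)" by (simp_all add: vec_eq_iff)
  then show ?thesis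
    using s N by (auto simp: star_sol_def complex_subspace_def inner_add_right
        intro: edge_sol_add subspace_add)
qed

lemma star_sol_scaleR:
  assumes N: "complex_subspace N" and s: "star_sol V N \<zeta> g f f1"
  shows "star_sol V N \<zeta> (\<lambda>n t. of_real r * g n t) (\<lambda>n t. of_real r * f n t) (\<lambda>n t. of_real r * f1 n t)"
proof -
  have "(\<chi> n. of_real r * f n 0) = r *\<^sub>R (\<chi> n. f n 0)"
    "(\<chi> n. of_real r * f1 n 0) = r *\<^sub>R (\<chi> n. f1 n 0)"
    unfolding vec_eq_iff vec_lambda_beta vector_scaleR_component by (simp_all add: scaleR_conv_of_real)
  then show ?thesis
    using s N by (auto simp: star_sol_def complex_subspace_def intro: edge_sol_cmult subspace_scale)
qed

lemma star_sol_zero_imp_zero: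
  assumes V: "\<And>n. pot (V n)" and \<zeta>: "Im \<zeta> \<noteq> 0" and N: "complex_subspace N"
    and s: "star_sol V N \<zeta> (\<lambda>n t. 0) f f1" and t: "0 \<le> t"
  shows "f n t = 0"
proof -
  have e: "edge_sol (V n) \<zeta> (\<lambda>t. 0) (f n) (f1 n)" for n using s by (simp add: star_sol_def)
  have f: "f n \<in> L2_half" for n using e by (simp add: edge_sol_def)
  have "norm (abs_star_L2 (\<lambda>n t. 0)) = 0"
    using norm_abs_star_L2[of "\<lambda>n t. 0"] by (simp add: L2_half_zero l2_def)
  then have "norm (abs_star_L2 f) \<le> 0"
    using star_sol_bound[OF V \<zeta> L2_half_zero N s] by simp
  then have l0: "l2 (f n) = 0" using l2_le_norm_abs_star_L2[of f n, OF f] l2_nonneg[of "f n"] by linarith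
  have c: "continuous_on {0..} (f n)" by (rule edge_sol_continuous[OF e])
  have c': "continuous_on (cbox 0 (t + 1)) (\<lambda>s. (cmod (f n s))\<^sup>2)"
    by (intro continuous_intros continuous_on_subset[OF c]) auto
  have "integral {0..t+1} (\<lambda>s. (cmod (f n s))\<^sup>2) = 0"
    using L2_half_sq_interval(2)[OF f[of n] order_refl, of "t+1"] l0
      integral_nonneg[OF integrable_continuous_real[OF c'[unfolded box_real]]]
    by (metis antisym power_zero_numeral zero_le_power2)
  then have "((\<lambda>s. (cmod (f n s))\<^sup>2) has_integral 0) (cbox 0 (t + 1))"
    using integrable_integral[OF integrable_continuous_real[OF c'[unfolded box_real]]] by simp
  then have "(cmod (f n t))\<^sup>2 = 0"
    using t by (intro has_integral_0_cbox_imp_0[OF c']) auto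
  then show ?thesis by simp
qed

lemma star_sol_exists:
  assumes V: "\<And>n. pot (V n)" and \<zeta>: "Im \<zeta> \<noteq> 0" and N: "complex_subspace N" and g: "\<And>n. g n \<in> L2_half"
  obtains f f1 where "star_sol V N \<zeta> g f f1"
proof -
  have "\<forall>n. \<exists>y y1. edge_sol (V n) \<zeta> (g n) y y1" using edge_sol_exists[OF V \<zeta> g] by metis
  then obtain y y1 where y: "\<And>n. edge_sol (V n) \<zeta> (g n) (y n) (y1 n)" by metis
  have "\<forall>n. \<exists>h h1. edge_sol (V n) \<zeta> (\<lambda>t. 0) h h1 \<and> h 1 \<noteq> 0" using edge_sol_homogeneous[OF V \<zeta>] by metis
  then obtain h h1 where h: "\<And>n. edge_sol (V n) \<zeta> (\<lambda>t. 0) (h n) (h1 n)" "\<And>n. h n 1 \<noteq> 0" by metis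
  have subN: "subspace N" using N by (simp add: complex_subspace_def)
  obtain B where B: "B \<subseteq> N" "pairwise orthogonal B" "\<And>x. x \<in> B \<Longrightarrow> norm x = 1" "independent B" "span B = N"
    using orthonormal_basis_subspace[OF subN] by metis
  have finB: "finite B" using B(4) by (rule independent_imp_finite)
  \<comment> \<open>The orthogonal projection onto \<open>N\<close>, written in an orthonormal
    basis.\<close>
  define P where "P x = (\<Sum>b\<in>B. (x \<bullet> b) *\<^sub>R b)" for x :: "complex ^ 3"
  have PN: "P x \<in> N" for x unfolding P_def B(5)[symmetric]
    by (intro span_sum span_scale span_base)
  have orth: "p \<bullet> (x - P x) = 0" if "p \<in> N" for p x
  proof -
    have "b \<bullet> (x - P x) = 0" if b: "b \<in> B" for b
    proof -
      have "b \<bullet> P x = (\<Sum>c\<in>B. (x \<bullet> c) * (b \<bullet> c))" by (simp add: P_def inner_sum_right)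
      also have "\<dots> = (\<Sum>c\<in>B. if c = b then x \<bullet> b else 0)"
      proof (rule sum.cong[OF refl])
        fix c assume c: "c \<in> B"
        have "b \<bullet> b = 1" using B(3)[OF b] by (simp add: norm_eq_1)
        then show "(x \<bullet> c) * (b \<bullet> c) = (if c = b then x \<bullet> b else 0)"
          using B(2) b c by (auto simp: pairwise_def orthogonal_def)
      qed
      also have "\<dots> = x \<bullet> b" using finB b by simp
      finally show ?thesis by (simp add: inner_diff_right inner_commute)
    qed
    then have "orthogonal (x - P x) p" if "p \<in> span B" for p
      using that by (intro orthogonal_to_span[of p B]) (auto simp: orthogonal_def inner_commute)
    then show ?thesis using \<open>p \<in> N\<close> B(5) by (auto simp: orthogonal_def inner_commute)
  qed
  have linP: "linear P" unfolding P_def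
    by (rule linearI) (simp_all add: inner_add_left scaleR_add_left sum.distrib scaleR_sum_right)
  define A where "A c = (\<chi> n. c $ n * h n 0)" for c :: "complex ^ 3"
  define A1 where "A1 c = (\<chi> n. c $ n * h1 n 0)" for c :: "complex ^ 3"
  have linA: "linear A" "linear A1" unfolding A_def A1_def
    by (auto intro!: linearI simp: vec_eq_iff algebra_simps)
  define T where "T c = (A c - P (A c)) + P (A1 c)" for c
  have linT: "linear T" unfolding T_def
    using linear_compose[OF linA(1) linP] linear_compose[OF linA(2) linP] linA
    by (intro linear_compose_add linear_compose_sub) (auto simp: o_def)
  text \<open>The two summands of \<open>T\<close> lie in orthogonal subspaces, so \<open>T c = e\<close> encodes both vertex conditions.\<close>
  have split: "x = 0 \<and> z = 0" if "x + z = 0" "z \<in> N" "\<And>p. p \<in> N \<Longrightarrow> p \<bullet> x = 0" for x z :: "complex ^ 3"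
  proof -
    have "z \<bullet> (x + z) = 0" using that(1) by simp
    then have "z = 0" using that(3)[OF that(2)] by (simp add: inner_add_right)
    then show ?thesis using that(1) by simp
  qed
  have comb: "(\<chi> n. a n + c $ n * b n) = (\<chi> n. a n) + (\<chi> n. c $ n * b n)" for a b and c :: "complex ^ 3"
    by (simp add: vec_eq_iff)
  have key: "e0 + A c \<in> N \<and> (\<forall>p\<in>N. p \<bullet> (e1 + A1 c) = 0)" if T0: "T c + ((e0 - P e0) + P e1) = 0" for c e0 e1
  proof -
    have "((A c - P (A c)) + (e0 - P e0)) + (P (A1 c) + P e1) = 0" using T0 by (simp add: T_def algebra_simps)
    then have *: "(A c - P (A c)) + (e0 - P e0) = 0 \<and> P (A1 c) + P e1 = 0"
    proof (rule split)
      show "P (A1 c) + P e1 \<in> N" using PN subN by (simp add: subspace_add)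
      show "p \<bullet> ((A c - P (A c)) + (e0 - P e0)) = 0" if "p \<in> N" for p
        using orth[OF that] by (simp add: inner_add_right)
    qed
    then have "e0 + A c = P (A c) + P e0" by (simp add: algebra_simps)
    then have "e0 + A c \<in> N" using PN subN by (simp add: subspace_add)
    moreover have "p \<bullet> (e1 + A1 c) = 0" if "p \<in> N" for p
    proof -
      have "p \<bullet> (e1 + A1 c) = p \<bullet> (e1 - P e1) + p \<bullet> (A1 c - P (A1 c)) + p \<bullet> (P (A1 c) + P e1)"
        by (simp add: inner_add_right inner_diff_right)
      also have "\<dots> = 0"
        by (simp only: orth[OF that] conjunct2[OF *] inner_zero_right add_0)
      finally show ?thesis .
    qed
    ultimately show ?thesis by blast
  qed
  \<comment> \<open>A kernel vector yields a star solution with right-hand side 0. It vanishes by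
    the resolvent bound, and evaluation at 1, where no \<open>h n\<close> is 0, gives the vanishing
    of the coefficients.\<close>
  have "inj T"
  proof (rule linear_injective_0[OF linT, THEN iffD2], intro allI impI)
    fix c assume "T c = 0"
    then have "0 + A c \<in> N \<and> (\<forall>p\<in>N. p \<bullet> (0 + A1 c) = 0)"
      by (intro key) (simp add: linear_0[OF linP])
    moreover have "edge_sol (V n) \<zeta> (\<lambda>t. 0) (\<lambda>t. c $ n * h n t) (\<lambda>t. c $ n * h1 n t)" for n
      using edge_sol_cmult[OF h(1)[of n], of "c $ n"] by simp
    ultimately have "star_sol V N \<zeta> (\<lambda>n t. 0) (\<lambda>n t. c $ n * h n t) (\<lambda>n t. c $ n * h1 n t)"
      by (auto simp: star_sol_def A_def A1_def)
    then have "c $ n * h n 1 = 0" for n by (rule star_sol_zero_imp_zero[OF V \<zeta> N]) simp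
    then show "c = 0" using h(2) by (simp add: vec_eq_iff)
  qed
  then have "surj T" by (rule linear_injective_imp_surjective[OF linT _ refl])
  define e0 where "e0 = (\<chi> n. y n 0)"
  define e1 where "e1 = (\<chi> n. y1 n 0)"
  obtain c where "T c = - ((e0 - P e0) + P e1)" using \<open>surj T\<close> by (metis surj_def)
  then have "T c + ((e0 - P e0) + P e1) = 0" by simp
  note k = key[OF this]
  have "star_sol V N \<zeta> (\<lambda>n t. g n t + c $ n * 0) (\<lambda>n t. y n t + c $ n * h n t) (\<lambda>n t. y1 n t + c $ n * h1 n t)"
    unfolding star_sol_def
  proof (intro conjI allI)
    show "edge_sol (V n) \<zeta> (\<lambda>t. g n t + c $ n * 0) (\<lambda>t. y n t + c $ n * h n t) (\<lambda>t. y1 n t + c $ n * h1 n t)" for n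
      by (rule edge_sol_add[OF y edge_sol_cmult[OF h(1)]])
  qed (use k in \<open>simp_all add: comb e0_def e1_def A_def A1_def\<close>)
  then have "star_sol V N \<zeta> g (\<lambda>n t. y n t + c $ n * h n t) (\<lambda>n t. y1 n t + c $ n * h1 n t)"
    by (simp only: mult_zero_right add_0_right)
  then show thesis by (rule that)
qed

text \<open>\<open>star_sol\<close> is the resolvent equation together with the vertex conditions,
  so the resolvent is its solution operator. Uniqueness and boundedness both come from the a priori
  bound, linearity from uniqueness.\<close>

lemma schroedinger_op_resolvent:
  assumes V: "\<And>n. pot (V n)" and \<zeta>: "Im \<zeta> \<noteq> 0" and N: "complex_subspace N"
    and bc: "vertex_condition_of N bc"
  defines "H \<equiv> schroedinger_op V bc"
  shows "\<And>g f f1. (\<And>n. g n \<in> L2_half) \<Longrightarrow> star_sol V N \<zeta> g f f1 \<Longrightarrow>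
      resolvent H \<zeta> (abs_star_L2 g) = abs_star_L2 f"
    and "norm (resolvent H \<zeta> G) \<le> norm G / \<bar>Im \<zeta>\<bar>"
    and "\<zeta> \<in> resolvent_set H"
proof -
  note iff = schroedinger_op_iff[where V=V, OF V bc, folded H_def]
  have fL: "f n \<in> L2_half" if "star_sol V N \<zeta> g f f1" for g f f1 n
    using that by (simp add: star_sol_def edge_sol_def)
  have uniq: "abs_star_L2 f = abs_star_L2 k"
    if g: "\<And>n. g n \<in> L2_half" and s: "star_sol V N \<zeta> g f f1" "star_sol V N \<zeta> g k k1" for g f f1 k k1
  proof -
    have "star_sol V N \<zeta> (\<lambda>n t. g n t + of_real (- 1) * g n t) (\<lambda>n t. f n t + of_real (- 1) * k n t)
        (\<lambda>n t. f1 n t + of_real (- 1) * k1 n t)"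
      by (intro star_sol_add[OF N] star_sol_scaleR[OF N] s)
    then have d: "star_sol V N \<zeta> (\<lambda>n t. 0) (\<lambda>n t. f n t - k n t) (\<lambda>n t. f1 n t - k1 n t)" by simp
    then have "f n t = k n t" if "0 \<le> t" for n t
      using star_sol_zero_imp_zero[OF V \<zeta> N d that, of n] by simp
    then show ?thesis
      by (subst star_L2_abs_eq_iff) (auto simp: AE_half_line_iff fL[OF s(1)] fL[OF s(2)])
  qed
  have ex1: "\<exists>!F. (F, abs_star_L2 g + scaleC_L2 \<zeta> F) \<in> H" if g: "\<And>n. g n \<in> L2_half" for g
  proof -
    obtain f f1 where s: "star_sol V N \<zeta> g f f1" by (rule star_sol_exists[OF V \<zeta> N g])
    show ?thesis
    proof (rule ex1I[of _ "abs_star_L2 f"])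
      show "(abs_star_L2 f, abs_star_L2 g + scaleC_L2 \<zeta> (abs_star_L2 f)) \<in> H"
        unfolding iff[where g=g, OF g] using s by blast
      fix F assume "(F, abs_star_L2 g + scaleC_L2 \<zeta> F) \<in> H"
      then obtain k k1 where k: "F = abs_star_L2 k" "star_sol V N \<zeta> g k k1"
        unfolding iff[where g=g, OF g] by blast
      show "F = abs_star_L2 f" unfolding k(1) by (rule uniq[OF g k(2) s])
    qed
  qed
  show R: "resolvent H \<zeta> (abs_star_L2 g) = abs_star_L2 f"
    if g: "\<And>n. g n \<in> L2_half" and s: "star_sol V N \<zeta> g f f1" for g f f1
    unfolding resolvent_def
  proof (rule the1_equality[OF ex1[OF g]])
    show "(abs_star_L2 f, abs_star_L2 g + scaleC_L2 \<zeta> (abs_star_L2 f)) \<in> H"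
      unfolding iff[where g=g, OF g] using s by blast
  qed
  have bound: "norm (resolvent H \<zeta> G) \<le> norm G / \<bar>Im \<zeta>\<bar>" for G
  proof -
    obtain g where g: "G = abs_star_L2 g" "\<And>n. g n \<in> L2_half" using star_L2_repE by blast
    obtain f f1 where s: "star_sol V N \<zeta> g f f1" by (rule star_sol_exists[OF V \<zeta> N g(2)])
    show ?thesis unfolding g(1) R[OF g(2) s] by (rule star_sol_bound[OF V \<zeta> g(2) N s])
  qed
  then show "norm (resolvent H \<zeta> G) \<le> norm G / \<bar>Im \<zeta>\<bar>" .
  have "bounded_linear (resolvent H \<zeta>)"
  proof (rule bounded_linear_intro)
    fix G1 G2
    obtain g1 where g1: "G1 = abs_star_L2 g1" "\<And>n. g1 n \<in> L2_half" using star_L2_repE by blast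
    obtain g2 where g2: "G2 = abs_star_L2 g2" "\<And>n. g2 n \<in> L2_half" using star_L2_repE by blast
    obtain f1 d1 where s1: "star_sol V N \<zeta> g1 f1 d1" by (rule star_sol_exists[OF V \<zeta> N g1(2)])
    obtain f2 d2 where s2: "star_sol V N \<zeta> g2 f2 d2" by (rule star_sol_exists[OF V \<zeta> N g2(2)])
    have "resolvent H \<zeta> (G1 + G2) = abs_star_L2 (\<lambda>n t. f1 n t + f2 n t)"
      unfolding g1(1) g2(1) abs_star_L2_add[OF g1(2) g2(2)]
      by (rule R[OF _ star_sol_add[OF N s1 s2]]) (intro L2_half_add g1 g2)
    then show "resolvent H \<zeta> (G1 + G2) = resolvent H \<zeta> G1 + resolvent H \<zeta> G2"
      unfolding g1(1) g2(1) R[OF g1(2) s1] R[OF g2(2) s2] abs_star_L2_add[OF fL[OF s1] fL[OF s2]] by simp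
    fix r :: real
    have "resolvent H \<zeta> (r *\<^sub>R G1) = abs_star_L2 (\<lambda>n t. of_real r * f1 n t)"
      unfolding g1(1) abs_star_L2_scaleR[OF g1(2)]
      by (rule R[OF _ star_sol_scaleR[OF N s1]]) (intro L2_half_scale g1)
    then show "resolvent H \<zeta> (r *\<^sub>R G1) = r *\<^sub>R resolvent H \<zeta> G1"
      unfolding g1(1) R[OF g1(2) s1] abs_star_L2_scaleR[OF fL[OF s1]] by simp
    show "norm (resolvent H \<zeta> G1) \<le> norm G1 * (1 / \<bar>Im \<zeta>\<bar>)" using bound[of G1] by simp
  qed
  moreover have "\<exists>!F. (F, G + scaleC_L2 \<zeta> F) \<in> H" for G
  proof -
    obtain g where g: "G = abs_star_L2 g" "\<And>n. g n \<in> L2_half" using star_L2_repE by blast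
    show ?thesis unfolding g(1) by (rule ex1[OF g(2)])
  qed
  ultimately show "\<zeta> \<in> resolvent_set H" by (simp add: resolvent_set_def)
qed

subsection \<open>The scaled potential near the vertex\<close>

text \<open>Zero-energy solutions, y'' = q y, on the unscaled edge. Taking them real makes the space
  of end values closed under conjugation.\<close>

definition ode_pair :: "(real \<Rightarrow> real) \<Rightarrow> (real \<Rightarrow> real) \<Rightarrow> (real \<Rightarrow> real) \<Rightarrow> bool" where
  "ode_pair q y y1 \<longleftrightarrow> (\<forall>t\<in>{0..1}. (y has_real_derivative y1 t) (at t within {0..1}) \<and>
     (y1 has_real_derivative q t * y t) (at t within {0..1}))"

lemma ode_pair_continuous:
  assumes "ode_pair q y y1" shows "continuous_on {0..1} y" "continuous_on {0..1} y1"
  using assms unfolding ode_pair_def by (auto intro: DERIV_continuous_on)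

lemma ode_pair_exists:
  assumes q: "continuous_on {0..1} q"
  obtains y y1 where "ode_pair q y y1" "y 1 = A" "y1 1 = B"
proof -
  have cq: "continuous_on {0..1} (\<lambda>t. complex_of_real (q t))" using q by (intro continuous_intros)
  have z: "(\<lambda>t::real. 0 :: complex) absolutely_integrable_on {0..1}"
    by (rule L2_half_integrable_interval[OF L2_half_zero order_refl])
  obtain x x1 where x: "x 1 = of_real A" "x1 1 = of_real B" "ac {0..1} x x1"
      "ac {0..1} x1 (\<lambda>t. of_real (q t) * x t - 0)"
    by (rule linear_ivp_backward[OF cq z])
  have c: "continuous_on {0..1} x" "continuous_on {0..1} x1" using x by (auto intro: ac_continuous_Icc)
  have "((\<lambda>t. Re (x t)) has_vector_derivative Re (x1 t)) (at t within {0..1})"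
       "((\<lambda>t. Re (x1 t)) has_vector_derivative Re (of_real (q t) * x t - 0)) (at t within {0..1})"
    if "t \<in> {0..1}" for t
    by (rule bounded_linear.has_vector_derivative[OF bounded_linear_Re] ac_vector_derivative_Icc
          x continuous_intros c cq that)+
  then have "ode_pair q (\<lambda>t. Re (x t)) (\<lambda>t. Re (x1 t))"
    by (simp add: ode_pair_def has_real_derivative_iff_has_vector_derivative)
  then show thesis by (rule that) (simp_all add: x)
qed

lemma ode_pair_wronskian:
  assumes "ode_pair q c c1" "ode_pair q s s1" "t \<in> {0..1}"
  shows "c t * s1 t - c1 t * s t = c 1 * s1 1 - c1 1 * s 1"
proof -
  have "((\<lambda>t. c t * s1 t - c1 t * s t) has_real_derivative 0) (at x within {0..1})" if "x \<in> {0..1}" for x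
    using assms(1,2) that unfolding ode_pair_def
    by (auto intro!: derivative_eq_intros simp: algebra_simps)
  then have "\<exists>k. \<forall>x\<in>{0..1}. c x * s1 x - c1 x * s x = k"
    by (intro has_field_derivative_zero_constant) auto
  then show ?thesis using assms(3) by (metis atLeastAtMost_iff order_refl zero_le_one)
qed

lemma ode_pair_scaled:
  assumes y: "ode_pair q y y1" and e: "0 < \<epsilon>"
  shows "ac {0..\<epsilon>} (\<lambda>t. of_real (y (t / \<epsilon>))) (\<lambda>t. of_real (y1 (t / \<epsilon>) / \<epsilon>))"
    "ac {0..\<epsilon>} (\<lambda>t. of_real (y1 (t / \<epsilon>) / \<epsilon>)) (\<lambda>t. of_real (q (t / \<epsilon>) / \<epsilon>\<^sup>2 * y (t / \<epsilon>)))"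
    "continuous_on {0..\<epsilon>} (\<lambda>t. y (t / \<epsilon>))" "continuous_on {0..\<epsilon>} (\<lambda>t. y1 (t / \<epsilon>))"
proof -
  have in01: "t / \<epsilon> \<in> {0..1}" if "t \<in> {0..\<epsilon>}" for t using that e by auto
  have chain: "((\<lambda>t. f (t / \<epsilon>)) has_real_derivative f' (t / \<epsilon>) / \<epsilon>) (at t within {0..\<epsilon>})"
    if "\<And>x. x \<in> {0..1} \<Longrightarrow> (f has_real_derivative f' x) (at x within {0..1})" "t \<in> {0..\<epsilon>}" for f f' t
  proof -
    have "(f has_real_derivative f' (t / \<epsilon>)) (at (t / \<epsilon>) within (\<lambda>t. t / \<epsilon>) ` {0..\<epsilon>})"
      by (rule has_field_derivative_subset[OF that(1)]) (use in01 that in auto)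
    moreover have "((\<lambda>t. t / \<epsilon>) has_real_derivative 1 / \<epsilon>) (at t within {0..\<epsilon>})"
      using e by (auto intro!: derivative_eq_intros)
    ultimately show ?thesis using DERIV_image_chain[of f _ "\<lambda>t. t / \<epsilon>"] by (fastforce simp: o_def)
  qed
  have d: "((\<lambda>t. y (t / \<epsilon>)) has_real_derivative y1 (t / \<epsilon>) / \<epsilon>) (at t within {0..\<epsilon>})"
    "((\<lambda>t. y1 (t / \<epsilon>)) has_real_derivative (q (t / \<epsilon>) * y (t / \<epsilon>)) / \<epsilon>) (at t within {0..\<epsilon>})"
    if "t \<in> {0..\<epsilon>}" for t
    using y chain[of y y1] chain[of y1 "\<lambda>t. q t * y t"] that by (auto simp: ode_pair_def)
  show "continuous_on {0..\<epsilon>} (\<lambda>t. y (t / \<epsilon>))" "continuous_on {0..\<epsilon>} (\<lambda>t. y1 (t / \<epsilon>))"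
    by (rule DERIV_continuous_on, erule d)+
  show "ac {0..\<epsilon>} (\<lambda>t. of_real (y (t / \<epsilon>))) (\<lambda>t. of_real (y1 (t / \<epsilon>) / \<epsilon>))"
    using d(1) by (intro acI_vector_derivative has_vector_derivative_of_real)
      (auto simp: has_real_derivative_iff_has_vector_derivative is_interval_cc)
  have "((\<lambda>t. y1 (t / \<epsilon>) / \<epsilon>) has_real_derivative q (t / \<epsilon>) / \<epsilon>\<^sup>2 * y (t / \<epsilon>)) (at t within {0..\<epsilon>})"
    if "t \<in> {0..\<epsilon>}" for t
    using DERIV_cdivide[OF d(2)[OF that], of \<epsilon>] by (simp add: power2_eq_square)
  then show "ac {0..\<epsilon>} (\<lambda>t. of_real (y1 (t / \<epsilon>) / \<epsilon>)) (\<lambda>t. of_real (q (t / \<epsilon>) / \<epsilon>\<^sup>2 * y (t / \<epsilon>)))"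
    by (intro acI_vector_derivative has_vector_derivative_of_real)
      (auto simp: has_real_derivative_iff_has_vector_derivative is_interval_cc)
qed

text \<open>The rescaled y solves the equation with the full potential q(t/\<epsilon>) /
  \<epsilon>^2, so the singular potential cancels in the derivative of u y' - u' y. What remains is
  \<zeta> u + g, integrated over a length of at most \<epsilon>.\<close>

lemma green_identity:
  assumes q: "continuous_on {0..1} q" and y: "ode_pair q y y1" and e: "0 < \<epsilon>"
    and u: "ac {0..\<epsilon>} u u1" "ac {0..\<epsilon>} u1 (\<lambda>t. (of_real (q (t / \<epsilon>) / \<epsilon>\<^sup>2) - \<zeta>) * u t - g t)"
    and g: "g absolutely_integrable_on {0..\<epsilon>}" and t: "t \<in> {0..\<epsilon>}"
  shows "((\<lambda>\<tau>. (\<zeta> * u \<tau> + g \<tau>) * of_real (y (\<tau> / \<epsilon>))) has_integral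
     (u \<epsilon> * of_real (y1 1 / \<epsilon>) - u1 \<epsilon> * of_real (y 1))
       - (u t * of_real (y1 (t / \<epsilon>) / \<epsilon>) - u1 t * of_real (y (t / \<epsilon>)))) {t..\<epsilon>}"
proof -
  note s = ode_pair_scaled[OF y e]
  have cu: "continuous_on {0..\<epsilon>} u" "continuous_on {0..\<epsilon>} u1" using u by (auto intro: ac_continuous_Icc)
  have cq: "continuous_on {0..\<epsilon>} (\<lambda>t. q (t / \<epsilon>))"
    by (rule continuous_on_compose2[OF q]) (use e in \<open>auto intro!: continuous_intros\<close>)
  have cqe: "continuous_on {0..\<epsilon>} (\<lambda>t. q (t / \<epsilon>) / \<epsilon>\<^sup>2)" using e by (intro continuous_intros cq) auto
  have w: "(\<lambda>t. (of_real (q (t / \<epsilon>) / \<epsilon>\<^sup>2) - \<zeta>) * u t - g t) absolutely_integrable_on {0..\<epsilon>}"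
    by (rule set_integral_diff(1)[OF absolutely_integrable_continuous_Icc g])
       (intro continuous_intros cqe cu)
  have "ac {0..\<epsilon>} (\<lambda>t. u t * of_real (y1 (t / \<epsilon>) / \<epsilon>) - u1 t * of_real (y (t / \<epsilon>)))
     (\<lambda>t. (u1 t * of_real (y1 (t / \<epsilon>) / \<epsilon>) + u t * of_real (q (t / \<epsilon>) / \<epsilon>\<^sup>2 * y (t / \<epsilon>)))
        - (((of_real (q (t / \<epsilon>) / \<epsilon>\<^sup>2) - \<zeta>) * u t - g t) * of_real (y (t / \<epsilon>)) + u1 t * of_real (y1 (t / \<epsilon>) / \<epsilon>)))"
    by (intro ac_diff ac_mult_Icc u s w absolutely_integrable_continuous_Icc cu continuous_intros cqe) (use e in auto)
  then have "ac {0..\<epsilon>} (\<lambda>t. u t * of_real (y1 (t / \<epsilon>) / \<epsilon>) - u1 t * of_real (y (t / \<epsilon>)))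
     (\<lambda>t. (\<zeta> * u t + g t) * of_real (y (t / \<epsilon>)))"
    by (rule ac_cong) (auto simp: algebra_simps is_interval_cc)
  from acD[OF this, of t \<epsilon>] show ?thesis using t e by simp
qed

text \<open>Green's identity with \<open>c\<close> (Neumann at the outer end) and with
  \<open>s\<close> (Dirichlet there) expresses the Cauchy data of u inside the small star by those
  at \<epsilon>. The second and third claims compare values and scaled derivatives at the vertex
  with \<open>u \<epsilon>\<close>. The fourth cannot be read off from them, as they would have to
  be divided by \<epsilon>: it is the identity for \<open>c\<close> itself, whose term with 1 /
  \<epsilon> is kept until summation over the edges removes it.\<close>

lemma inner_edge_estimates:
  fixes M :: real and \<zeta> :: complex
  assumes q: "continuous_on {0..1} q"
    and c: "ode_pair q c c1" "c 1 = 1" "c1 1 = 0" and s: "ode_pair q s s1" "s 1 = 0" "s1 1 = 1"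
    and M: "1 \<le> M" "\<And>t. t \<in> {0..1} \<Longrightarrow> \<bar>c t\<bar> \<le> M" "\<And>t. t \<in> {0..1} \<Longrightarrow> \<bar>c1 t\<bar> \<le> M"
      "\<And>t. t \<in> {0..1} \<Longrightarrow> \<bar>s t\<bar> \<le> M" "\<And>t. t \<in> {0..1} \<Longrightarrow> \<bar>s1 t\<bar> \<le> M"
    and e: "0 < \<epsilon>" "\<epsilon> \<le> 1" "4 * \<epsilon> * M\<^sup>2 * cmod \<zeta> \<le> 1"
    and u: "ac {0..\<epsilon>} u u1" "ac {0..\<epsilon>} u1 (\<lambda>t. (of_real (q (t / \<epsilon>) / \<epsilon>\<^sup>2) - \<zeta>) * u t - g t)"
    and g: "g absolutely_integrable_on {0..\<epsilon>}" "integral {0..\<epsilon>} (\<lambda>t. cmod (g t)) \<le> sqrt \<epsilon> * \<gamma>" and \<gamma>: "0 \<le> \<gamma>"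
  defines "\<sigma> \<equiv> cmod (u \<epsilon>) + cmod (u1 \<epsilon>) + \<gamma>" and "K \<equiv> 8 * M\<^sup>2 * (4 * M\<^sup>2 * cmod \<zeta> + 1)"
  shows "\<And>t. t \<in> {0..\<epsilon>} \<Longrightarrow> cmod (u t) \<le> K * \<sigma>"
    and "cmod (of_real (c 0) * u \<epsilon> - u 0) \<le> K * \<sigma> * \<epsilon>"
    and "cmod (of_real (c1 0) * u \<epsilon> - of_real \<epsilon> * u1 0) \<le> K * \<sigma> * \<epsilon>"
    and "cmod (u1 \<epsilon> + (u 0 * of_real (c1 0 / \<epsilon>) - u1 0 * of_real (c 0))) \<le> K * \<sigma> * sqrt \<epsilon>"
proof -
  define R where "R = 4 * M\<^sup>2 * cmod \<zeta> + 1"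
  have R1: "1 \<le> R" by (simp add: R_def)
  have KR: "K = 8 * M\<^sup>2 * R" by (simp add: K_def R_def)
  have M2: "M \<le> M\<^sup>2" "1 \<le> M\<^sup>2" using M(1) by (auto simp: power2_eq_square mult_le_cancel_left1 intro: order_trans[of 1 M])
  have \<sigma>: "0 \<le> \<sigma>" "cmod (u \<epsilon>) \<le> \<sigma>" "cmod (u1 \<epsilon>) \<le> \<sigma>" "\<gamma> \<le> \<sigma>" using \<gamma> by (auto simp: \<sigma>_def)
  have cu: "continuous_on {0..\<epsilon>} u" using u by (auto intro: ac_continuous_Icc)
  define r where "r t = \<zeta> * u t + g t" for t
  have rai: "r absolutely_integrable_on {0..\<epsilon>}" unfolding r_def
    by (intro set_integral_add(1) g absolutely_integrable_continuous_Icc continuous_intros cu)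
  define \<rho> where "\<rho> = integral {0..\<epsilon>} (\<lambda>t. cmod (r t))"
  have rn: "(\<lambda>t. cmod (r t)) integrable_on {0..\<epsilon>}" using rai by (simp add: absolutely_integrable_on_def)
  have \<rho>0: "0 \<le> \<rho>" unfolding \<rho>_def by (rule integral_nonneg[OF rn]) simp
  have in01: "t / \<epsilon> \<in> {0..1}" if "t \<in> {0..\<epsilon>}" for t using that e by auto
  have int_bound: "cmod (integral {t..\<epsilon>} (\<lambda>\<tau>. r \<tau> * of_real (y (\<tau> / \<epsilon>)))) \<le> M * \<rho>"
    if t: "t \<in> {0..\<epsilon>}" and y: "continuous_on {0..\<epsilon>} (\<lambda>t. y (t / \<epsilon>))" "\<And>t. t \<in> {0..1} \<Longrightarrow> \<bar>y t\<bar> \<le> M" for y t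
  proof -
    have "(\<lambda>\<tau>. of_real (y (\<tau> / \<epsilon>)) * r \<tau>) absolutely_integrable_on {0..\<epsilon>}"
      by (intro absolutely_integrable_continuous_mult rai continuous_intros y)
    then have "(\<lambda>\<tau>. r \<tau> * of_real (y (\<tau> / \<epsilon>))) integrable_on {0..\<epsilon>}"
      by (simp add: absolutely_integrable_on_def mult.commute)
    then have i: "(\<lambda>\<tau>. r \<tau> * of_real (y (\<tau> / \<epsilon>))) integrable_on {t..\<epsilon>}"
      by (rule integrable_on_subinterval) (use t in auto)
    have rn': "(\<lambda>t. cmod (r t)) integrable_on {t..\<epsilon>}"
      by (rule integrable_on_subinterval[OF rn]) (use t in auto)
    have "cmod (integral {t..\<epsilon>} (\<lambda>\<tau>. r \<tau> * of_real (y (\<tau> / \<epsilon>)))) \<le> integral {t..\<epsilon>} (\<lambda>\<tau>. M * cmod (r \<tau>))"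
    proof (rule integral_norm_bound_integral[OF i integrable_on_mult_right[OF rn']])
      fix \<tau> assume "\<tau> \<in> {t..\<epsilon>}"
      then have "\<bar>y (\<tau> / \<epsilon>)\<bar> \<le> M" using t by (intro y(2) in01) auto
      then show "cmod (r \<tau> * of_real (y (\<tau> / \<epsilon>))) \<le> M * cmod (r \<tau>)"
        using mult_right_mono[of "\<bar>y (\<tau> / \<epsilon>)\<bar>" M "cmod (r \<tau>)"] by (simp add: norm_mult mult.commute)
    qed
    also have "\<dots> = M * integral {t..\<epsilon>} (\<lambda>\<tau>. cmod (r \<tau>))" by simp
    also have "\<dots> \<le> M * \<rho>"
      unfolding \<rho>_def using M(1) t by (intro mult_left_mono integral_subset_le rn rn') auto
    finally show ?thesis .
  qed
  \<comment> \<open>The Green remainders for \<open>c\<close> and \<open>s\<close>; the second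
    carries a factor \<epsilon> because the normalization s' = 1 at 1 becomes 1 / \<epsilon> after
    rescaling.\<close>
  define a where "a t = integral {t..\<epsilon>} (\<lambda>\<tau>. r \<tau> * of_real (c (\<tau> / \<epsilon>)))" for t
  define b where "b t = of_real \<epsilon> * integral {t..\<epsilon>} (\<lambda>\<tau>. r \<tau> * of_real (s (\<tau> / \<epsilon>)))" for t
  note ca = ode_pair_scaled(3)[OF c(1) e(1)] and sa = ode_pair_scaled(3)[OF s(1) e(1)]
  have ab: "cmod (a t) \<le> M * \<rho>" "cmod (b t) \<le> \<epsilon> * (M * \<rho>)" if "t \<in> {0..\<epsilon>}" for t
    using int_bound[OF that ca M(2)] int_bound[OF that sa M(4)] e(1)
    by (auto simp: a_def b_def norm_mult)
  have gc: "a t = - u1 \<epsilon> - (u t * of_real (c1 (t / \<epsilon>) / \<epsilon>) - u1 t * of_real (c (t / \<epsilon>)))" if "t \<in> {0..\<epsilon>}" for t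
    using integral_unique[OF green_identity[OF q c(1) e(1) u g(1) that]] by (simp add: a_def r_def c)
  have gs: "b t = u \<epsilon> - (u t * of_real (s1 (t / \<epsilon>)) - of_real \<epsilon> * u1 t * of_real (s (t / \<epsilon>)))" if "t \<in> {0..\<epsilon>}" for t
  proof -
    have "integral {t..\<epsilon>} (\<lambda>\<tau>. r \<tau> * of_real (s (\<tau> / \<epsilon>))) =
        u \<epsilon> * of_real (1 / \<epsilon>) - (u t * of_real (s1 (t / \<epsilon>) / \<epsilon>) - u1 t * of_real (s (t / \<epsilon>)))"
      using integral_unique[OF green_identity[OF q s(1) e(1) u g(1) that]] by (simp add: r_def s)
    then show ?thesis using e(1) by (simp add: b_def field_simps)
  qed
  have wr: "complex_of_real (c (t / \<epsilon>)) * of_real (s1 (t / \<epsilon>)) - of_real (c1 (t / \<epsilon>)) * of_real (s (t / \<epsilon>)) = 1"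
    if "t \<in> {0..\<epsilon>}" for t
  proof -
    have "c (t / \<epsilon>) * s1 (t / \<epsilon>) - c1 (t / \<epsilon>) * s (t / \<epsilon>) = 1"
      using ode_pair_wronskian[OF c(1) s(1) in01[OF that]] c s by simp
    then show ?thesis by (metis of_real_1 of_real_diff of_real_mult)
  qed
  have e0: "complex_of_real \<epsilon> \<noteq> 0" using e(1) by simp
  \<comment> \<open>Both Green identities are solved for \<open>u t\<close> and
    \<open>\<epsilon> * u1 t\<close>; the determinant of this system is the Wronskian, which is
    1.\<close>
  have rep: "u t = of_real (c (t / \<epsilon>)) * (u \<epsilon> - b t) + of_real \<epsilon> * of_real (s (t / \<epsilon>)) * (u1 \<epsilon> + a t)"
    "of_real \<epsilon> * u1 t = of_real (c1 (t / \<epsilon>)) * (u \<epsilon> - b t) + of_real \<epsilon> * of_real (s1 (t / \<epsilon>)) * (u1 \<epsilon> + a t)"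
    if t: "t \<in> {0..\<epsilon>}" for t
  proof -
    let ?c = "complex_of_real (c (t / \<epsilon>))" and ?c1 = "complex_of_real (c1 (t / \<epsilon>))"
    let ?s = "complex_of_real (s (t / \<epsilon>))" and ?s1 = "complex_of_real (s1 (t / \<epsilon>))"
    have 1: "u \<epsilon> - b t = u t * ?s1 - of_real \<epsilon> * u1 t * ?s" using gs[OF t] by simp
    have 2: "of_real \<epsilon> * (u1 \<epsilon> + a t) = - (u t * ?c1 - of_real \<epsilon> * u1 t * ?c)"
      unfolding gc[OF t] using e0 by (simp add: field_simps)
    have "?c * (u \<epsilon> - b t) + of_real \<epsilon> * ?s * (u1 \<epsilon> + a t) = ?c * (u \<epsilon> - b t) + ?s * (of_real \<epsilon> * (u1 \<epsilon> + a t))" by simp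
    also have "\<dots> = u t * (?c * ?s1 - ?c1 * ?s)" unfolding 1 2 by (simp add: algebra_simps)
    finally show "u t = ?c * (u \<epsilon> - b t) + of_real \<epsilon> * ?s * (u1 \<epsilon> + a t)" using wr[OF t] by simp
    have "?c1 * (u \<epsilon> - b t) + of_real \<epsilon> * ?s1 * (u1 \<epsilon> + a t) = ?c1 * (u \<epsilon> - b t) + ?s1 * (of_real \<epsilon> * (u1 \<epsilon> + a t))" by simp
    also have "\<dots> = of_real \<epsilon> * u1 t * (?c * ?s1 - ?c1 * ?s)" unfolding 1 2 by (simp add: algebra_simps)
    finally show "of_real \<epsilon> * u1 t = ?c1 * (u \<epsilon> - b t) + of_real \<epsilon> * ?s1 * (u1 \<epsilon> + a t)" using wr[OF t] by simp
  qed
  have rem: "cmod (of_real x * u \<epsilon> - (of_real x * (u \<epsilon> - b t) + of_real \<epsilon> * of_real y * (u1 \<epsilon> + a t)))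
      \<le> \<epsilon> * (2 * M\<^sup>2 * \<rho> + M * \<sigma>)"
    if t: "t \<in> {0..\<epsilon>}" and xy: "\<bar>x\<bar> \<le> M" "\<bar>y\<bar> \<le> M" for x y t
  proof -
    have "of_real x * u \<epsilon> - (of_real x * (u \<epsilon> - b t) + of_real \<epsilon> * of_real y * (u1 \<epsilon> + a t))
        = of_real x * b t - of_real \<epsilon> * of_real y * (u1 \<epsilon> + a t)" by (simp add: algebra_simps)
    also have "cmod \<dots> \<le> cmod (of_real x * b t) + cmod (of_real \<epsilon> * of_real y * (u1 \<epsilon> + a t))"
      by (rule norm_triangle_ineq4)
    also have "\<dots> = \<bar>x\<bar> * cmod (b t) + \<epsilon> * \<bar>y\<bar> * cmod (u1 \<epsilon> + a t)"
      using e(1) by (simp add: norm_mult)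
    also have "\<dots> \<le> \<bar>x\<bar> * cmod (b t) + \<epsilon> * \<bar>y\<bar> * (cmod (u1 \<epsilon>) + cmod (a t))"
      using e(1) by (intro add_left_mono mult_left_mono norm_triangle_ineq) auto
    also have "\<dots> \<le> M * (\<epsilon> * (M * \<rho>)) + \<epsilon> * M * (\<sigma> + M * \<rho>)"
      using xy ab[OF t] \<sigma> M(1) e(1) \<rho>0 by (intro add_mono mult_mono) auto
    also have "\<dots> = \<epsilon> * (2 * M\<^sup>2 * \<rho> + M * \<sigma>)" by (simp add: power2_eq_square algebra_simps)
    finally show ?thesis .
  qed
  obtain t0 where t0: "t0 \<in> {0..\<epsilon>}" "\<And>t. t \<in> {0..\<epsilon>} \<Longrightarrow> cmod (u t) \<le> cmod (u t0)"
    using continuous_attains_sup[of "{0..\<epsilon>}" "\<lambda>t. cmod (u t)"] continuous_on_norm[OF cu] e(1) by auto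
  define X where "X = cmod (u t0)"
  have X0: "X \<ge> 0" by (simp add: X_def)
  have \<rho>X: "\<rho> \<le> cmod \<zeta> * \<epsilon> * X + sqrt \<epsilon> * \<sigma>"
  proof -
    have gn: "(\<lambda>t. cmod (g t)) integrable_on {0..\<epsilon>}" using g(1) by (simp add: absolutely_integrable_on_def)
    have "\<rho> \<le> integral {0..\<epsilon>} (\<lambda>t. cmod \<zeta> * X + cmod (g t))"
      unfolding \<rho>_def
    proof (rule integral_le[OF rn])
      show "(\<lambda>t. cmod \<zeta> * X + cmod (g t)) integrable_on {0..\<epsilon>}"
        by (rule integrable_add[OF integrable_const_ivl gn])
      show "cmod (r t) \<le> cmod \<zeta> * X + cmod (g t)" if "t \<in> {0..\<epsilon>}" for t
        unfolding r_def X_def using t0(2)[OF that]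
        by (intro norm_triangle_le add_mono) (auto simp: norm_mult intro: mult_left_mono)
    qed
    also have "\<dots> = cmod \<zeta> * X * \<epsilon> + integral {0..\<epsilon>} (\<lambda>t. cmod (g t))"
      using e(1) by (subst integral_add[OF integrable_const_ivl gn]) simp
    also have "\<dots> \<le> cmod \<zeta> * X * \<epsilon> + sqrt \<epsilon> * \<sigma>"
      by (intro add_left_mono order_trans[OF g(2)] mult_left_mono \<sigma>(4)) (use e(1) in simp)
    finally show ?thesis by (simp add: algebra_simps)
  qed
  have se: "sqrt \<epsilon> \<le> 1" "0 \<le> sqrt \<epsilon>" "\<epsilon> \<le> sqrt \<epsilon>" using e sqrt_le_D[of 1] real_le_rsqrt[of \<epsilon> \<epsilon>]
    by (auto simp: power2_eq_square mult_le_cancel_left1)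
  \<comment> \<open>The remainder \<open>\<rho>\<close> contains the supremum \<open>X\<close> of
    |u| again. In the resulting inequality \<open>X\<close> has the coefficient (4 \<epsilon> M^2
    |\<zeta>|) \<epsilon> / 2, at most 1 / 2 by the smallness assumption, so it can be
    absorbed.\<close>
  have XK: "X \<le> 4 * M\<^sup>2 * \<sigma> + 4 * M\<^sup>2 * \<sigma>"
  proof -
    let ?c = "complex_of_real (c (t0 / \<epsilon>))"
    have "cmod (?c * u \<epsilon> - u t0) \<le> \<epsilon> * (2 * M\<^sup>2 * \<rho> + M * \<sigma>)"
      using rem[OF t0(1) M(2)[OF in01[OF t0(1)]] M(4)[OF in01[OF t0(1)]]] rep(1)[OF t0(1)] by simp
    moreover have "cmod (?c * u \<epsilon>) \<le> M * \<sigma>"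
      unfolding norm_mult using M(2)[OF in01[OF t0(1)]] \<sigma> M(1) by (intro mult_mono) auto
    ultimately have "X \<le> M * \<sigma> + \<epsilon> * (2 * M\<^sup>2 * \<rho> + M * \<sigma>)"
      unfolding X_def using norm_triangle_sub[of "u t0" "?c * u \<epsilon>"] by (simp add: norm_minus_commute)
    also have "\<dots> \<le> M * \<sigma> + \<epsilon> * (2 * M\<^sup>2 * (cmod \<zeta> * \<epsilon> * X + sqrt \<epsilon> * \<sigma>) + M * \<sigma>)"
      using \<rho>X e(1) by (intro add_left_mono mult_left_mono add_right_mono) auto
    also have "\<dots> = M * \<sigma> + \<epsilon> * (2 * M\<^sup>2 * (sqrt \<epsilon> * \<sigma>) + M * \<sigma>) + (4 * \<epsilon> * M\<^sup>2 * cmod \<zeta>) * (\<epsilon> * X) / 2"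
      by (simp add: algebra_simps)
    also have "\<dots> \<le> M * \<sigma> + 1 * (2 * M\<^sup>2 * (1 * \<sigma>) + M * \<sigma>) + 1 * (1 * X) / 2"
      using e se M(1) \<sigma>(1) X0 by (intro add_mono mult_mono divide_right_mono order_refl add_nonneg_nonneg mult_nonneg_nonneg) auto
    finally have "X \<le> 4 * (M * \<sigma>) + 4 * (M\<^sup>2 * \<sigma>)" by simp
    moreover have "M * \<sigma> \<le> M\<^sup>2 * \<sigma>" by (rule mult_right_mono[OF M2(1) \<sigma>(1)])
    ultimately show ?thesis by linarith
  qed
  have \<rho>R: "\<rho> \<le> sqrt \<epsilon> * (2 * R * \<sigma>)"
  proof -
    have "cmod \<zeta> * \<epsilon> * X \<le> cmod \<zeta> * sqrt \<epsilon> * (4 * M\<^sup>2 * \<sigma> + 4 * M\<^sup>2 * \<sigma>)"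
      using XK X0 se by (intro mult_mono) auto
    then have "\<rho> \<le> sqrt \<epsilon> * ((8 * M\<^sup>2 * cmod \<zeta> + 1) * \<sigma>)" using \<rho>X by (simp add: algebra_simps)
    also have "\<dots> \<le> sqrt \<epsilon> * (2 * R * \<sigma>)"
      using \<sigma>(1) se by (intro mult_left_mono mult_right_mono) (auto simp: R_def)
    finally show ?thesis .
  qed
  have \<rho>R': "\<rho> \<le> 2 * R * \<sigma>"
    by (rule order_trans[OF \<rho>R mult_left_le_one_le]) (use se R1 \<sigma>(1) in auto)
  have MR: "M\<^sup>2 * \<sigma> \<le> M\<^sup>2 * R * \<sigma>" "M * R * \<sigma> \<le> M\<^sup>2 * R * \<sigma>" "M * \<sigma> \<le> M\<^sup>2 * R * \<sigma>"
  proof -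
    show 1: "M\<^sup>2 * \<sigma> \<le> M\<^sup>2 * R * \<sigma>"
      using mult_left_mono[OF R1, of "M\<^sup>2"] \<sigma>(1) by (intro mult_right_mono) auto
    show "M * R * \<sigma> \<le> M\<^sup>2 * R * \<sigma>" using M2 R1 \<sigma>(1) by (intro mult_right_mono) auto
    show "M * \<sigma> \<le> M\<^sup>2 * R * \<sigma>" using mult_right_mono[OF M2(1) \<sigma>(1)] 1 by linarith
  qed
  have rem_le: "\<epsilon> * (2 * M\<^sup>2 * \<rho> + M * \<sigma>) \<le> K * \<sigma> * \<epsilon>"
  proof -
    have "M\<^sup>2 * \<rho> \<le> M\<^sup>2 * (2 * R * \<sigma>)" by (rule mult_left_mono[OF \<rho>R']) simp
    moreover have "0 \<le> M\<^sup>2 * R * \<sigma>" using R1 \<sigma>(1) by simp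
    ultimately have "2 * M\<^sup>2 * \<rho> + M * \<sigma> \<le> K * \<sigma>" using MR(3) unfolding KR by linarith
    then show ?thesis using mult_left_mono[of _ _ \<epsilon>] e(1) by (simp add: mult.commute)
  qed
  have z0: "0 \<in> {0..\<epsilon>}" "(0::real) \<in> {0..1}" using e(1) by auto
  show "cmod (u t) \<le> K * \<sigma>" if "t \<in> {0..\<epsilon>}" for t
    using t0(2)[OF that] XK MR(1) unfolding X_def KR by linarith
  show "cmod (of_real (c 0) * u \<epsilon> - u 0) \<le> K * \<sigma> * \<epsilon>"
    using rem[OF z0(1) M(2)[OF z0(2)] M(4)[OF z0(2)]] rep(1)[OF z0(1)] rem_le by simp
  show "cmod (of_real (c1 0) * u \<epsilon> - of_real \<epsilon> * u1 0) \<le> K * \<sigma> * \<epsilon>"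
    using rem[OF z0(1) M(3)[OF z0(2)] M(5)[OF z0(2)]] rep(2)[OF z0(1)] rem_le by simp
  have "u1 \<epsilon> + (u 0 * of_real (c1 0 / \<epsilon>) - u1 0 * of_real (c 0)) = - a 0"
    using gc[OF z0(1)] by simp
  also have "cmod (- a 0) \<le> M * \<rho>" using ab(1)[OF z0(1)] by simp
  also have "\<dots> \<le> M * (sqrt \<epsilon> * (2 * R * \<sigma>))" using \<rho>R M(1) by (intro mult_left_mono) auto
  also have "\<dots> = 2 * (M * R * \<sigma>) * sqrt \<epsilon>" by simp
  also have "\<dots> \<le> K * \<sigma> * sqrt \<epsilon>"
  proof (rule mult_right_mono[OF _ se(2)])
    have "0 \<le> M\<^sup>2 * R * \<sigma>" using R1 \<sigma>(1) by simp
    then show "2 * (M * R * \<sigma>) \<le> K * \<sigma>" using MR(2) unfolding KR by linarith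
  qed
  finally show "cmod (u1 \<epsilon> + (u 0 * of_real (c1 0 / \<epsilon>) - u1 0 * of_real (c 0))) \<le> K * \<sigma> * sqrt \<epsilon>" .
qed

text \<open>On the small star the difference of the solutions is merely bounded; the length
  \<epsilon> still makes this part of order sqrt \<epsilon> in the norm.\<close>

lemma l2_le_inner_and_tail:
  assumes d: "continuous_on {0..} d" and e: "0 \<le> \<epsilon>" and \<kappa>: "0 < \<kappa>" and B: "0 \<le> B"
    and inner: "\<And>t. t \<in> {0..\<epsilon>} \<Longrightarrow> cmod (d t) \<le> B"
    and tail: "\<And>t. \<epsilon> \<le> t \<Longrightarrow> cmod (d t) \<le> w * exp (- \<kappa> * (t - \<epsilon>))"
  shows "(l2 d)\<^sup>2 \<le> \<epsilon> * B\<^sup>2 + w\<^sup>2 / (2 * \<kappa>)"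
proof -
  have sq: "(\<lambda>t. (cmod (d t))\<^sup>2) integrable_on {a..b}" if "0 \<le> a" for a b
    by (intro integrable_continuous_real continuous_intros continuous_on_subset[OF d]) (use that in auto)
  define K where "K = \<epsilon> * B\<^sup>2 + w\<^sup>2 / (2 * \<kappa>)"
  have K: "0 \<le> K" using e \<kappa> by (simp add: K_def)
  have "l2 d \<le> sqrt K"
  proof (rule L2_halfI_continuous(2)[OF d])
    fix T :: real assume T: "0 \<le> T"
    define T' where "T' = max T \<epsilon>"
    have T': "\<epsilon> \<le> T'" "T \<le> T'" by (auto simp: T'_def)
    have "integral {0..T} (\<lambda>t. (cmod (d t))\<^sup>2) \<le> integral {0..T'} (\<lambda>t. (cmod (d t))\<^sup>2)"
      using T' by (intro integral_subset_le sq) auto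
    also have "\<dots> = integral {0..\<epsilon>} (\<lambda>t. (cmod (d t))\<^sup>2) + integral {\<epsilon>..T'} (\<lambda>t. (cmod (d t))\<^sup>2)"
      using T' e by (intro Henstock_Kurzweil_Integration.integral_combine[symmetric] sq) auto
    also have "integral {0..\<epsilon>} (\<lambda>t. (cmod (d t))\<^sup>2) \<le> integral {0..\<epsilon>} (\<lambda>t. B\<^sup>2)"
      by (intro integral_le sq integrable_const_ivl power_mono inner) auto
    also have "integral {0..\<epsilon>} (\<lambda>t. B\<^sup>2) = \<epsilon> * B\<^sup>2" using e by simp
    also have "integral {\<epsilon>..T'} (\<lambda>t. (cmod (d t))\<^sup>2) \<le> w\<^sup>2 / (2 * \<kappa>)"
    proof -
      have I: "((\<lambda>t. w\<^sup>2 * exp (- 2 * \<kappa> * (t - \<epsilon>))) has_integral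
         (w\<^sup>2 * exp (- 2 * \<kappa> * (T' - \<epsilon>)) / (- 2 * \<kappa>) - w\<^sup>2 * exp (- 2 * \<kappa> * (\<epsilon> - \<epsilon>)) / (- 2 * \<kappa>))) {\<epsilon>..T'}"
        using \<kappa> by (intro fundamental_theorem_of_calculus[OF T'(1)])
          (auto intro!: derivative_eq_intros simp flip: has_real_derivative_iff_has_vector_derivative)
      have "integral {\<epsilon>..T'} (\<lambda>t. (cmod (d t))\<^sup>2) \<le> integral {\<epsilon>..T'} (\<lambda>t. w\<^sup>2 * exp (- 2 * \<kappa> * (t - \<epsilon>)))"
      proof (rule integral_le)
        fix t assume "t \<in> {\<epsilon>..T'}"
        then have "(cmod (d t))\<^sup>2 \<le> (w * exp (- \<kappa> * (t - \<epsilon>)))\<^sup>2" by (intro power_mono tail) auto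
        also have "\<dots> = w\<^sup>2 * exp (- 2 * \<kappa> * (t - \<epsilon>))"
          by (simp add: power_mult_distrib exp_of_nat_mult[symmetric] algebra_simps)
        finally show "(cmod (d t))\<^sup>2 \<le> w\<^sup>2 * exp (- 2 * \<kappa> * (t - \<epsilon>))" .
      qed (use I sq e in auto)
      also have "\<dots> = w\<^sup>2 * exp (- 2 * \<kappa> * (T' - \<epsilon>)) / (- 2 * \<kappa>) - w\<^sup>2 * exp (- 2 * \<kappa> * (\<epsilon> - \<epsilon>)) / (- 2 * \<kappa>)"
        by (rule integral_unique[OF I])
      also have "\<dots> \<le> w\<^sup>2 / (2 * \<kappa>)" using \<kappa> by simp
      finally show ?thesis .
    qed
    finally show "integral {0..T} (\<lambda>t. (cmod (d t))\<^sup>2) \<le> (sqrt K)\<^sup>2" using K by (simp add: K_def)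
  qed (use K in simp)
  then have "(l2 d)\<^sup>2 \<le> (sqrt K)\<^sup>2" by (rule power_mono) simp
  then show ?thesis using K by (simp add: K_def)
qed

section \<open>Stability and conjugation of vertex conditions in three dimensions\<close>

lemma linear_kernel_distance:
  fixes A :: "'a::euclidean_space \<Rightarrow> 'b::euclidean_space"
  assumes "linear A"
  obtains K where "0 < K" "\<And>x. \<exists>p. A p = 0 \<and> norm (x - p) \<le> K * norm (A x)"
proof -
  \<comment> \<open>Subtracting from x the image of A x under a linear right inverse lands in the
    kernel, and the correction is controlled by the bound of that inverse. So data that nearly
    satisfy linear equations are close to data that satisfy them exactly.\<close>
  obtain h where h: "linear h" "\<And>y. y \<in> range A \<Longrightarrow> A (h y) = y"
    using linear_exists_right_inverse_on[OF assms subspace_UNIV] by blast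
  obtain K where K: "0 < K" "\<And>y. norm (h y) \<le> K * norm y"
    using linear_bounded_pos[OF h(1)] by blast
  show thesis
  proof (rule that[OF K(1)])
    fix x
    have "A (x - h (A x)) = 0" using h(2)[of "A x"] by (simp add: linear_diff[OF assms])
    then show "\<exists>p. A p = 0 \<and> norm (x - p) \<le> K * norm (A x)"
      using K(2)[of "A x"] by (intro exI[of _ "x - h (A x)"]) simp
  qed
qed

lemma norm_vec3_le:
  fixes x :: "complex ^ 3"
  assumes "\<And>n. cmod (x $ n) \<le> B" shows "norm x \<le> 3 * B"
proof -
  have "norm x \<le> (\<Sum>n\<in>UNIV. cmod (x $ n))" unfolding norm_vec_def by (rule L2_set_le_sum) simp
  also have "\<dots> \<le> (\<Sum>n\<in>(UNIV :: 3 set). B)" by (rule sum_mono) (rule assms)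
  finally show ?thesis by simp
qed

lemma cmod_dot3_le:
  fixes p :: "complex ^ 3"
  assumes "\<And>n. cmod (x n) \<le> B"
  shows "cmod (\<Sum>n\<in>UNIV. p $ n * x n) \<le> 3 * norm p * B"
proof -
  have "cmod (\<Sum>n\<in>UNIV. p $ n * x n) \<le> (\<Sum>n\<in>UNIV. cmod (p $ n * x n))" by (rule norm_sum)
  also have "\<dots> \<le> (\<Sum>n\<in>(UNIV :: 3 set). norm p * B)"
    unfolding norm_mult by (intro sum_mono mult_mono assms) (auto simp: Finite_Cartesian_Product.norm_nth_le)
  finally show ?thesis by simp
qed

definition kirchhoff_space :: "(complex ^ 3) set" where
  "kirchhoff_space = {x. \<exists>k. \<forall>n. x $ n = k}"

lemma complex_subspace_kirchhoff: "complex_subspace kirchhoff_space"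
  unfolding complex_subspace_def kirchhoff_space_def
  by (auto simp: subspace_def)

text \<open>Real orthogonality to the constant vectors 1 and i gives the real and the imaginary part
  of the flux condition.\<close>

lemma star_sol_kirchhoff:
  assumes "star_sol V kirchhoff_space \<zeta> g f f1"
  obtains k where "\<And>n. f n 0 = k" "(\<Sum>n\<in>UNIV. f1 n 0) = 0"
proof -
  obtain k where k: "\<And>n. f n 0 = k" using assms by (auto simp: star_sol_def kirchhoff_space_def)
  have p: "(\<chi> n. z) \<bullet> (\<chi> n. f1 n 0) = 0" for z
    using assms by (auto simp: star_sol_def kirchhoff_space_def)
  have "Re (\<Sum>n\<in>UNIV. f1 n 0) = 0" "Im (\<Sum>n\<in>UNIV. f1 n 0) = 0"
    using p[of 1] p[of \<i>] by (simp_all add: inner_vec_def inner_complex_def)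
  then show thesis using k by (intro that[of k]) (auto simp: complex_eq_iff)
qed

text \<open>The real inner products of y with the conjugate of p and with i times it are the real
  part and, up to sign, the imaginary part of the bilinear sum. The latter is the form in which the
  limit conditions and Green's identity use orthogonality.\<close>

lemma inner_zero_imp_dot_zero:
  fixes y :: "complex ^ 3"
  assumes "complex_subspace N" "\<And>p. p \<in> N \<Longrightarrow> (\<chi> n. cnj (p $ n)) \<in> N"
    and "\<forall>p\<in>N. p \<bullet> y = 0" "p \<in> N"
  shows "(\<Sum>n\<in>UNIV. p $ n * y $ n) = 0"
proof -
  have p': "(\<chi> n. cnj (p $ n)) \<in> N" using assms by blast
  then have "(\<chi> n. \<i> * (\<chi> n. cnj (p $ n)) $ n) \<in> N" using assms(1) unfolding complex_subspace_def by blast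
  then have "(\<chi> n. \<i> * cnj (p $ n)) \<bullet> y = 0" "(\<chi> n. cnj (p $ n)) \<bullet> y = 0" using assms(3) p' by auto
  then show ?thesis
    by (auto simp: inner_vec_def inner_complex_def complex_eq_iff sum_subtractf sum.distrib algebra_simps sum_negf)
qed

text \<open>The data are prescribed at the outer end, where the free half-line is attached:
  \<open>c n\<close> is the Neumann solution there, \<open>s n\<close> the Dirichlet solution, and
  their Wronskian is 1.\<close>

locale star_fundamental =
  fixes q c c1 s s1 :: "real star_fun"
  assumes q: "\<And>n. pot (q n)"
    and c: "\<And>n. ode_pair (q n) (c n) (c1 n)" "\<And>n. c n 1 = 1" "\<And>n. c1 n 1 = 0"
    and s: "\<And>n. ode_pair (q n) (s n) (s1 n)" "\<And>n. s n 1 = 0" "\<And>n. s1 n 1 = 1"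
begin

text \<open>On the edge \<open>n\<close> the solutions of the resonant problem are the multiples of \<open>c n\<close>, because of the
  Neumann condition at \<open>1\<close>; the remaining Kirchhoff conditions restrict the coefficients to this space.\<close>

definition end_space :: "(complex ^ 3) set" where
  "end_space = {x. (\<exists>k. \<forall>n. of_real (c n 0) * x $ n = k) \<and> (\<Sum>n\<in>UNIV. of_real (c1 n 0) * x $ n) = 0}"

lemma complex_subspace_end: "complex_subspace end_space"
  unfolding complex_subspace_def subspace_def
proof (intro conjI ballI allI)
  show "0 \<in> end_space" by (simp add: end_space_def)
  fix x assume x: "x \<in> end_space"
  then obtain k where k: "\<And>n. of_real (c n 0) * x $ n = k" "(\<Sum>n\<in>UNIV. of_real (c1 n 0) * x $ n) = 0"
    by (auto simp: end_space_def)
  have mult: "(\<chi> n. z * x $ n) \<in> end_space" for z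
    unfolding end_space_def
  proof (intro CollectI conjI exI[of _ "z * k"] allI)
    show "of_real (c n 0) * (\<chi> n. z * x $ n) $ n = z * k" for n using k(1)[of n] by (simp add: mult.left_commute)
    show "(\<Sum>n\<in>UNIV. of_real (c1 n 0) * (\<chi> n. z * x $ n) $ n) = 0"
      using k(2) by (simp add: mult.left_commute sum_distrib_left[symmetric])
  qed
  then show "(\<chi> n. \<i> * x $ n) \<in> end_space" .
  have "r *\<^sub>R x = (\<chi> n. of_real r * x $ n)" for r
    unfolding vec_eq_iff vec_lambda_beta vector_scaleR_component by (simp add: scaleR_conv_of_real)
  then show "r *\<^sub>R x \<in> end_space" for r using mult by simp
  fix y assume "y \<in> end_space"
  then obtain l where "\<And>n. of_real (c n 0) * y $ n = l" "(\<Sum>n\<in>UNIV. of_real (c1 n 0) * y $ n) = 0"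
    by (auto simp: end_space_def)
  with k show "x + y \<in> end_space" unfolding end_space_def
    by (intro CollectI conjI exI[of _ "k + l"]) (simp_all add: distrib_left sum.distrib)
qed

lemma end_space_cnj:
  assumes "x \<in> end_space" shows "(\<chi> n. cnj (x $ n)) \<in> end_space"
proof -
  obtain k where k: "\<And>n. of_real (c n 0) * x $ n = k" "(\<Sum>n\<in>UNIV. of_real (c1 n 0) * x $ n) = 0"
    using assms by (auto simp: end_space_def)
  have "cnj (of_real (c n 0) * x $ n) = cnj k" for n by (simp only: k)
  moreover have "cnj (\<Sum>n\<in>UNIV. of_real (c1 n 0) * x $ n) = 0" by (simp only: k complex_cnj_zero)
  ultimately show ?thesis unfolding end_space_def by (auto intro!: exI[of _ "cnj k"])
qed

text \<open>Approximate solutions of the defining equations are near exact ones. The unknown common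
  value \<open>k\<close> is eliminated by taking differences, so \<open>K\<close> depends only on
  the fundamental solutions.\<close>

lemma end_space_distance:
  obtains K where "0 < K" "\<And>x k B. (\<And>n. cmod (of_real (c n 0) * x $ n - k) \<le> B) \<Longrightarrow>
     cmod (\<Sum>n\<in>UNIV. of_real (c1 n 0) * x $ n) \<le> 3 * B \<Longrightarrow> \<exists>p\<in>end_space. norm (x - p) \<le> K * B"
proof -
  \<comment> \<open>The kernel of this map is \<open>end_space\<close>: two differences encode
    continuity at the vertex, the third component the flux condition.\<close>
  define A :: "complex ^ 3 \<Rightarrow> complex ^ 3" where "A x = (\<chi> n. if n = 1 then of_real (c 1 0) * x $ 1 - of_real (c 2 0) * x $ 2
     else if n = 2 then of_real (c 2 0) * x $ 2 - of_real (c 3 0) * x $ 3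
     else (\<Sum>n\<in>UNIV. of_real (c1 n 0) * x $ n))" for x
  have linA: "linear A" unfolding A_def
    by (rule linearI) (auto simp: vec_eq_iff sum.distrib sum_distrib_left algebra_simps scaleR_sum_right)
  then obtain K where K: "0 < K" "\<And>x. \<exists>p. A p = 0 \<and> norm (x - p) \<le> K * norm (A x)"
    using linear_kernel_distance[OF linA] by blast
  have ker: "p \<in> end_space" if "A p = 0" for p
  proof -
    have "A p $ 1 = 0" "A p $ 2 = 0" "A p $ 3 = 0" using that by simp_all
    then show ?thesis unfolding end_space_def A_def
      by (auto simp: forall_3 intro!: exI[of _ "of_real (c 1 0) * p $ 1"])
  qed
  \<comment> \<open>Each component of \<open>A x\<close> is at most 3 B, and passing to the norm
    costs another factor 3, whence 9.\<close>
  show thesis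
  proof (rule that[of "K * 9"])
    fix x k B
    assume a: "\<And>n. cmod (of_real (c n 0) * x $ n - k) \<le> B" "cmod (\<Sum>n\<in>UNIV. of_real (c1 n 0) * x $ n) \<le> 3 * B"
    have "0 \<le> B" using a(1)[of 1] norm_ge_zero order_trans by blast
    have d: "cmod (of_real (c n 0) * x $ n - of_real (c m 0) * x $ m) \<le> 3 * B" for n m
      using norm_triangle_ineq4[of "of_real (c n 0) * x $ n - k" "of_real (c m 0) * x $ m - k"]
        a(1)[of n] a(1)[of m] \<open>0 \<le> B\<close> by simp
    have "cmod (A x $ n) \<le> 3 * B" for n unfolding A_def using d a(2) by auto
    then have "norm (A x) \<le> 3 * (3 * B)" by (rule norm_vec3_le)
    then have "K * norm (A x) \<le> K * 9 * B" using K(1) by simp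
    then show "\<exists>p\<in>end_space. norm (x - p) \<le> K * 9 * B" using K(2)[of x] ker order_trans by blast
  qed (use K in simp)
qed

lemma fundamental_bound:
  obtains M where "1 \<le> M" "\<And>n t. t \<in> {0..1} \<Longrightarrow> \<bar>c n t\<bar> \<le> M" "\<And>n t. t \<in> {0..1} \<Longrightarrow> \<bar>c1 n t\<bar> \<le> M"
    "\<And>n t. t \<in> {0..1} \<Longrightarrow> \<bar>s n t\<bar> \<le> M" "\<And>n t. t \<in> {0..1} \<Longrightarrow> \<bar>s1 n t\<bar> \<le> M"
proof -
  have "\<exists>B. \<forall>t\<in>{0..1}. \<bar>y t\<bar> \<le> B" if "continuous_on {0..1} y" for y :: "real \<Rightarrow> real"
  proof -
    have "bounded (y ` {0..1})" by (intro compact_imp_bounded compact_continuous_image that) simp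
    then show ?thesis unfolding bounded_iff by auto
  qed
  then have "\<exists>B. \<forall>t\<in>{0..1}. \<bar>y t\<bar> \<le> B" if "y \<in> {c n, c1 n, s n, s1 n}" for y n
    using that ode_pair_continuous[OF c(1)[of n]] ode_pair_continuous[OF s(1)[of n]] by auto
  then obtain B where B: "\<And>y n t. y \<in> {c n, c1 n, s n, s1 n} \<Longrightarrow> t \<in> {0..1} \<Longrightarrow> \<bar>y t\<bar> \<le> B y" by metis
  define S where "S = (\<Union>n. {c n, c1 n, s n, s1 n})"
  have fin: "finite S" unfolding S_def by auto
  define M where "M = Max (insert 1 (B ` S))"
  have M: "B y \<le> M" if "y \<in> S" for y unfolding M_def using fin that by (intro Max_ge) auto
  have "\<bar>y t\<bar> \<le> M" if "y \<in> {c n, c1 n, s n, s1 n}" "t \<in> {0..1}" for y n t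
    using B[OF that] M[of y] that by (force simp: S_def)
  moreover have "1 \<le> M" unfolding M_def using fin by (intro Max_ge) auto
  ultimately show thesis by (intro that[of M]) auto
qed

section \<open>Comparison of the two resolvents\<close>

definition scaled :: "real \<Rightarrow> real star_fun" where
  "scaled \<epsilon> = (\<lambda>n t. q n (t / \<epsilon>) / \<epsilon>\<^sup>2)"

lemma pot_scaled:
  assumes "0 < \<epsilon>" "\<epsilon> \<le> 1" shows "pot (scaled \<epsilon> n)"
proof -
  have "continuous_on {0..} (\<lambda>t. q n (t / \<epsilon>))"
    by (rule continuous_on_compose2[of "{0..}" "q n"]) (use q[of n] assms in \<open>auto simp: pot_def intro!: continuous_intros\<close>)
  then have "continuous_on {0..} (scaled \<epsilon> n)"
    unfolding scaled_def using assms by (intro continuous_intros) auto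
  moreover have "scaled \<epsilon> n t = 0" if "1 \<le> t" for t
  proof -
    have "1 \<le> t / \<epsilon>" using that assms by (simp add: field_simps)
    then show ?thesis using q[of n] by (simp add: scaled_def pot_def)
  qed
  ultimately show ?thesis by (simp add: pot_def)
qed

text \<open>The limit solution does not depend on \<epsilon> and is regular up to the vertex: v is
  Lipschitz, and v' is Hoelder continuous with exponent 1/2, since v'' is only square integrable.
  The numbers 3 and 4 in \<open>K\<close> are those of the pointwise bounds, applied to v and v'' =
  - \<zeta> v - g.\<close>

lemma limit_bounds:
  assumes \<zeta>: "Im \<zeta> \<noteq> 0" and g: "\<And>n. g n \<in> L2_half" and sv: "star_sol (\<lambda>n t. 0) end_space \<zeta> g v v1"
  defines "\<Gamma> \<equiv> norm (abs_star_L2 g)" and "K \<equiv> 3 / \<bar>Im \<zeta>\<bar> + 4 * (cmod \<zeta> / \<bar>Im \<zeta>\<bar> + 1)"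
  shows "\<And>n t. 0 \<le> t \<Longrightarrow> cmod (v n t) \<le> K * \<Gamma>" "\<And>n t. 0 \<le> t \<Longrightarrow> cmod (v1 n t) \<le> K * \<Gamma>"
    "\<And>n t. 0 \<le> t \<Longrightarrow> cmod (v n t - v n 0) \<le> K * \<Gamma> * t" "\<And>n t. 0 \<le> t \<Longrightarrow> cmod (v1 n t - v1 n 0) \<le> K * \<Gamma> * sqrt t"
proof -
  have pz: "pot (\<lambda>t. 0)" by (simp add: pot_def)
  have e: "edge_sol (\<lambda>t. 0) \<zeta> (g n) (v n) (v1 n)" for n using sv by (simp add: star_sol_def)
  have v: "v n \<in> L2_half" "ac {0..} (v n) (v1 n)" for n using e[of n] by (auto simp: edge_sol_def edge_ode_def)
  define w where "w n t = (of_real 0 - \<zeta>) * v n t - g n t" for n t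
  have wL: "w n \<in> L2_half" for n unfolding w_def[abs_def] by (rule edge_rhs_L2[OF pz v(1) g])
  have acw: "ac {0..} (v1 n) (w n)" for n using e[of n] by (auto simp: edge_sol_def edge_ode_def w_def[abs_def])
  have nv: "norm (abs_star_L2 v) \<le> \<Gamma> / \<bar>Im \<zeta>\<bar>"
    unfolding \<Gamma>_def by (rule star_sol_bound[OF _ \<zeta> _ complex_subspace_end sv]) (auto simp: pz g)
  then have lv: "l2 (v n) \<le> \<Gamma> / \<bar>Im \<zeta>\<bar>" for n using l2_le_norm_abs_star_L2[of v n, OF v(1)] by linarith
  have "abs_star_L2 w = abs_star_L2 (\<lambda>n t. - \<zeta> * v n t) - abs_star_L2 g"
    by (subst abs_star_L2_diff) (auto simp: w_def[abs_def] intro: L2_half_scale[OF v(1), of "- \<zeta>", simplified] g)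
  also have "norm \<dots> \<le> norm (abs_star_L2 (\<lambda>n t. - \<zeta> * v n t)) + \<Gamma>"
    unfolding \<Gamma>_def by (rule norm_triangle_ineq4)
  also have "norm (abs_star_L2 (\<lambda>n t. - \<zeta> * v n t)) = cmod \<zeta> * norm (abs_star_L2 v)"
  proof (rule power2_eq_imp_eq)
    have "(l2 (\<lambda>t. - \<zeta> * v n t))\<^sup>2 = (cmod \<zeta>)\<^sup>2 * (l2 (v n))\<^sup>2" for n
      unfolding l2_sq by (simp add: norm_mult power_mult_distrib)
    then show "(norm (abs_star_L2 (\<lambda>n t. - \<zeta> * v n t)))\<^sup>2 = (cmod \<zeta> * norm (abs_star_L2 v))\<^sup>2"
      unfolding power_mult_distrib
      by (subst (1 2) norm_abs_star_L2) (simp_all add: v(1) L2_half_scale[OF v(1), of "- \<zeta>", simplified] sum_distrib_left)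
  qed simp_all
  also have "cmod \<zeta> * norm (abs_star_L2 v) \<le> cmod \<zeta> * (\<Gamma> / \<bar>Im \<zeta>\<bar>)" by (rule mult_left_mono[OF nv]) simp
  finally have nw: "norm (abs_star_L2 w) \<le> (cmod \<zeta> / \<bar>Im \<zeta>\<bar> + 1) * \<Gamma>" by (simp add: algebra_simps)
  have lw: "l2 (w n) \<le> (cmod \<zeta> / \<bar>Im \<zeta>\<bar> + 1) * \<Gamma>" for n
    using l2_le_norm_abs_star_L2[of w n, OF wL] nw by linarith
  have KG: "K * \<Gamma> = 3 * (\<Gamma> / \<bar>Im \<zeta>\<bar>) + 4 * ((cmod \<zeta> / \<bar>Im \<zeta>\<bar> + 1) * \<Gamma>)"
    unfolding K_def by (simp add: distrib_right)
  show b0: "cmod (v n t) \<le> K * \<Gamma>" and b1: "cmod (v1 n t) \<le> K * \<Gamma>" if "0 \<le> t" for n t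
    using W22_pointwise_bounds[OF v wL acw that, of n] lv[of n] lw[of n] l2_nonneg[of "v n"] l2_nonneg[of "w n"]
    unfolding KG by linarith+
  show "cmod (v n t - v n 0) \<le> K * \<Gamma> * t" if "0 \<le> t" for n t
    using ac_norm_diff_le[OF v(2)[of n], of 0 t "K * \<Gamma>"] b1 that by auto
  show "cmod (v1 n t - v1 n 0) \<le> K * \<Gamma> * sqrt t" if "0 \<le> t" for n t
  proof -
    have "cmod (v1 n t - v1 n 0) \<le> sqrt t * l2 (w n)" using ac_L2_diff_le[OF acw wL order_refl that, of n] by simp
    also have "l2 (w n) \<le> K * \<Gamma>"
      using lw[of n] lv[of n] l2_nonneg[of "v n"] l2_nonneg[of "w n"] unfolding KG by linarith
    then have "sqrt t * l2 (w n) \<le> sqrt t * (K * \<Gamma>)" by (rule mult_left_mono) (use that in simp)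
    finally show ?thesis by (simp add: mult.commute)
  qed
qed

text \<open>All constants are fixed before \<epsilon> and g. In the proof \<Gamma> is the norm of g,
  \<omega> the norm of the mismatch W at distance \<epsilon>, and \<tau> the resulting bound for the
  inner estimates; an inequality with \<omega> on both sides is derived and then closed.\<close>

lemma small_parameter_estimate:
  assumes \<zeta>: "Im \<zeta> \<noteq> 0"
  shows "\<exists>\<epsilon>0 C. 0 < \<epsilon>0 \<and> 0 \<le> C \<and> (\<forall>\<epsilon> g f f1 v v1. 0 < \<epsilon> \<and> \<epsilon> \<le> \<epsilon>0 \<and> \<epsilon> \<le> 1 \<and> (\<forall>n. g n \<in> L2_half) \<and>
      star_sol (scaled \<epsilon>) kirchhoff_space \<zeta> g f f1 \<and> star_sol (\<lambda>n t. 0) end_space \<zeta> g v v1 \<longrightarrow>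
      norm (abs_star_L2 f - abs_star_L2 v) \<le> C * sqrt \<epsilon> * norm (abs_star_L2 g))"
proof -
  define \<mu> where "\<mu> = csqrt (- \<zeta>)"
  have \<mu>: "0 < Re \<mu>" "\<mu>\<^sup>2 = - \<zeta>" unfolding \<mu>_def using csqrt_Re_pos[OF \<zeta>] by simp_all
  then have \<mu>0: "0 < cmod \<mu>" by auto
  obtain M where M: "1 \<le> M" "\<And>n t. t \<in> {0..1} \<Longrightarrow> \<bar>c n t\<bar> \<le> M" "\<And>n t. t \<in> {0..1} \<Longrightarrow> \<bar>c1 n t\<bar> \<le> M"
    "\<And>n t. t \<in> {0..1} \<Longrightarrow> \<bar>s n t\<bar> \<le> M" "\<And>n t. t \<in> {0..1} \<Longrightarrow> \<bar>s1 n t\<bar> \<le> M"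
    by (rule fundamental_bound) blast
  obtain KA where KA: "0 < KA" "\<And>x k B. (\<And>n. cmod (of_real (c n 0) * x $ n - k) \<le> B) \<Longrightarrow>
     cmod (\<Sum>n\<in>UNIV. of_real (c1 n 0) * x $ n) \<le> 3 * B \<Longrightarrow> \<exists>p\<in>end_space. norm (x - p) \<le> KA * B"
    by (rule end_space_distance) blast
  define Kv where "Kv = 3 / \<bar>Im \<zeta>\<bar> + 4 * (cmod \<zeta> / \<bar>Im \<zeta>\<bar> + 1)"
  define K where "K = 8 * M\<^sup>2 * (4 * M\<^sup>2 * cmod \<zeta> + 1)"
  \<comment> \<open>Turns the inner estimates into multiples of \<Gamma> + \<omega>: the Cauchy data
    of \<open>f n\<close> at \<epsilon> are those of \<open>v n\<close>, at most Kv \<Gamma> each,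
    plus at most \<omega> and |\<mu>| \<omega>.\<close>
  define Kt where "Kt = K * (2 * Kv + 2 + cmod \<mu>)"
  \<comment> \<open>Chosen so that \<omega> \<le> sqrt \<epsilon> Ks (\<Gamma> + \<omega>). The
    first summand comes from the derivative test, the second from four times the distance of W to
    \<open>end_space\<close>.\<close>
  define Ks where "Ks = 3 * (Kt + Kv) / cmod \<mu> + 4 * (KA * Kt + 3 * Kv)"
  \<comment> \<open>The first bound is the smallness required on the inner edges, the second gives
    sqrt \<epsilon> Ks \<le> 1/2 for absorbing \<omega>.\<close>
  define \<epsilon>0 where "\<epsilon>0 = min (1 / (4 * M\<^sup>2 * cmod \<zeta> + 1)) ((1 / (2 * Ks + 1))\<^sup>2)"
  \<comment> \<open>Contributions of the inner part and of the exponential tail to the squared norm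
    on one edge, up to the factor \<epsilon> \<Gamma>^2.\<close>
  define D where "D = (2 * Kt + Kv)\<^sup>2 + (2 * Ks)\<^sup>2 / (2 * Re \<mu>)"
  have nn: "0 < Kv" "0 < K" "0 < Kt" "0 < Ks" "0 \<le> D" "0 < \<epsilon>0"
  proof -
    have "0 \<le> cmod \<zeta> / \<bar>Im \<zeta>\<bar>" by simp
    then show 1: "0 < Kv" unfolding Kv_def by (intro add_nonneg_pos mult_pos_pos) (auto intro: add_nonneg_pos)
    show 2: "0 < K" using M(1) unfolding K_def by (intro mult_pos_pos add_nonneg_pos) auto
    show 3: "0 < Kt" unfolding Kt_def using 1 2 by (intro mult_pos_pos add_pos_nonneg) auto
    show 4: "0 < Ks" unfolding Ks_def using 1 3 \<mu>0 KA by (intro add_pos_pos divide_pos_pos mult_pos_pos) auto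
    show "0 \<le> D" unfolding D_def using \<mu>(1) by simp
    have "0 < 4 * M\<^sup>2 * cmod \<zeta> + 1" by (intro add_nonneg_pos) auto
    then show "0 < \<epsilon>0" unfolding \<epsilon>0_def using 4 by simp
  qed
  show ?thesis
  proof (rule exI[of _ \<epsilon>0], rule exI[of _ "sqrt (3 * D)"], intro conjI allI impI)
    fix \<epsilon> :: real and g f f1 v v1
    assume A: "0 < \<epsilon> \<and> \<epsilon> \<le> \<epsilon>0 \<and> \<epsilon> \<le> 1 \<and> (\<forall>n. g n \<in> L2_half) \<and>
      star_sol (scaled \<epsilon>) kirchhoff_space \<zeta> g f f1 \<and> star_sol (\<lambda>n t. 0) end_space \<zeta> g v v1"
    then have e: "0 < \<epsilon>" "\<epsilon> \<le> \<epsilon>0" "\<epsilon> \<le> 1" and g: "\<And>n. g n \<in> L2_half"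
      and sf: "star_sol (scaled \<epsilon>) kirchhoff_space \<zeta> g f f1" and sv: "star_sol (\<lambda>n t. 0) end_space \<zeta> g v v1"
      by blast+
    have e1: "4 * \<epsilon> * M\<^sup>2 * cmod \<zeta> \<le> 1"
    proof -
      have p: "0 < 4 * M\<^sup>2 * cmod \<zeta> + 1" by (intro add_nonneg_pos) auto
      have "\<epsilon> \<le> 1 / (4 * M\<^sup>2 * cmod \<zeta> + 1)" using e(2) by (simp add: \<epsilon>0_def)
      then have "\<epsilon> * (4 * M\<^sup>2 * cmod \<zeta> + 1) \<le> 1" by (simp only: pos_le_divide_eq[OF p])
      then show ?thesis using e(1) by (simp add: algebra_simps)
    qed
    have e2: "sqrt \<epsilon> * Ks \<le> 1 / 2"
    proof -
      have "\<epsilon> \<le> (1 / (2 * Ks + 1))\<^sup>2" using e(2) by (simp add: \<epsilon>0_def)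
      then have "sqrt \<epsilon> \<le> 1 / (2 * Ks + 1)" using nn by (intro real_le_lsqrt) auto
      then have "sqrt \<epsilon> * (2 * Ks + 1) \<le> 1" using nn by (simp add: pos_le_divide_eq)
      then have "2 * (sqrt \<epsilon> * Ks) + sqrt \<epsilon> \<le> 1" by (simp add: algebra_simps)
      moreover have "0 \<le> sqrt \<epsilon>" using e(1) by simp
      ultimately show ?thesis by linarith
    qed
    have se: "0 \<le> sqrt \<epsilon>" "\<epsilon> \<le> sqrt \<epsilon>" "sqrt \<epsilon> * sqrt \<epsilon> = \<epsilon>"
      using e real_le_rsqrt[of \<epsilon> \<epsilon>] by (auto simp: power2_eq_square mult_le_cancel_left1)
    define \<Gamma> where "\<Gamma> = norm (abs_star_L2 g)"
    have \<Gamma>: "0 \<le> \<Gamma>" by (simp add: \<Gamma>_def)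
    note vb = limit_bounds[OF \<zeta> g sv, folded Kv_def \<Gamma>_def]
    have ef: "edge_sol (scaled \<epsilon> n) \<zeta> (g n) (f n) (f1 n)" for n using sf by (simp add: star_sol_def)
    have ev: "edge_sol (\<lambda>t. 0) \<zeta> (g n) (v n) (v1 n)" for n using sv by (simp add: star_sol_def)
    have fL: "f n \<in> L2_half" and vL: "v n \<in> L2_half" for n using ef[of n] ev[of n] by (auto simp: edge_sol_def)
    have facs: "ac {0..} (f n) (f1 n)" "ac {0..} (f1 n) (\<lambda>t. (of_real (q n (t / \<epsilon>) / \<epsilon>\<^sup>2) - \<zeta>) * f n t - g n t)" for n
      using ef[of n] by (auto simp: edge_sol_def edge_ode_def scaled_def)
    have vacs: "ac {0..} (v n) (v1 n)" "ac {0..} (v1 n) (\<lambda>t. (of_real 0 - \<zeta>) * v n t - g n t)" for n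
      using ev[of n] by (auto simp: edge_sol_def edge_ode_def)
    obtain k where k: "\<And>n. f n 0 = k" "(\<Sum>n\<in>UNIV. f1 n 0) = 0" using star_sol_kirchhoff[OF sf] by blast
    define W where "W = (\<chi> n. f n \<epsilon> - v n \<epsilon>)"
    have dec: "f1 n \<epsilon> - v1 n \<epsilon> = - \<mu> * W $ n"
       "\<And>t. \<epsilon> \<le> t \<Longrightarrow> f n t - v n t = W $ n * exp (- \<mu> * of_real (t - \<epsilon>))" for n
    proof -
      have sub: "{\<epsilon>..} \<subseteq> {0..}" using e(1) by auto
      have a1: "ac {\<epsilon>..} (\<lambda>t. f n t - v n t) (\<lambda>t. f1 n t - v1 n t)"
        by (rule ac_subset[OF ac_diff[OF facs(1) vacs(1)] sub])
      have "ac {\<epsilon>..} (\<lambda>t. f1 n t - v1 n t) (\<lambda>t. ((of_real (q n (t / \<epsilon>) / \<epsilon>\<^sup>2) - \<zeta>) * f n t - g n t) -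
            ((of_real 0 - \<zeta>) * v n t - g n t))"
        by (rule ac_subset[OF ac_diff[OF facs(2) vacs(2)] sub])
      then have a2: "ac {\<epsilon>..} (\<lambda>t. f1 n t - v1 n t) (\<lambda>t. \<mu>\<^sup>2 * (f n t - v n t))"
      proof (rule ac_cong)
        fix t assume "t \<in> {\<epsilon>..}"
        then have "1 \<le> t / \<epsilon>" using e(1) by (simp add: field_simps)
        then have "q n (t / \<epsilon>) = 0" using q[of n] by (simp add: pot_def)
        then show "((of_real (q n (t / \<epsilon>) / \<epsilon>\<^sup>2) - \<zeta>) * f n t - g n t) - ((of_real 0 - \<zeta>) * v n t - g n t) = \<mu>\<^sup>2 * (f n t - v n t)"
          by (simp add: \<mu>(2) algebra_simps)
      qed (auto simp: is_interval_ci)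
      note F = free_decay[OF \<mu>(1) less_imp_le[OF e(1)] L2_half_diff[OF fL vL] a1 a2]
      show "f1 n \<epsilon> - v1 n \<epsilon> = - \<mu> * W $ n" using F(1) by (simp add: W_def)
      show "f n t - v n t = W $ n * exp (- \<mu> * of_real (t - \<epsilon>))" if "\<epsilon> \<le> t" for t
        using F(2)[OF that] by (simp add: W_def)
    qed
    define \<omega> where "\<omega> = norm W"
    have W\<omega>: "cmod (W $ n) \<le> \<omega>" for n unfolding \<omega>_def by (rule Finite_Cartesian_Product.norm_nth_le)
    have \<omega>: "0 \<le> \<omega>" by (simp add: \<omega>_def)
    define \<tau> where "\<tau> = Kt * (\<Gamma> + \<omega>)"
    have \<tau>0: "0 \<le> \<tau>" unfolding \<tau>_def using nn \<Gamma> \<omega> by simp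
    have \<sigma>: "K * (cmod (f n \<epsilon>) + cmod (f1 n \<epsilon>) + \<Gamma>) \<le> \<tau>" for n
    proof -
      have "f n \<epsilon> = v n \<epsilon> + W $ n" by (simp add: W_def)
      then have "cmod (f n \<epsilon>) \<le> Kv * \<Gamma> + \<omega>"
        using norm_triangle_ineq[of "v n \<epsilon>" "W $ n"] vb(1)[of \<epsilon> n] W\<omega>[of n] e(1) by simp
      moreover have "cmod (f1 n \<epsilon>) \<le> Kv * \<Gamma> + cmod \<mu> * \<omega>"
      proof -
        have "f1 n \<epsilon> = v1 n \<epsilon> - \<mu> * W $ n" using dec(1)[of n] by (simp add: algebra_simps)
        then have "cmod (f1 n \<epsilon>) \<le> cmod (v1 n \<epsilon>) + cmod \<mu> * cmod (W $ n)"
          using norm_triangle_ineq4[of "v1 n \<epsilon>" "\<mu> * W $ n"] by (simp add: norm_mult)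
        also have "\<dots> \<le> Kv * \<Gamma> + cmod \<mu> * \<omega>"
          using vb(2)[of \<epsilon> n] e(1) by (intro add_mono mult_left_mono W\<omega>) auto
        finally show ?thesis .
      qed
      ultimately have "cmod (f n \<epsilon>) + cmod (f1 n \<epsilon>) + \<Gamma> \<le> (2 * Kv * \<Gamma> + \<Gamma>) + (\<omega> + cmod \<mu> * \<omega>)" by simp
      also have "\<dots> \<le> (2 * Kv * \<Gamma> + 2 * \<Gamma> + cmod \<mu> * \<Gamma>) + (2 * Kv * \<omega> + 2 * \<omega> + cmod \<mu> * \<omega>)"
        using nn \<Gamma> \<omega> mult_nonneg_nonneg[of "cmod \<mu>" \<Gamma>] mult_nonneg_nonneg[of Kv \<omega>] by simp
      also have "\<dots> = (2 * Kv + 2 + cmod \<mu>) * (\<Gamma> + \<omega>)" by (simp add: algebra_simps)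
      finally show ?thesis unfolding \<tau>_def Kt_def using nn(2) by (simp add: mult.assoc)
    qed
    have cq: "continuous_on {0..1} (q n)" for n using q[of n] by (auto simp: pot_def intro: continuous_on_subset)
    have gi: "g n absolutely_integrable_on {0..\<epsilon>}" "integral {0..\<epsilon>} (\<lambda>t. cmod (g n t)) \<le> sqrt \<epsilon> * \<Gamma>" for n
    proof -
      show "g n absolutely_integrable_on {0..\<epsilon>}" by (rule L2_half_integrable_interval[OF g order_refl])
      have "integral {0..\<epsilon>} (\<lambda>t. cmod (g n t)) \<le> sqrt \<epsilon> * l2 (g n)"
        using L2_half_abs_interval[OF g[of n] order_refl, of \<epsilon>] e(1) by simp
      also have "\<dots> \<le> sqrt \<epsilon> * \<Gamma>"
        unfolding \<Gamma>_def using l2_le_norm_abs_star_L2[of g n, OF g] se(1) by (rule mult_left_mono)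
      finally show "integral {0..\<epsilon>} (\<lambda>t. cmod (g n t)) \<le> sqrt \<epsilon> * \<Gamma>" .
    qed
    have fi: "ac {0..\<epsilon>} (f n) (f1 n)" "ac {0..\<epsilon>} (f1 n) (\<lambda>t. (of_real (q n (t / \<epsilon>) / \<epsilon>\<^sup>2) - \<zeta>) * f n t - g n t)" for n
      by (rule ac_subset[OF facs(1)], simp, rule ac_subset[OF facs(2)], simp)
    note est = inner_edge_estimates[OF cq c s M(1) M(2) M(3) M(4) M(5) e(1) e(3) e1 fi gi \<Gamma>, folded K_def]
    have E1: "cmod (f n t) \<le> \<tau>" if "t \<in> {0..\<epsilon>}" for n t
      using est(1)[OF _ _ _ _ that, of n] \<sigma>[of n] by simp
    have E2: "cmod (of_real (c n 0) * f n \<epsilon> - k) \<le> \<tau> * \<epsilon>" for n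
      using order_trans[OF est(2) mult_right_mono[OF \<sigma>[of n] less_imp_le[OF e(1)]]] by (simp add: k)
    have E3: "cmod (of_real (c1 n 0) * f n \<epsilon> - of_real \<epsilon> * f1 n 0) \<le> \<tau> * \<epsilon>" for n
      using order_trans[OF est(3) mult_right_mono[OF \<sigma>[of n] less_imp_le[OF e(1)]]] by simp
    have E4: "cmod (f1 n \<epsilon> + (k * of_real (c1 n 0 / \<epsilon>) - f1 n 0 * of_real (c n 0))) \<le> \<tau> * sqrt \<epsilon>" for n
      using order_trans[OF est(4) mult_right_mono[OF \<sigma>[of n] se(1)]] by (simp add: k)
    have "\<exists>p\<in>end_space. norm ((\<chi> n. f n \<epsilon>) - p) \<le> KA * (\<tau> * \<epsilon>)"
    proof (rule KA(2)[of _ k])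
      show "cmod (of_real (c n 0) * (\<chi> n. f n \<epsilon>) $ n - k) \<le> \<tau> * \<epsilon>" for n using E2[of n] by simp
      have "(\<Sum>n\<in>UNIV. of_real (c1 n 0) * (\<chi> n. f n \<epsilon>) $ n) =
          (\<Sum>n\<in>UNIV. of_real (c1 n 0) * f n \<epsilon> - of_real \<epsilon> * f1 n 0)"
        by (simp add: sum_subtractf sum_distrib_left[symmetric] k(2))
      also have "cmod \<dots> \<le> (\<Sum>n\<in>(UNIV :: 3 set). \<tau> * \<epsilon>)" by (intro sum_norm_le E3)
      finally show "cmod (\<Sum>n\<in>UNIV. of_real (c1 n 0) * (\<chi> n. f n \<epsilon>) $ n) \<le> 3 * (\<tau> * \<epsilon>)" by simp
    qed
    then obtain p0 where p0: "p0 \<in> end_space" "norm ((\<chi> n. f n \<epsilon>) - p0) \<le> KA * (\<tau> * \<epsilon>)" by blast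
    \<comment> \<open>An element of \<open>end_space\<close> close to W: \<open>p0\<close>
      approximates the values of \<open>f\<close> at \<epsilon>, and the values of \<open>v\<close>
      at the vertex lie in the space exactly.\<close>
    define p where "p = p0 - (\<chi> n. v n 0)"
    have v0: "(\<chi> n. v n 0) \<in> end_space" "\<forall>p\<in>end_space. p \<bullet> (\<chi> n. v1 n 0) = 0" using sv by (auto simp: star_sol_def)
    have pN: "p \<in> end_space" unfolding p_def
      using complex_subspace_end p0(1) v0(1) by (auto simp: complex_subspace_def intro: subspace_diff)
    define \<delta> where "\<delta> = sqrt \<epsilon> * (KA * \<tau> + 3 * (Kv * \<Gamma>))"
    have Wp: "norm (W - p) \<le> \<delta>"
    proof -
      have "W - p = ((\<chi> n. f n \<epsilon>) - p0) - (\<chi> n. v n \<epsilon> - v n 0)" by (simp add: W_def p_def vec_eq_iff)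
      also have "norm \<dots> \<le> KA * (\<tau> * \<epsilon>) + 3 * (Kv * \<Gamma> * \<epsilon>)"
        using norm_triangle_ineq4[of "(\<chi> n. f n \<epsilon>) - p0" "(\<chi> n. v n \<epsilon> - v n 0)"] p0(2)
          norm_vec3_le[of "(\<chi> n. v n \<epsilon> - v n 0)" "Kv * \<Gamma> * \<epsilon>"] vb(3)[of \<epsilon>] e(1) by simp
      also have "\<dots> = \<epsilon> * (KA * \<tau> + 3 * (Kv * \<Gamma>))" by (simp add: algebra_simps)
      also have "\<dots> \<le> \<delta>" unfolding \<delta>_def using se KA(1) \<tau>0 nn \<Gamma> by (intro mult_right_mono) auto
      finally show ?thesis .
    qed
    define p' where "p' = (\<chi> n. cnj (p $ n))"
    have p'N: "p' \<in> end_space" unfolding p'_def by (rule end_space_cnj[OF pN])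
    have np': "norm p' = norm p" by (simp add: p'_def norm_vec_def)
    obtain k' where k': "\<And>n. of_real (c n 0) * p' $ n = k'" "(\<Sum>n\<in>UNIV. of_real (c1 n 0) * p' $ n) = 0"
      using p'N by (auto simp: end_space_def)
    text \<open>Test the derivatives against \<open>p'\<close>: the vertex terms cancel by the Kirchhoff conditions.\<close>
    have T1: "cmod (\<Sum>n\<in>UNIV. p' $ n * f1 n \<epsilon>) \<le> 3 * norm p * (\<tau> * sqrt \<epsilon>)"
    proof -
      \<comment> \<open>The term of size 1 / \<epsilon> is multiplied by the flux sum of
        \<open>p'\<close>, which is exactly 0; the vertex derivatives are multiplied by the common
        value of \<open>c n 0\<close> times \<open>p'\<close> and then sum to 0.\<close>
      have "(\<Sum>n\<in>UNIV. p' $ n * (f1 n \<epsilon> + (k * of_real (c1 n 0 / \<epsilon>) - f1 n 0 * of_real (c n 0)))) =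
        (\<Sum>n\<in>UNIV. p' $ n * f1 n \<epsilon>) + k / of_real \<epsilon> * (\<Sum>n\<in>UNIV. of_real (c1 n 0) * p' $ n)
          - (\<Sum>n\<in>UNIV. (of_real (c n 0) * p' $ n) * f1 n 0)"
        by (simp add: sum_subtractf sum.distrib sum_distrib_left algebra_simps)
      also have "(\<Sum>n\<in>UNIV. (of_real (c n 0) * p' $ n) * f1 n 0) = k' * (\<Sum>n\<in>UNIV. f1 n 0)"
        by (simp add: k' sum_distrib_left)
      finally show ?thesis using cmod_dot3_le[of "\<lambda>n. f1 n \<epsilon> + (k * of_real (c1 n 0 / \<epsilon>) - f1 n 0 * of_real (c n 0))"
          "\<tau> * sqrt \<epsilon>" p', OF E4] by (simp add: k k' np')
    qed
    have T2: "cmod (\<Sum>n\<in>UNIV. p' $ n * v1 n \<epsilon>) \<le> 3 * norm p * (Kv * \<Gamma> * sqrt \<epsilon>)"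
    proof -
      have "(\<Sum>n\<in>UNIV. p' $ n * (\<chi> n. v1 n 0) $ n) = 0"
        by (rule inner_zero_imp_dot_zero[OF complex_subspace_end end_space_cnj v0(2) p'N])
      then have "(\<Sum>n\<in>UNIV. p' $ n * v1 n \<epsilon>) = (\<Sum>n\<in>UNIV. p' $ n * (v1 n \<epsilon> - v1 n 0))"
        by (simp add: right_diff_distrib sum_subtractf)
      then show ?thesis
        using cmod_dot3_le[of "\<lambda>n. v1 n \<epsilon> - v1 n 0" "Kv * \<Gamma> * sqrt \<epsilon>" p'] vb(4)[of \<epsilon>] e(1) by (simp add: np')
    qed
    have T3: "cmod \<mu> * cmod (\<Sum>n\<in>UNIV. p' $ n * W $ n) \<le> 3 * norm p * ((\<tau> + Kv * \<Gamma>) * sqrt \<epsilon>)"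
    proof -
      have "- \<mu> * (\<Sum>n\<in>UNIV. p' $ n * W $ n) = (\<Sum>n\<in>UNIV. p' $ n * (f1 n \<epsilon> - v1 n \<epsilon>))"
        unfolding dec(1) by (simp add: sum_distrib_left mult.left_commute)
      also have "\<dots> = (\<Sum>n\<in>UNIV. p' $ n * f1 n \<epsilon>) - (\<Sum>n\<in>UNIV. p' $ n * v1 n \<epsilon>)"
        by (simp add: right_diff_distrib sum_subtractf)
      finally have "cmod (- \<mu> * (\<Sum>n\<in>UNIV. p' $ n * W $ n)) \<le> 3 * norm p * (\<tau> * sqrt \<epsilon>) + 3 * norm p * (Kv * \<Gamma> * sqrt \<epsilon>)"
        using norm_triangle_ineq4[of "\<Sum>n\<in>UNIV. p' $ n * f1 n \<epsilon>" "\<Sum>n\<in>UNIV. p' $ n * v1 n \<epsilon>"] T1 T2 by simp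
      then show ?thesis by (simp add: norm_mult algebra_simps)
    qed
    \<comment> \<open>The bilinear pairing of \<open>p'\<close> with \<open>p\<close> is the squared
      norm of \<open>p\<close>. Writing p = W - (W - p), the pairing with W is controlled by the
      derivatives and the rest is small by \<open>Wp\<close>.\<close>
    have T4: "norm p \<le> 3 * ((\<tau> + Kv * \<Gamma>) * sqrt \<epsilon>) / cmod \<mu> + 3 * \<delta>"
    proof (cases "norm p = 0")
      case True then show ?thesis unfolding \<delta>_def using se KA(1) \<tau>0 nn \<Gamma> \<mu>0 by simp
    next
      case False
      have "complex_of_real ((norm p)\<^sup>2) = (\<Sum>n\<in>UNIV. p' $ n * p $ n)"
        unfolding power2_norm_eq_inner
        by (simp add: inner_vec_def p'_def power2_norm_eq_inner[symmetric] complex_norm_square mult.commute del: of_real_power)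
      also have "\<dots> = (\<Sum>n\<in>UNIV. p' $ n * W $ n) - (\<Sum>n\<in>UNIV. p' $ n * (W - p) $ n)"
        by (simp add: right_diff_distrib sum_subtractf)
      finally have "cmod (complex_of_real ((norm p)\<^sup>2)) \<le> cmod (\<Sum>n\<in>UNIV. p' $ n * W $ n) + cmod (\<Sum>n\<in>UNIV. p' $ n * (W - p) $ n)"
        by (simp only: norm_triangle_ineq4)
      then have "(norm p)\<^sup>2 \<le> cmod (\<Sum>n\<in>UNIV. p' $ n * W $ n) + cmod (\<Sum>n\<in>UNIV. p' $ n * (W - p) $ n)"
        by (simp only: norm_of_real abs_power2)
      also have "cmod (\<Sum>n\<in>UNIV. p' $ n * W $ n) \<le> 3 * norm p * ((\<tau> + Kv * \<Gamma>) * sqrt \<epsilon>) / cmod \<mu>"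
        using T3 \<mu>0 by (simp add: pos_le_divide_eq mult.commute)
      also have "cmod (\<Sum>n\<in>UNIV. p' $ n * (W - p) $ n) \<le> 3 * norm p * \<delta>"
        using cmod_dot3_le[of "\<lambda>n. (W - p) $ n" \<delta> p'] order_trans[OF Finite_Cartesian_Product.norm_nth_le Wp] np' by simp
      finally have "norm p * norm p \<le> norm p * (3 * ((\<tau> + Kv * \<Gamma>) * sqrt \<epsilon>) / cmod \<mu> + 3 * \<delta>)"
        by (simp add: power2_eq_square distrib_left mult.left_commute mult.assoc)
      then show ?thesis using False by (simp add: mult_le_cancel_left)
    qed
    have "\<omega> \<le> norm p + norm (W - p)" unfolding \<omega>_def using norm_triangle_ineq[of p "W - p"] by simp
    also have "\<dots> \<le> 3 * ((\<tau> + Kv * \<Gamma>) * sqrt \<epsilon>) / cmod \<mu> + 4 * \<delta>" using T4 Wp by simp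
    also have "\<dots> \<le> 3 * (((Kt + Kv) * (\<Gamma> + \<omega>)) * sqrt \<epsilon>) / cmod \<mu> + 4 * (sqrt \<epsilon> * ((KA * Kt + 3 * Kv) * (\<Gamma> + \<omega>)))"
    proof -
      have "Kv * \<Gamma> \<le> Kv * (\<Gamma> + \<omega>)" using nn \<omega> by (intro mult_left_mono) auto
      then have "\<tau> + Kv * \<Gamma> \<le> (Kt + Kv) * (\<Gamma> + \<omega>)" "KA * \<tau> + 3 * (Kv * \<Gamma>) \<le> (KA * Kt + 3 * Kv) * (\<Gamma> + \<omega>)"
        unfolding \<tau>_def distrib_right by (simp_all add: mult.assoc)
      then show ?thesis unfolding \<delta>_def using se(1) \<mu>0 by (intro add_mono mult_left_mono mult_right_mono divide_right_mono) auto
    qed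
    also have "\<dots> = (sqrt \<epsilon> * Ks) * (\<Gamma> + \<omega>)" unfolding Ks_def by (simp add: algebra_simps add_divide_distrib)
    finally have \<omega>1: "\<omega> \<le> (sqrt \<epsilon> * Ks) * (\<Gamma> + \<omega>)" .
    \<comment> \<open>Half of \<omega> is absorbed on the left, which turns the implicit bound into
      \<omega> = O(sqrt \<epsilon>) \<Gamma>.\<close>
    have "(sqrt \<epsilon> * Ks) * \<omega> \<le> 1 / 2 * \<omega>" by (rule mult_right_mono[OF e2 \<omega>])
    with \<omega>1 have \<omega>2: "\<omega> \<le> 2 * Ks * sqrt \<epsilon> * \<Gamma>" by (simp add: algebra_simps)
    have "(sqrt \<epsilon> * Ks) * \<Gamma> \<le> 1 / 2 * \<Gamma>" by (rule mult_right_mono[OF e2 \<Gamma>])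
    with \<omega>2 have \<omega>3: "\<omega> \<le> \<Gamma>" by (simp add: algebra_simps)
    have dn: "(l2 (\<lambda>t. f n t - v n t))\<^sup>2 \<le> D * \<epsilon> * \<Gamma>\<^sup>2" for n
    proof -
      have "(l2 (\<lambda>t. f n t - v n t))\<^sup>2 \<le> \<epsilon> * ((2 * Kt + Kv) * \<Gamma>)\<^sup>2 + (2 * Ks * sqrt \<epsilon> * \<Gamma>)\<^sup>2 / (2 * Re \<mu>)"
      proof (rule l2_le_inner_and_tail[OF _ less_imp_le[OF e(1)] \<mu>(1)])
        show "continuous_on {0..} (\<lambda>t. f n t - v n t)"
          by (intro continuous_intros edge_sol_continuous(1)[OF ef] edge_sol_continuous(1)[OF ev])
        show "0 \<le> (2 * Kt + Kv) * \<Gamma>" using nn \<Gamma> by simp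
        fix t
        show "cmod (f n t - v n t) \<le> (2 * Kt + Kv) * \<Gamma>" if t: "t \<in> {0..\<epsilon>}"
        proof -
          have "\<tau> \<le> Kt * (\<Gamma> + \<Gamma>)" unfolding \<tau>_def using \<omega>3 nn by (intro mult_left_mono) auto
          then show ?thesis
            using norm_triangle_ineq4[of "f n t" "v n t"] E1[OF t, of n] vb(1)[of t n] t by (simp add: algebra_simps)
        qed
        show "cmod (f n t - v n t) \<le> 2 * Ks * sqrt \<epsilon> * \<Gamma> * exp (- Re \<mu> * (t - \<epsilon>))" if t: "\<epsilon> \<le> t"
          unfolding dec(2)[OF t] norm_mult using order_trans[OF W\<omega>[of n] \<omega>2]
          by (simp add: norm_exp_eq_Re mult_right_mono)
      qed
      also have "(2 * Ks * sqrt \<epsilon> * \<Gamma>)\<^sup>2 = (2 * Ks)\<^sup>2 * \<epsilon> * \<Gamma>\<^sup>2"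
        using e(1) by (simp add: power_mult_distrib)
      also have "\<epsilon> * ((2 * Kt + Kv) * \<Gamma>)\<^sup>2 + (2 * Ks)\<^sup>2 * \<epsilon> * \<Gamma>\<^sup>2 / (2 * Re \<mu>) = D * \<epsilon> * \<Gamma>\<^sup>2"
        unfolding D_def power_mult_distrib by (simp add: algebra_simps)
      finally show ?thesis .
    qed
    have "(norm (abs_star_L2 f - abs_star_L2 v))\<^sup>2 = (\<Sum>n\<in>UNIV. (l2 (\<lambda>t. f n t - v n t))\<^sup>2)"
      unfolding abs_star_L2_diff[OF fL vL] by (rule norm_abs_star_L2) (intro L2_half_diff fL vL)
    also have "\<dots> \<le> (\<Sum>n\<in>(UNIV :: 3 set). D * \<epsilon> * \<Gamma>\<^sup>2)" by (intro sum_mono dn)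
    also have "\<dots> = (sqrt (3 * D) * sqrt \<epsilon> * \<Gamma>)\<^sup>2"
      using nn(5) e(1) by (simp add: power_mult_distrib)
    finally have "norm (abs_star_L2 f - abs_star_L2 v) \<le> sqrt (3 * D) * sqrt \<epsilon> * \<Gamma>"
      by (rule power2_le_imp_le) (use nn e \<Gamma> in simp)
    then show "norm (abs_star_L2 f - abs_star_L2 v) \<le> sqrt (3 * D) * sqrt \<epsilon> * norm (abs_star_L2 g)"
      by (simp add: \<Gamma>_def)
  qed (use nn in auto)
qed

end

subsection \<open>The resonant problem\<close>

text \<open>Identifies the one-sided limits in \<open>kirchhoff\<close> and \<open>end_deriv\<close>
  with boundary values of the derivative; the sign at 1 is that of the direction away from the end
  point.\<close>

lemma unit_interval_limits:
  assumes d: "\<And>t. t \<in> {0..1} \<Longrightarrow> (f has_vector_derivative f' t) (at t within {0..1})"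
    and c: "continuous_on {0..1} f'"
  shows "(f \<longlongrightarrow> f 0) (at_right 0)"
    "Lim (at_right 0) (\<lambda>t. vector_derivative f (at t)) = f' 0"
    "Lim (at_left 1) (\<lambda>t. - vector_derivative f (at t)) = - f' (1::real)"
proof -
  have at: "(f has_vector_derivative f' t) (at t)" if "t \<in> {0<..<1}" for t
    using d[of t] at_within_interior[of t "{0..1}"] that by simp
  have w: "at 0 within {0..1::real} = at_right 0" "at 1 within {0..1::real} = at_left 1"
    by (simp_all add: at_within_Icc_at_right at_within_Icc_at_left)
  have r: "\<forall>\<^sub>F t in at_right 0. t \<in> {0<..<1::real}" by (rule eventually_at_right_real) simp
  have l: "\<forall>\<^sub>F t in at_left 1. t \<in> {0<..<1::real}" by (rule eventually_at_left_real) simp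
  have cf: "continuous_on {0..1} f" by (rule continuous_on_vector_derivative[OF d])
  then show "(f \<longlongrightarrow> f 0) (at_right 0)" by (auto simp: continuous_on_def w[symmetric])
  have "(f' \<longlongrightarrow> f' 0) (at_right 0)" using c by (auto simp: continuous_on_def w[symmetric])
  moreover have "\<forall>\<^sub>F t in at_right 0. f' t = vector_derivative f (at t)"
    using r by (rule eventually_mono) (metis at vector_derivative_at)
  ultimately show "Lim (at_right 0) (\<lambda>t. vector_derivative f (at t)) = f' 0"
    by (intro tendsto_Lim) (auto elim: Lim_transform_eventually)
  have "((\<lambda>t. - f' t) \<longlongrightarrow> - f' 1) (at_left 1)"
    using c by (auto simp: continuous_on_def w[symmetric] intro!: tendsto_minus)
  moreover have "\<forall>\<^sub>F t in at_left 1. - f' t = - vector_derivative f (at t)"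
    using l by (rule eventually_mono) (metis at vector_derivative_at)
  ultimately show "Lim (at_left 1) (\<lambda>t. - vector_derivative f (at t)) = - f' 1"
    by (intro tendsto_Lim) (auto elim: Lim_transform_eventually)
qed

interpretation end_pair: vector_space_pair star_scale "(*s) :: complex \<Rightarrow> complex ^ 3 \<Rightarrow> complex ^ 3"
  by unfold_locales

lemma linear_end_values: "Vector_Spaces.linear star_scale (*s) end_values"
  by unfold_locales (simp_all add: end_values_def star_scale_def vec_eq_iff)

locale star_resonance = star_fundamental +
  fixes \<alpha> :: real and Q :: "real star_fun"
  assumes q_eq: "\<And>n t. q n t = \<alpha> * Q n t"
begin

text \<open>On \<open>end_space\<close> this inverts \<open>end_values\<close>, which makes the
  resonant solutions isomorphic to a subspace of complex 3-space.\<close>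

definition extend_end :: "complex ^ 3 \<Rightarrow> complex star_fun" where
  "extend_end x = (\<lambda>n t. if t \<in> {0..1} then x $ n * of_real (c n t) else 0)"

lemma end_values_extend_end: "end_values (extend_end x) = x"
  by (simp add: end_values_def extend_end_def c vec_eq_iff)

lemma extend_end_resonant:
  assumes x: "x \<in> end_space" shows "extend_end x \<in> resonant_solutions \<alpha> Q"
proof -
  let ?f = "extend_end x"
  have d: "(?f n has_vector_derivative x $ n * of_real (c1 n t)) (at t within {0..1})"
    "((\<lambda>t. x $ n * of_real (c1 n t)) has_vector_derivative x $ n * of_real (q n t * c n t)) (at t within {0..1})"
    if t: "t \<in> {0..1}" for n t
  proof -
    have "(c n has_real_derivative c1 n t) (at t within {0..1})"
      "(c1 n has_real_derivative q n t * c n t) (at t within {0..1})"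
      using c(1)[of n] t unfolding ode_pair_def by blast+
    note 1 = this[THEN has_vector_derivative_of_real]
    have "((\<lambda>t. x $ n * of_real (c n t)) has_vector_derivative x $ n * of_real (c1 n t)) (at t within {0..1})"
      by (rule has_vector_derivative_mult_right[OF 1(1)])
    then show "(?f n has_vector_derivative x $ n * of_real (c1 n t)) (at t within {0..1})"
      by (rule has_vector_derivative_transform[OF t, rotated]) (simp add: extend_end_def)
    show "((\<lambda>t. x $ n * of_real (c1 n t)) has_vector_derivative x $ n * of_real (q n t * c n t)) (at t within {0..1})"
      by (rule has_vector_derivative_mult_right[OF 1(2)])
  qed
  have cd: "continuous_on {0..1} (\<lambda>t. x $ n * of_real (c1 n t))" for n
    by (intro continuous_intros ode_pair_continuous(2)[OF c(1)])
  have L: "(?f n \<longlongrightarrow> ?f n 0) (at_right 0)"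
    "Lim (at_right 0) (\<lambda>t. vector_derivative (?f n) (at t)) = x $ n * of_real (c1 n 0)"
    "Lim (at_left 1) (\<lambda>t. - vector_derivative (?f n) (at t)) = - (x $ n * of_real (c1 n 1))" for n
    by (rule unit_interval_limits[OF d(1)[where n=n] cd[of n]]; assumption)+
  obtain k where k: "\<And>n. of_real (c n 0) * x $ n = k" "(\<Sum>n\<in>UNIV. of_real (c1 n 0) * x $ n) = 0"
    using x by (auto simp: end_space_def)
  have f0: "?f n 0 = k" for n using k(1)[of n] by (simp add: extend_end_def mult.commute)
  have "kirchhoff ?f" unfolding kirchhoff_def
  proof (intro conjI exI[of _ k] allI)
    show "?f n 0 = k" for n by (rule f0)
    show "(?f n \<longlongrightarrow> k) (at_right 0)" for n using L(1)[of n] by (simp add: f0)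
    show "(\<Sum>n\<in>UNIV. vertex_deriv ?f n) = 0"
      using k(2) by (simp add: vertex_deriv_def L(2) mult.commute)
  qed
  moreover have "end_deriv ?f n = 0" for n by (simp add: end_deriv_def L(3) c)
  moreover have "\<exists>f' f''. \<forall>t\<in>{0..1}. (?f n has_vector_derivative f' t) (at t within {0..1}) \<and>
        (f' has_vector_derivative f'' t) (at t within {0..1}) \<and>
        - f'' t + of_real (\<alpha> * Q n t) * ?f n t = 0" for n
    by (intro exI[of _ "\<lambda>t. x $ n * of_real (c1 n t)"] exI[of _ "\<lambda>t. x $ n * of_real (q n t * c n t)"] ballI conjI d)
       (simp_all add: extend_end_def q_eq)
  ultimately show ?thesis unfolding resonant_solutions_def by (auto simp: extend_end_def)
qed

text \<open>With energy 0 and no right-hand side Green's identity is exact. Because of the Neumann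
  condition at 1 it gives f' c = f c' and f s' - f' s = f(1), and the Wronskian resolves this into f
  = c f(1) and f' = c' f(1).\<close>

lemma resonant_imp_end:
  assumes f: "f \<in> resonant_solutions \<alpha> Q"
  shows "end_values f \<in> end_space" "f = extend_end (end_values f)"
proof -
  have "\<forall>n. \<exists>f' f''. \<forall>t\<in>{0..1}. (f n has_vector_derivative f' t) (at t within {0..1}) \<and>
        (f' has_vector_derivative f'' t) (at t within {0..1}) \<and>
        - f'' t + of_real (\<alpha> * Q n t) * f n t = 0"
    using f by (simp add: resonant_solutions_def)
  then obtain f1 f2 where d: "\<And>n t. t \<in> {0..1} \<Longrightarrow> (f n has_vector_derivative f1 n t) (at t within {0..1})"
     "\<And>n t. t \<in> {0..1} \<Longrightarrow> (f1 n has_vector_derivative f2 n t) (at t within {0..1})"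
     "\<And>n t. t \<in> {0..1} \<Longrightarrow> - f2 n t + of_real (\<alpha> * Q n t) * f n t = 0" by metis
  have cd: "continuous_on {0..1} (f1 n)" for n
    by (rule continuous_on_vector_derivative[OF d(2)])
  have L: "Lim (at_right 0) (\<lambda>t. vector_derivative (f n) (at t)) = f1 n 0"
    "Lim (at_left 1) (\<lambda>t. - vector_derivative (f n) (at t)) = - f1 n 1" for n
    by (rule unit_interval_limits[OF d(1)[where n=n] cd[of n]]; assumption)+
  have kf: "kirchhoff f" and out: "\<And>n t. t \<notin> {0..1} \<Longrightarrow> f n t = 0" and ed: "\<And>n. end_deriv f n = 0"
    using f by (simp_all add: resonant_solutions_def)
  have f11: "f1 n 1 = 0" for n using ed[of n] L(2)[of n] by (simp add: end_deriv_def)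
  have acf: "ac {0..1} (f n) (f1 n)" for n by (rule acI_vector_derivative[OF d(1)]) (auto simp: is_interval_cc)
  \<comment> \<open>The derivative is written as the instance \<epsilon> = 1, \<zeta> = 0, g = 0 of
    the scaled equation, so that \<open>green_identity\<close> applies as it stands.\<close>
  have ac2: "ac {0..1} (f1 n) (\<lambda>t. (of_real (q n (t / 1) / 1\<^sup>2) - 0) * f n t - 0)" for n
    by (rule ac_cong[OF acI_vector_derivative[OF d(2)]])
       (use d(3) in \<open>auto simp: is_interval_cc q_eq neg_eq_iff_add_eq_0\<close>)
  have cq: "continuous_on {0..1} (q n)" for n using q[of n] by (auto simp: pot_def intro: continuous_on_subset)
  have z: "(\<lambda>t::real. 0 :: complex) absolutely_integrable_on {0..1}"
    by (rule L2_half_integrable_interval[OF L2_half_zero order_refl])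
  have sol: "f n t = of_real (c n t) * f n 1" "f1 n t = of_real (c1 n t) * f n 1" if t: "t \<in> {0..1}" for n t
  proof -
    let ?c = "complex_of_real (c n t)" and ?c1 = "complex_of_real (c1 n t)"
    let ?s = "complex_of_real (s n t)" and ?s1 = "complex_of_real (s1 n t)"
    have gc: "f n t * ?c1 = f1 n t * ?c"
      using integral_unique[OF green_identity[OF cq c(1) zero_less_one acf ac2 z t]] by (simp add: c f11)
    have gs: "f n t * ?s1 - f1 n t * ?s = f n 1"
      using integral_unique[OF green_identity[OF cq s(1) zero_less_one acf ac2 z t]] by (simp add: s f11)
    have "c n t * s1 n t - c1 n t * s n t = 1" using ode_pair_wronskian[OF c(1) s(1) t] by (simp add: c s)
    then have w: "?c * ?s1 - ?c1 * ?s = 1" by (metis of_real_1 of_real_diff of_real_mult)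
    have "?c * f n 1 = f n t * (?c * ?s1) - (f1 n t * ?c) * ?s" unfolding gs[symmetric] by (simp add: algebra_simps)
    also have "\<dots> = f n t * (?c * ?s1 - ?c1 * ?s)" unfolding gc[symmetric] by (simp add: algebra_simps)
    finally show "f n t = ?c * f n 1" by (simp add: w)
    have "?c1 * f n 1 = (f n t * ?c1) * ?s1 - f1 n t * (?c1 * ?s)" unfolding gs[symmetric] by (simp add: algebra_simps)
    also have "\<dots> = f1 n t * (?c * ?s1 - ?c1 * ?s)" unfolding gc by (simp add: algebra_simps)
    finally show "f1 n t = ?c1 * f n 1" by (simp add: w)
  qed
  show "f = extend_end (end_values f)"
  proof (intro ext)
    fix n t
    show "f n t = extend_end (end_values f) n t"
    proof (cases "t \<in> {0..1}")
      case True
      have "extend_end (end_values f) n t = of_real (c n t) * f n 1"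
        using True by (simp add: extend_end_def end_values_def)
      then show ?thesis using sol(1)[OF True] by (rule trans[OF _ sym, rotated])
    qed (auto simp: extend_end_def out)
  qed
  have z01: "(0::real) \<in> {0..1}" by simp
  obtain k where "\<And>n. f n 0 = k" using kf by (auto simp: kirchhoff_def)
  then have "of_real (c n 0) * f n 1 = k" for n using sol(1)[OF z01, of n] by simp
  moreover have "(\<Sum>n\<in>UNIV. f1 n 0) = 0" using kf by (simp add: kirchhoff_def vertex_deriv_def L(1))
  then have "(\<Sum>n\<in>UNIV. of_real (c1 n 0) * f n 1) = 0" unfolding sol(2)[OF z01] .
  ultimately show "end_values f \<in> end_space" by (simp add: end_space_def end_values_def)
qed

lemma resonant_iff: "f \<in> resonant_solutions \<alpha> Q \<longleftrightarrow> end_values f \<in> end_space \<and> f = extend_end (end_values f)"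
  using resonant_imp_end extend_end_resonant by metis

lemma vec_subspace_end: "vec.subspace end_space"
  unfolding vec.subspace_def
proof (intro conjI ballI allI)
  have N: "subspace end_space" using complex_subspace_end by (simp add: complex_subspace_def)
  then show "0 \<in> end_space" "\<And>x y. x \<in> end_space \<Longrightarrow> y \<in> end_space \<Longrightarrow> x + y \<in> end_space"
    by (auto intro: subspace_0 subspace_add)
  fix z x assume x: "x \<in> end_space"
  then have "(\<chi> n. \<i> * x $ n) \<in> end_space" using complex_subspace_end by (simp add: complex_subspace_def)
  then have "Re z *\<^sub>R x + Im z *\<^sub>R (\<chi> n. \<i> * x $ n) \<in> end_space"
    using N x by (intro subspace_add subspace_scale)
  moreover have "Re z *\<^sub>R x + Im z *\<^sub>R (\<chi> n. \<i> * x $ n) = z *s x"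
    unfolding vec_eq_iff vector_add_component vector_scaleR_component vector_smult_component vec_lambda_beta
    by (auto simp: complex_eq_iff)
  ultimately show "z *s x \<in> end_space" by simp
qed

lemma extend_end_linear:
  "extend_end (x + y) = extend_end x + extend_end y" "extend_end (z *s x) = star_scale z (extend_end x)"
  "extend_end 0 = 0"
  by (auto simp: extend_end_def star_scale_def fun_eq_iff algebra_simps)

lemma subspace_resonant: "star_fun.subspace (resonant_solutions \<alpha> Q)"
  unfolding star_fun.subspace_def
proof (intro conjI ballI allI)
  show "0 \<in> resonant_solutions \<alpha> Q"
    using extend_end_resonant[OF vec.subspace_0[OF vec_subspace_end]] by (simp add: extend_end_linear)
  fix f assume "f \<in> resonant_solutions \<alpha> Q"
  then have f: "end_values f \<in> end_space" "f = extend_end (end_values f)" by (auto simp: resonant_iff)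
  show "star_scale z f \<in> resonant_solutions \<alpha> Q" for z
    using extend_end_resonant[OF vec.subspace_scale[OF vec_subspace_end f(1), of z]] f(2)
    by (simp add: extend_end_linear)
  fix g assume "g \<in> resonant_solutions \<alpha> Q"
  then have g: "end_values g \<in> end_space" "g = extend_end (end_values g)" by (auto simp: resonant_iff)
  show "f + g \<in> resonant_solutions \<alpha> Q"
    using extend_end_resonant[OF vec.subspace_add[OF vec_subspace_end f(1) g(1)]] f(2) g(2)
    by (simp add: extend_end_linear)
qed

text \<open>If the first unit vector belonged to the space, continuity at the vertex would force
  \<open>c 1 0 = 0\<close> and the flux condition \<open>c1 1 0 = 0\<close>, against the Wronskian.
  This excludes multiplicity 3.\<close>

lemma end_space_proper: "end_space \<noteq> UNIV"
proof
  assume U: "end_space = UNIV"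
  have "(\<chi> n. if n = 1 then 1 else 0) \<in> end_space" by (simp add: U)
  then obtain k where k: "\<And>n. of_real (c n 0) * (if n = 1 then 1 else (0::complex)) = k"
     "(\<Sum>n\<in>UNIV. of_real (c1 n 0) * (if n = 1 then 1 else (0::complex))) = 0" by (auto simp: end_space_def)
  have "k = 0" using k(1)[of 2] by simp
  then have "c 1 0 = 0" using k(1)[of 1] by simp
  moreover have "c1 1 0 = 0" using k(2) by (simp add: sum_3)
  moreover have "c 1 0 * s1 1 0 - c1 1 0 * s 1 0 = 1"
    using ode_pair_wronskian[OF c(1) s(1), of 0 1] by (simp add: c s)
  ultimately show False by simp
qed

text \<open>End values determine a resonant solution, so a basis maps injectively to an independent
  set in complex 3-space; three vectors would span everything and exceed the proper subspace of end
  values. Hence the simple and the double case exhaust the resonant one.\<close>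

lemma dim_resonant:
  assumes "resonant_eigenvalue \<alpha> Q"
  shows "star_fun.dim (resonant_solutions \<alpha> Q) = 1 \<or> star_fun.dim (resonant_solutions \<alpha> Q) = 2"
proof -
  let ?R = "resonant_solutions \<alpha> Q"
  obtain B where B: "B \<subseteq> ?R" "star_fun.independent B" "?R \<subseteq> star_fun.span B" "card B = star_fun.dim ?R"
    by (rule star_fun.basis_exists)
  have sB: "star_fun.span B \<subseteq> ?R" by (rule star_fun.span_minimal[OF B(1) subspace_resonant])
  have inj: "inj_on end_values ?R" by (rule inj_onI) (metis resonant_iff)
  have ind: "vec.independent (end_values ` B)"
    by (rule end_pair.linear_independent_injective_image[OF linear_end_values B(2) inj_on_subset[OF inj sB]])
  have injB: "inj_on end_values B" by (rule inj_on_subset[OF inj B(1)])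
  have finB: "finite B" using vec.finiteI_independent[OF ind] injB by (simp add: finite_image_iff)
  have card: "card (end_values ` B) = card B" by (rule card_image[OF injB])
  have "card B \<le> 2"
  proof (rule ccontr)
    assume "\<not> card B \<le> 2"
    then have "vec.dim (UNIV :: (complex ^ 3) set) \<le> card (end_values ` B)" by (simp add: card card_cart_basis)
    then have "UNIV \<subseteq> vec.span (end_values ` B)" by (intro vec.card_ge_dim_independent ind) auto
    also have "\<dots> \<subseteq> end_space"
      by (rule vec.span_minimal[OF _ vec_subspace_end]) (use B(1) in \<open>auto simp: resonant_iff\<close>)
    finally show False using end_space_proper by auto
  qed
  moreover have "card B \<noteq> 0"
  proof
    assume "card B = 0"
    then have "B = {}" using finB by simp
    then have "?R \<subseteq> {0}" using B(3) by simp
    then show False using assms by (auto simp: resonant_eigenvalue_def)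
  qed
  ultimately show ?thesis using B(4) by auto
qed

lemma end_space_nonresonant:
  assumes "\<not> resonant_eigenvalue \<alpha> Q" shows "end_space = {0}"
proof -
  have "x = 0" if "x \<in> end_space" for x
  proof -
    have "extend_end x = 0" using extend_end_resonant[OF that] assms by (auto simp: resonant_eigenvalue_def)
    then have "end_values (extend_end x) = 0" by (simp add: end_values_def vec_eq_iff)
    then show ?thesis by (simp add: end_values_extend_end)
  qed
  then show ?thesis using vec.subspace_0[OF vec_subspace_end] by auto
qed

lemma end_space_simple:
  assumes "simple_eigenvalue \<alpha> Q" "eigenfunction \<alpha> Q \<phi>"
  shows "end_space = range (\<lambda>z. z *s end_values \<phi>)"
proof -
  let ?R = "resonant_solutions \<alpha> Q"
  have \<phi>: "\<phi> \<in> ?R" "\<phi> \<noteq> 0" using assms(2) by (auto simp: eigenfunction_def)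
  obtain B where B: "B \<subseteq> ?R" "star_fun.independent B" "?R \<subseteq> star_fun.span B" "card B = star_fun.dim ?R"
    by (rule star_fun.basis_exists)
  then have "card B = 1" using assms(1) by (simp add: simple_eigenvalue_def)
  then obtain b where b: "B = {b}" by (auto simp: card_1_singleton_iff)
  then have R: "f \<in> ?R \<Longrightarrow> \<exists>z. f = star_scale z b" for f using B(3) by (auto simp: star_fun.span_singleton)
  obtain k where k: "\<phi> = star_scale k b" using R[OF \<phi>(1)] by blast
  have k0: "k \<noteq> 0" using \<phi>(2) unfolding k by (metis star_fun.scale_zero_left)
  show ?thesis
  proof (intro equalityI subsetI)
    fix x assume x: "x \<in> end_space"
    obtain z where "extend_end x = star_scale z b" using R[OF extend_end_resonant[OF x]] by blast
    then have "extend_end x = star_scale (z / k) \<phi>" unfolding k using k0 by (simp add: star_scale_def)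
    then have "end_values (extend_end x) = (z / k) *s end_values \<phi>"
      by (simp add: end_values_def star_scale_def vec_eq_iff)
    then show "x \<in> range (\<lambda>z. z *s end_values \<phi>)" unfolding end_values_extend_end by (rule range_eqI)
  next
    fix x assume "x \<in> range (\<lambda>z. z *s end_values \<phi>)"
    then show "x \<in> end_space"
      using resonant_imp_end(1)[OF \<phi>(1)] by (auto intro: vec.subspace_scale[OF vec_subspace_end])
  qed
qed

text \<open>A resonant solution with end values 0 vanishes, so independence of the two functions
  passes to their end values; the vector product needs exactly this.\<close>

lemma end_space_double:
  assumes "eigenbasis \<alpha> Q \<phi> \<psi>"
  defines "\<theta> \<equiv> end_values \<phi>" and "\<eta> \<equiv> end_values \<psi>"
  shows "end_space = {a *s \<theta> + b *s \<eta> | a b. True}" "\<And>a b. a *s \<theta> + b *s \<eta> = 0 \<Longrightarrow> a = 0 \<and> b = 0"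
proof -
  let ?R = "resonant_solutions \<alpha> Q"
  have ind: "star_fun.independent {\<phi>, \<psi>}" and ne: "\<phi> \<noteq> \<psi>" and span: "star_fun.span {\<phi>, \<psi>} = ?R"
    using assms(1) by (auto simp: eigenbasis_def)
  have R: "\<phi> \<in> ?R" "\<psi> \<in> ?R" unfolding span[symmetric] by (auto intro: star_fun.span_base)
  have ev: "end_values (star_scale a \<phi> + star_scale b \<psi>) = a *s \<theta> + b *s \<eta>" for a b
    by (simp add: \<theta>_def \<eta>_def end_values_def star_scale_def vec_eq_iff)
  show "end_space = {a *s \<theta> + b *s \<eta> | a b. True}"
  proof (intro equalityI subsetI)
    fix x assume "x \<in> end_space"
    then have "extend_end x \<in> star_fun.span {\<phi>, \<psi>}" using extend_end_resonant span by simp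
    then obtain a b where "extend_end x - star_scale a \<phi> = star_scale b \<psi>"
      by (auto simp: star_fun.span_insert star_fun.span_singleton)
    then have "extend_end x = star_scale a \<phi> + star_scale b \<psi>" by (simp add: algebra_simps)
    then have "x = a *s \<theta> + b *s \<eta>" using ev end_values_extend_end by metis
    then show "x \<in> {a *s \<theta> + b *s \<eta> | a b. True}" by blast
  next
    fix x assume "x \<in> {a *s \<theta> + b *s \<eta> | a b. True}"
    then show "x \<in> end_space"
      using resonant_imp_end(1)[OF R(1)] resonant_imp_end(1)[OF R(2)] unfolding \<theta>_def \<eta>_def
      by (auto intro!: vec.subspace_add[OF vec_subspace_end] vec.subspace_scale[OF vec_subspace_end])
  qed
  fix a b assume "a *s \<theta> + b *s \<eta> = 0"
  moreover have "star_scale a \<phi> + star_scale b \<psi> \<in> ?R"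
    using R by (intro star_fun.subspace_add[OF subspace_resonant] star_fun.subspace_scale[OF subspace_resonant])
  ultimately have z: "star_scale a \<phi> + star_scale b \<psi> = 0"
    using resonant_imp_end(2) ev extend_end_linear(3) by metis
  have nz: "\<psi> \<noteq> 0" "\<phi> \<notin> star_fun.span {\<psi>}"
    using ind ne star_fun.independent_insert[of \<phi> "{\<psi>}"] star_fun.dependent_zero[of "{\<phi>, \<psi>}"] by auto
  have a: "a = 0"
  proof (rule ccontr)
    assume a: "a \<noteq> 0"
    have "star_scale (1 / a) (star_scale a \<phi> + star_scale b \<psi>) = 0" by (simp add: z)
    then have "\<phi> = star_scale (- b / a) \<psi>" using a
      by (simp add: star_scale_def fun_eq_iff field_simps eq_neg_iff_add_eq_0)
    then have "\<phi> \<in> star_fun.span {\<psi>}" unfolding star_fun.span_singleton by (rule range_eqI)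
    then show False using nz(2) by blast
  qed
  moreover have "b = 0" using z nz(1) a by (simp add: star_fun.scale_eq_0_iff)
  ultimately show "a = 0 \<and> b = 0" by blast
qed

end

section \<open>The limit conditions as subspace conditions\<close>

lemma dot_zero_iff_inner_zero:
  assumes N: "complex_subspace N" "\<And>p. p \<in> N \<Longrightarrow> (\<chi> n. cnj (p $ n)) \<in> N"
  shows "(\<forall>p\<in>N. p \<bullet> y = 0) \<longleftrightarrow> (\<forall>p\<in>N. (\<Sum>n\<in>UNIV. p $ n * y $ n) = 0)"
proof
  assume "\<forall>p\<in>N. p \<bullet> y = 0"
  then show "\<forall>p\<in>N. (\<Sum>n\<in>UNIV. p $ n * y $ n) = 0" using inner_zero_imp_dot_zero[OF N] by blast
next
  assume *: "\<forall>p\<in>N. (\<Sum>n\<in>UNIV. p $ n * y $ n) = 0"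
  show "\<forall>p\<in>N. p \<bullet> y = 0"
  proof
    fix p assume "p \<in> N"
    then have "(\<Sum>n\<in>UNIV. (\<chi> n. cnj (p $ n)) $ n * y $ n) = 0" using * N(2) by blast
    then have "Re (\<Sum>n\<in>UNIV. cnj (p $ n) * y $ n) = 0" by simp
    then show "p \<bullet> y = 0" by (simp add: inner_vec_def inner_complex_def)
  qed
qed

text \<open>The vector product spans the complement of the plane of \<theta> and \<eta> with respect
  to the bilinear pairing. No conjugates occur, so the identities for real vectors carry over to
  complex ones.\<close>

lemma vector_product_conditions:
  fixes \<theta> \<eta> :: "complex ^ 3"
  assumes ind: "\<And>a b. a *s \<theta> + b *s \<eta> = 0 \<Longrightarrow> a = 0 \<and> b = 0"
  defines "X \<equiv> vector_product \<theta> \<eta>"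
  shows "(\<exists>z. \<forall>n. y $ n = z * X $ n) \<longleftrightarrow>
      (\<Sum>n\<in>UNIV. \<theta> $ n * y $ n) = 0 \<and> (\<Sum>n\<in>UNIV. \<eta> $ n * y $ n) = 0"
    and "(\<Sum>n\<in>UNIV. X $ n * x $ n) = 0 \<longleftrightarrow> (\<exists>a b. x = a *s \<theta> + b *s \<eta>)"
proof -
  have X: "X $ 1 = \<theta>$2 * \<eta>$3 - \<theta>$3 * \<eta>$2" "X $ 2 = \<theta>$3 * \<eta>$1 - \<theta>$1 * \<eta>$3" "X $ 3 = \<theta>$1 * \<eta>$2 - \<theta>$2 * \<eta>$1"
    by (simp_all add: X_def vector_product_def vector_3)
  have nz: "X $ 1 \<noteq> 0 \<or> X $ 2 \<noteq> 0 \<or> X $ 3 \<noteq> 0"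
  proof (rule ccontr)
    assume "\<not> ?thesis"
    then have z: "\<theta>$2 * \<eta>$3 = \<theta>$3 * \<eta>$2" "\<theta>$3 * \<eta>$1 = \<theta>$1 * \<eta>$3" "\<theta>$1 * \<eta>$2 = \<theta>$2 * \<eta>$1" by (simp_all add: X)
    \<comment> \<open>The vanishing of \<open>X\<close> says that all 2 x 2 minors vanish, which is
      a linear relation between \<theta> and \<eta> for each index.\<close>
    then have "\<eta>$n *s \<theta> + (- \<theta>$n) *s \<eta> = 0" for n
      using exhaust_3[of n] by (auto simp: vec_eq_iff forall_3 algebra_simps)
    then have "\<theta> = 0" using ind by (metis neg_equal_0_iff_equal vec_eq_iff zero_index)
    then have "1 *s \<theta> + 0 *s \<eta> = 0" by simp
    then show False using ind[of 1 0] by simp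
  qed
  show "(\<exists>z. \<forall>n. y $ n = z * X $ n) \<longleftrightarrow>
      (\<Sum>n\<in>UNIV. \<theta> $ n * y $ n) = 0 \<and> (\<Sum>n\<in>UNIV. \<eta> $ n * y $ n) = 0"
  proof
    assume "\<exists>z. \<forall>n. y $ n = z * X $ n"
    then show "(\<Sum>n\<in>UNIV. \<theta> $ n * y $ n) = 0 \<and> (\<Sum>n\<in>UNIV. \<eta> $ n * y $ n) = 0"
      by (auto simp: sum_3 X algebra_simps)
  next
    assume "(\<Sum>n\<in>UNIV. \<theta> $ n * y $ n) = 0 \<and> (\<Sum>n\<in>UNIV. \<eta> $ n * y $ n) = 0"
    then have o: "\<theta>$1 * y$1 + \<theta>$2 * y$2 + \<theta>$3 * y$3 = 0" "\<eta>$1 * y$1 + \<eta>$2 * y$2 + \<eta>$3 * y$3 = 0"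
      by (simp_all add: sum_3)
    \<comment> \<open>The components of y \<times> (\<theta> \<times> \<eta>) = (y \<cdot> \<eta>)
      \<theta> - (y \<cdot> \<theta>) \<eta>, which is 0 here; so y is parallel to
      \<open>X\<close>.\<close>
    have par: "y$2 * X$3 = y$3 * X$2" "y$3 * X$1 = y$1 * X$3" "y$1 * X$2 = y$2 * X$1"
      using o unfolding X by algebra+
    show "\<exists>z. \<forall>n. y $ n = z * X $ n"
      using nz
    proof (elim disjE)
      assume "X $ 1 \<noteq> 0" then show ?thesis using par by (intro exI[of _ "y$1 / X$1"]) (auto simp: forall_3 field_simps)
    next
      assume "X $ 2 \<noteq> 0" then show ?thesis using par by (intro exI[of _ "y$2 / X$2"]) (auto simp: forall_3 field_simps)
    next
      assume "X $ 3 \<noteq> 0" then show ?thesis using par by (intro exI[of _ "y$3 / X$3"]) (auto simp: forall_3 field_simps)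
    qed
  qed
  show "(\<Sum>n\<in>UNIV. X $ n * x $ n) = 0 \<longleftrightarrow> (\<exists>a b. x = a *s \<theta> + b *s \<eta>)"
  proof
    assume "\<exists>a b. x = a *s \<theta> + b *s \<eta>"
    then show "(\<Sum>n\<in>UNIV. X $ n * x $ n) = 0" by (auto simp: sum_3 X algebra_simps)
  next
    assume "(\<Sum>n\<in>UNIV. X $ n * x $ n) = 0"
    then have o: "X$1 * x$1 + X$2 * x$2 + X$3 * x$3 = 0" by (simp add: sum_3)
    text \<open>Cramer's rule for the two rows other than the one belonging to a nonzero component of \<open>X\<close>.\<close>
    have "\<exists>a b. \<forall>n. X $ m * x $ n = a * \<theta> $ n + b * \<eta> $ n" for m
    proof -
      have "m = 1 \<or> m = 2 \<or> m = 3" by (rule exhaust_3)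
      then show ?thesis
      proof (elim disjE)
        assume m: "m = 1"
        have "X$1 * x$1 = - (X$2 * x$2) - X$3 * x$3" "X$2 * x$2 = - (X$1 * x$1) - X$3 * x$3"
          "X$3 * x$3 = - (X$1 * x$1) - X$2 * x$2" using o by (simp_all add: algebra_simps eq_neg_iff_add_eq_0)
        note e = this(1)
        show ?thesis unfolding m forall_3 e
          by (rule exI[of _ "x$2 * \<eta>$3 - x$3 * \<eta>$2"], rule exI[of _ "\<theta>$2 * x$3 - \<theta>$3 * x$2"])
             (simp add: X algebra_simps)
      next
        assume m: "m = 2"
        have "X$1 * x$1 = - (X$2 * x$2) - X$3 * x$3" "X$2 * x$2 = - (X$1 * x$1) - X$3 * x$3"
          "X$3 * x$3 = - (X$1 * x$1) - X$2 * x$2" using o by (simp_all add: algebra_simps eq_neg_iff_add_eq_0)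
        note e = this(2)
        show ?thesis unfolding m forall_3 e
          by (rule exI[of _ "x$3 * \<eta>$1 - x$1 * \<eta>$3"], rule exI[of _ "\<theta>$3 * x$1 - \<theta>$1 * x$3"])
             (simp add: X algebra_simps)
      next
        assume m: "m = 3"
        have "X$1 * x$1 = - (X$2 * x$2) - X$3 * x$3" "X$2 * x$2 = - (X$1 * x$1) - X$3 * x$3"
          "X$3 * x$3 = - (X$1 * x$1) - X$2 * x$2" using o by (simp_all add: algebra_simps eq_neg_iff_add_eq_0)
        note e = this(3)
        show ?thesis unfolding m forall_3 e
          by (rule exI[of _ "x$1 * \<eta>$2 - x$2 * \<eta>$1"], rule exI[of _ "\<theta>$1 * x$2 - \<theta>$2 * x$1"])
             (simp add: X algebra_simps)
      qed
    qed
    moreover obtain m where m: "X $ m \<noteq> 0" using nz by blast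
    ultimately obtain a b where ab: "\<And>n. X $ m * x $ n = a * \<theta> $ n + b * \<eta> $ n" by blast
    have "x = (a / X $ m) *s \<theta> + (b / X $ m) *s \<eta>"
      using ab m by (simp add: vec_eq_iff field_simps)
    then show "\<exists>a b. x = a *s \<theta> + b *s \<eta>" by blast
  qed
qed

context star_resonance
begin

text \<open>The space is 0, the line of \<theta>, or the plane of both end-value vectors. In the
  double case \<theta> is the normal of the plane, so the roles interchange: the derivative being
  proportional to \<theta> expresses orthogonality to the plane, and the sum condition puts the
  values into the plane.\<close>

lemma vertex_condition_limit:
  assumes simple: "simple_eigenvalue \<alpha> Q \<Longrightarrow> eigenfunction \<alpha> Q \<phi>"
    and double: "double_eigenvalue \<alpha> Q \<Longrightarrow> eigenbasis \<alpha> Q \<phi> \<psi>"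
  shows "vertex_condition_of end_space (limit_condition \<alpha> Q \<phi> \<psi>)"
  unfolding vertex_condition_of_def
proof (intro allI impI)
  fix f f1 :: "complex star_fun"
  assume "\<forall>n. ac {0..} (f n) (f1 n) \<and> continuous_on {0..} (f1 n)"
  then have vd: "vertex_deriv f n = f1 n 0" for n by (simp add: vertex_deriv_def ac_vertex_limit)
  define x y where "x = (\<chi> n. f n 0)" and "y = (\<chi> n. f1 n 0)"
  have xy: "f n 0 = x $ n" "f1 n 0 = y $ n" for n by (simp_all add: x_def y_def)
  have dot: "(\<forall>p\<in>end_space. p \<bullet> y = 0) \<longleftrightarrow> (\<forall>p\<in>end_space. (\<Sum>n\<in>UNIV. p $ n * y $ n) = 0)"
    by (rule dot_zero_iff_inner_zero[OF complex_subspace_end end_space_cnj])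
  have "limit_condition \<alpha> Q \<phi> \<psi> f \<longleftrightarrow> x \<in> end_space \<and> (\<forall>p\<in>end_space. (\<Sum>n\<in>UNIV. p $ n * y $ n) = 0)"
  proof (cases "resonant_eigenvalue \<alpha> Q")
    case False
    then show ?thesis
      by (simp add: limit_condition_def simple_eigenvalue_def double_eigenvalue_def end_space_nonresonant xy vec_eq_iff)
  next
    case True
    then consider "simple_eigenvalue \<alpha> Q" "\<not> double_eigenvalue \<alpha> Q" | "double_eigenvalue \<alpha> Q" "\<not> simple_eigenvalue \<alpha> Q"
      using dim_resonant by (auto simp: simple_eigenvalue_def double_eigenvalue_def)
    then show ?thesis
    proof cases
      case 1
      let ?\<theta> = "end_values \<phi>"
      note N = end_space_simple[OF 1(1) simple[OF 1(1)]]
      have "limit_condition \<alpha> Q \<phi> \<psi> f \<longleftrightarrow> (\<exists>z. \<forall>n. x $ n = z * ?\<theta> $ n) \<and> (\<Sum>n\<in>UNIV. ?\<theta> $ n * y $ n) = 0"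
        using True 1 by (simp add: limit_condition_def Let_def vd xy)
      moreover have "(\<exists>z. \<forall>n. x $ n = z * ?\<theta> $ n) \<longleftrightarrow> x \<in> end_space" unfolding N by (auto simp: vec_eq_iff)
      moreover have "(\<Sum>n\<in>UNIV. ?\<theta> $ n * y $ n) = 0 \<longleftrightarrow> (\<forall>p\<in>end_space. (\<Sum>n\<in>UNIV. p $ n * y $ n) = 0)"
      proof -
        have "(\<Sum>n\<in>UNIV. (z *s ?\<theta>) $ n * y $ n) = z * (\<Sum>n\<in>UNIV. ?\<theta> $ n * y $ n)" for z
          by (simp add: sum_distrib_left mult.assoc)
        then show ?thesis unfolding N by (auto dest: spec[of _ 1])
      qed
      ultimately show ?thesis by blast
    next
      case 2
      let ?\<theta> = "end_values \<phi>" and ?\<eta> = "end_values \<psi>"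
      note N = end_space_double[OF double[OF 2(1)]]
      note X = vector_product_conditions[where \<theta>="?\<theta>" and \<eta>="?\<eta>", OF N(2)]
      have "limit_condition \<alpha> Q \<phi> \<psi> f \<longleftrightarrow> (\<exists>z. \<forall>n. y $ n = z * vector_product ?\<theta> ?\<eta> $ n) \<and>
          (\<Sum>n\<in>UNIV. vector_product ?\<theta> ?\<eta> $ n * x $ n) = 0"
        using True 2 by (simp add: limit_condition_def Let_def vd xy)
      moreover have "(\<Sum>n\<in>UNIV. vector_product ?\<theta> ?\<eta> $ n * x $ n) = 0 \<longleftrightarrow> x \<in> end_space"
        using X(2)[of x] unfolding N(1) by blast
      moreover have "(\<exists>z. \<forall>n. y $ n = z * vector_product ?\<theta> ?\<eta> $ n) \<longleftrightarrow> (\<forall>p\<in>end_space. (\<Sum>n\<in>UNIV. p $ n * y $ n) = 0)"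
      proof -
        have lin: "(\<Sum>n\<in>UNIV. (a *s ?\<theta> + b *s ?\<eta>) $ n * y $ n) =
            a * (\<Sum>n\<in>UNIV. ?\<theta> $ n * y $ n) + b * (\<Sum>n\<in>UNIV. ?\<eta> $ n * y $ n)" for a b
          by (simp add: sum_distrib_left sum.distrib algebra_simps)
        have "?\<theta> \<in> end_space" unfolding N(1) by (rule CollectI, rule exI[of _ 1], rule exI[of _ 0]) simp
        moreover have "?\<eta> \<in> end_space" unfolding N(1) by (rule CollectI, rule exI[of _ 0], rule exI[of _ 1]) simp
        moreover have "(\<Sum>n\<in>UNIV. p $ n * y $ n) = 0"
          if "(\<Sum>n\<in>UNIV. ?\<theta> $ n * y $ n) = 0" "(\<Sum>n\<in>UNIV. ?\<eta> $ n * y $ n) = 0" "p \<in> end_space" for p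
          using that(3) lin that(1,2) unfolding N(1) by auto
        ultimately show ?thesis using X(1)[of y] by blast
      qed
      ultimately show ?thesis by blast
    qed
  qed
  then show "limit_condition \<alpha> Q \<phi> \<psi> f \<longleftrightarrow>
      (\<chi> n. f n 0) \<in> end_space \<and> (\<forall>p\<in>end_space. p \<bullet> (\<chi> n. f1 n 0) = 0)"
    unfolding x_def[symmetric] y_def[symmetric] dot .
qed

end

lemma vertex_condition_kirchhoff: "vertex_condition_of kirchhoff_space kirchhoff"
  unfolding vertex_condition_of_def
proof (intro allI impI)
  fix f f1 :: "complex star_fun"
  assume a: "\<forall>n. ac {0..} (f n) (f1 n) \<and> continuous_on {0..} (f1 n)"
  then have vd: "vertex_deriv f n = f1 n 0" for n by (simp add: vertex_deriv_def ac_vertex_limit)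
  have lim: "(f n \<longlongrightarrow> f n 0) (at_right 0)" for n
    using ac_continuous[of "f n" "f1 n"] a by (auto simp: continuous_on_def at_within_Ici_at_right[symmetric])
  have cnjN: "(\<chi> n. cnj (p $ n)) \<in> kirchhoff_space" if "p \<in> kirchhoff_space" for p
    using that by (auto simp: kirchhoff_space_def)
  have "(\<forall>p\<in>kirchhoff_space. p \<bullet> (\<chi> n. f1 n 0) = 0) \<longleftrightarrow> (\<Sum>n\<in>UNIV. f1 n 0) = 0"
  proof -
    have "(\<forall>p\<in>kirchhoff_space. p \<bullet> (\<chi> n. f1 n 0) = 0) \<longleftrightarrow>
        (\<forall>p\<in>kirchhoff_space. (\<Sum>n\<in>UNIV. p $ n * f1 n 0) = 0)"
      using dot_zero_iff_inner_zero[OF complex_subspace_kirchhoff cnjN, of "\<chi> n. f1 n 0"] by simp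
    also have "\<dots> \<longleftrightarrow> (\<Sum>n\<in>UNIV. f1 n 0) = 0"
    proof
      assume "\<forall>p\<in>kirchhoff_space. (\<Sum>n\<in>UNIV. p $ n * f1 n 0) = 0"
      moreover have "(\<chi> n. 1) \<in> kirchhoff_space" by (simp add: kirchhoff_space_def)
      ultimately have "(\<Sum>n\<in>UNIV. (\<chi> n. 1) $ n * f1 n 0) = 0" by blast
      then show "(\<Sum>n\<in>UNIV. f1 n 0) = 0" by simp
    qed (auto simp: kirchhoff_space_def sum_distrib_left[symmetric])
    finally show ?thesis .
  qed
  moreover have "(\<exists>c. \<forall>n. f n 0 = c \<and> (f n \<longlongrightarrow> c) (at_right 0)) \<longleftrightarrow> (\<chi> n. f n 0) \<in> kirchhoff_space"
    unfolding kirchhoff_space_def using lim by auto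
  ultimately show "kirchhoff f \<longleftrightarrow> (\<chi> n. f n 0) \<in> kirchhoff_space \<and> (\<forall>p\<in>kirchhoff_space. p \<bullet> (\<chi> n. f1 n 0) = 0)"
    by (simp add: kirchhoff_def vd)
qed

section \<open>Assembly of the convergence statement\<close>

lemma potentials_pot:
  assumes "Q \<in> potentials" shows "pot (\<lambda>t. \<alpha> * Q n t)"
proof -
  have "smooth_on {0..} (Q n)" and cl: "closure {t. 0 \<le> t \<and> Q n t \<noteq> 0} = {0..1}"
    using assms by (auto simp: potentials_def)
  then obtain D where "D 0 = Q n" "\<And>t. t \<in> {0..} \<Longrightarrow> (D 0 has_vector_derivative D (Suc 0) t) (at t within {0..})"
    unfolding smooth_on_def by blast
  then have c: "continuous_on {0..} (Q n)" by (intro continuous_on_vector_derivative[of _ _ "D (Suc 0)"]) simp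
  have gt: "Q n t = 0" if "1 < t" for t
  proof (rule ccontr)
    assume "Q n t \<noteq> 0"
    then have "t \<in> closure {t. 0 \<le> t \<and> Q n t \<noteq> 0}" using that by (intro subsetD[OF closure_subset]) auto
    then show False using cl that by simp
  qed
  \<comment> \<open>The support condition alone leaves the value at its boundary point open;
    continuity from the right settles it.\<close>
  have "Q n 1 = 0"
  proof -
    have "(Q n \<longlongrightarrow> Q n 1) (at_right 1)"
      using continuous_on_subset[OF c, of "{1..}"] by (auto simp: continuous_on_def at_within_Ici_at_right[symmetric])
    moreover have "(Q n \<longlongrightarrow> 0) (at_right 1)"
      by (rule tendsto_eventually) (auto simp: eventually_at_filter gt)
    ultimately show ?thesis by (rule tendsto_unique[rotated]) simp
  qed
  then have "Q n t = 0" if "1 \<le> t" for t using gt[of t] that by (cases "t = 1") auto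
  then show ?thesis using c by (auto simp: pot_def intro!: continuous_intros)
qed

theorem theorem1:
  fixes \<alpha> :: real and Q :: "real star_fun" and \<phi> \<psi> :: "complex star_fun"
  assumes "Q \<in> potentials"
    and "simple_eigenvalue \<alpha> Q \<Longrightarrow> eigenfunction \<alpha> Q \<phi>"
    and "double_eigenvalue \<alpha> Q \<Longrightarrow> eigenbasis \<alpha> Q \<phi> \<psi>"
  shows "norm_resolvent_converges (H_eps \<alpha> Q) (H_lim \<alpha> Q \<phi> \<psi>) (at_right 0)
    \<and> (\<forall>\<zeta>::complex. \<zeta> \<notin> \<real> \<longrightarrow> (\<exists>C::real. \<forall>\<epsilon>\<in>{0<..<1}.
          \<zeta> \<in> resolvent_set (H_eps \<alpha> Q \<epsilon>) \<and> \<zeta> \<in> resolvent_set (H_lim \<alpha> Q \<phi> \<psi>) \<and>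
          onorm (\<lambda>G. resolvent (H_eps \<alpha> Q \<epsilon>) \<zeta> G - resolvent (H_lim \<alpha> Q \<phi> \<psi>) \<zeta> G)
            \<le> C * \<epsilon> powr (1/2)))"
proof -
  define q :: "real star_fun" where "q = (\<lambda>n t. \<alpha> * Q n t)"
  have q: "pot (q n)" for n unfolding q_def by (rule potentials_pot[OF assms(1)])
  have cq: "continuous_on {0..1} (q n)" for n
    using q[of n] by (auto simp: pot_def elim: continuous_on_subset)
  have "\<forall>n. \<exists>y y1. ode_pair (q n) y y1 \<and> y 1 = A \<and> y1 1 = B" for A B using ode_pair_exists[OF cq] by metis
  note ex = this
  \<comment> \<open>Neumann and Dirichlet data at the outer end, as required by
    \<open>star_fundamental\<close>.\<close>
  obtain c c1 where c: "\<And>n. ode_pair (q n) (c n) (c1 n)" "\<And>n. c n 1 = 1" "\<And>n. c1 n 1 = 0" using ex[of 1 0] by metis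
  obtain s s1 where s: "\<And>n. ode_pair (q n) (s n) (s1 n)" "\<And>n. s n 1 = 0" "\<And>n. s1 n 1 = 1" using ex[of 0 1] by metis
  interpret star_resonance q c c1 s s1 \<alpha> Q by unfold_locales (simp_all add: q c s, simp add: q_def)
  have He: "H_eps \<alpha> Q \<epsilon> = schroedinger_op (scaled \<epsilon>) kirchhoff" for \<epsilon> by (simp add: H_eps_def scaled_def q_eq)
  have pz: "pot (\<lambda>t. 0)" by (simp add: pot_def)
  have Im: "Im \<zeta> \<noteq> 0" if "\<zeta> \<notin> \<real>" for \<zeta> using that by (simp add: complex_is_Real_iff)
  have limc: "vertex_condition_of end_space (limit_condition \<alpha> Q \<phi> \<psi>)"
    by (rule vertex_condition_limit) (use assms(2,3) in blast)+
  have pzn: "\<And>n::3. pot ((\<lambda>n t. 0) n)" using pz by simp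
  note RL = schroedinger_op_resolvent[where V="\<lambda>n t. 0", OF pzn _ complex_subspace_end limc, folded H_lim_def]
  have main: "\<exists>C. \<forall>\<epsilon>\<in>{0<..<1}. \<zeta> \<in> resolvent_set (H_eps \<alpha> Q \<epsilon>) \<and> \<zeta> \<in> resolvent_set (H_lim \<alpha> Q \<phi> \<psi>) \<and>
          onorm (\<lambda>G. resolvent (H_eps \<alpha> Q \<epsilon>) \<zeta> G - resolvent (H_lim \<alpha> Q \<phi> \<psi>) \<zeta> G) \<le> C * \<epsilon> powr (1/2)"
    if \<zeta>: "\<zeta> \<notin> \<real>" for \<zeta>
  proof -
    obtain \<epsilon>0 C where C: "0 < \<epsilon>0" "0 \<le> C"
      "\<forall>\<epsilon> g f f1 v v1. 0 < \<epsilon> \<and> \<epsilon> \<le> \<epsilon>0 \<and> \<epsilon> \<le> 1 \<and> (\<forall>n. g n \<in> L2_half) \<and>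
        star_sol (scaled \<epsilon>) kirchhoff_space \<zeta> g f f1 \<and> star_sol (\<lambda>n t. 0) end_space \<zeta> g v v1 \<longrightarrow>
        norm (abs_star_L2 f - abs_star_L2 v) \<le> C * sqrt \<epsilon> * norm (abs_star_L2 g)"
      using small_parameter_estimate[OF Im[OF \<zeta>]] by (elim exE conjE) (rule that)
    \<comment> \<open>For \<epsilon> > \<epsilon>0 the difference of the resolvents is at most 2 /
      |Im \<zeta>|, and the second summand times sqrt \<epsilon> exceeds this.\<close>
    define C' where "C' = C + 2 / (\<bar>Im \<zeta>\<bar> * sqrt \<epsilon>0)"
    have I0: "0 < \<bar>Im \<zeta>\<bar>" using Im[OF \<zeta>] by simp
    have C': "C \<le> C'" "2 / (\<bar>Im \<zeta>\<bar> * sqrt \<epsilon>0) \<le> C'" "0 \<le> C'" using C I0 by (simp_all add: C'_def)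
    show ?thesis
    proof (intro exI[of _ C'] ballI conjI)
      fix \<epsilon> :: real assume e: "\<epsilon> \<in> {0<..<1}"
      have ps: "\<And>n. pot (scaled \<epsilon> n)" using e by (intro pot_scaled) auto
      note RE = schroedinger_op_resolvent[where V="scaled \<epsilon>", OF ps Im[OF \<zeta>] complex_subspace_kirchhoff
          vertex_condition_kirchhoff, folded He]
      show "\<zeta> \<in> resolvent_set (H_eps \<alpha> Q \<epsilon>)" by (rule RE(3))
      show "\<zeta> \<in> resolvent_set (H_lim \<alpha> Q \<phi> \<psi>)" by (rule RL(3)[OF Im[OF \<zeta>]])
      show "onorm (\<lambda>G. resolvent (H_eps \<alpha> Q \<epsilon>) \<zeta> G - resolvent (H_lim \<alpha> Q \<phi> \<psi>) \<zeta> G) \<le> C' * \<epsilon> powr (1/2)"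
      proof (rule onorm_bound)
        show "0 \<le> C' * \<epsilon> powr (1/2)" using C' by simp
        fix G
        have sq: "\<epsilon> powr (1/2) = sqrt \<epsilon>" using e by (simp add: powr_half_sqrt)
        show "norm (resolvent (H_eps \<alpha> Q \<epsilon>) \<zeta> G - resolvent (H_lim \<alpha> Q \<phi> \<psi>) \<zeta> G) \<le> C' * \<epsilon> powr (1/2) * norm G"
        proof (cases "\<epsilon> \<le> \<epsilon>0")
          case True
          obtain g where g: "G = abs_star_L2 g" "\<And>n. g n \<in> L2_half" using star_L2_repE by blast
          obtain f f1 where f: "star_sol (scaled \<epsilon>) kirchhoff_space \<zeta> g f f1"
            using star_sol_exists[where V="scaled \<epsilon>" and g=g, OF ps Im[OF \<zeta>] complex_subspace_kirchhoff g(2)] by blast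
          obtain v v1 where v: "star_sol (\<lambda>n t. 0) end_space \<zeta> g v v1"
            using star_sol_exists[where V="\<lambda>n t. 0" and g=g, OF pzn Im[OF \<zeta>] complex_subspace_end g(2)] by blast
          have "norm (resolvent (H_eps \<alpha> Q \<epsilon>) \<zeta> G - resolvent (H_lim \<alpha> Q \<phi> \<psi>) \<zeta> G) \<le> C * sqrt \<epsilon> * norm G"
            unfolding g(1) RE(1)[OF g(2) f] RL(1)[OF Im[OF \<zeta>] g(2) v]
            by (rule C(3)[rule_format]) (use e True g(2) f v in auto)
          also have "\<dots> \<le> C' * sqrt \<epsilon> * norm G" using C'(1) e by (intro mult_right_mono) auto
          finally show ?thesis by (simp add: sq)
        next
          case False
          have "norm (resolvent (H_eps \<alpha> Q \<epsilon>) \<zeta> G - resolvent (H_lim \<alpha> Q \<phi> \<psi>) \<zeta> G) \<le> norm G / \<bar>Im \<zeta>\<bar> + norm G / \<bar>Im \<zeta>\<bar>"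
            by (rule order_trans[OF norm_triangle_ineq4 add_mono[OF RE(2) RL(2)[OF Im[OF \<zeta>]]]])
          also have "\<dots> = 2 / (\<bar>Im \<zeta>\<bar> * sqrt \<epsilon>0) * sqrt \<epsilon>0 * norm G" using C(1) by simp
          also have "\<dots> \<le> C' * sqrt \<epsilon> * norm G"
            using C' False C(1) by (intro mult_right_mono mult_mono) auto
          finally show ?thesis by (simp add: sq)
        qed
      qed
    qed
  qed
  have "norm_resolvent_converges (H_eps \<alpha> Q) (H_lim \<alpha> Q \<phi> \<psi>) (at_right 0)"
    unfolding norm_resolvent_converges_def
  proof (intro allI impI)
    fix \<zeta> :: complex assume \<zeta>: "\<zeta> \<notin> \<real>"
    let ?d = "\<lambda>\<epsilon>. onorm (\<lambda>G. resolvent (H_eps \<alpha> Q \<epsilon>) \<zeta> G - resolvent (H_lim \<alpha> Q \<phi> \<psi>) \<zeta> G)"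
    obtain C where C: "\<And>\<epsilon>. \<epsilon> \<in> {0<..<1} \<Longrightarrow> \<zeta> \<in> resolvent_set (H_eps \<alpha> Q \<epsilon>)"
      "\<And>\<epsilon>. \<epsilon> \<in> {0<..<1} \<Longrightarrow> ?d \<epsilon> \<le> C * \<epsilon> powr (1/2)" using main[OF \<zeta>] by blast
    have L: "\<zeta> \<in> resolvent_set (H_lim \<alpha> Q \<phi> \<psi>)" by (rule RL(3)[OF Im[OF \<zeta>]])
    have ev: "\<forall>\<^sub>F \<epsilon> in at_right 0. \<epsilon> \<in> {0<..<1::real}" by (rule eventually_at_right_real) simp
    have "(?d \<longlongrightarrow> 0) (at_right 0)"
    proof (rule tendsto_sandwich[where f="\<lambda>_. 0" and h="\<lambda>\<epsilon>. C * sqrt \<epsilon>"])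
      show "\<forall>\<^sub>F \<epsilon> in at_right 0. 0 \<le> ?d \<epsilon>"
        using ev
      proof (rule eventually_mono)
        fix \<epsilon> :: real assume "\<epsilon> \<in> {0<..<1}"
        then have "bounded_linear (\<lambda>G. resolvent (H_eps \<alpha> Q \<epsilon>) \<zeta> G - resolvent (H_lim \<alpha> Q \<phi> \<psi>) \<zeta> G)"
          using C(1) L by (intro bounded_linear_sub) (auto simp: resolvent_set_def)
        then show "0 \<le> ?d \<epsilon>" by (rule onorm_pos_le)
      qed
      show "\<forall>\<^sub>F \<epsilon> in at_right 0. ?d \<epsilon> \<le> C * sqrt \<epsilon>"
        using ev by (rule eventually_mono) (use C(2) in \<open>auto simp: powr_half_sqrt\<close>)
      have "((\<lambda>\<epsilon>. C * sqrt \<epsilon>) \<longlongrightarrow> C * sqrt 0) (at_right 0)" by (intro tendsto_intros)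
      then show "((\<lambda>\<epsilon>. C * sqrt \<epsilon>) \<longlongrightarrow> 0) (at_right 0)" by simp
    qed simp
    then show "\<zeta> \<in> resolvent_set (H_lim \<alpha> Q \<phi> \<psi>) \<and> (\<forall>\<^sub>F \<epsilon> in at_right 0. \<zeta> \<in> resolvent_set (H_eps \<alpha> Q \<epsilon>)) \<and>
        (?d \<longlongrightarrow> 0) (at_right 0)"
      using L ev C(1) by (auto elim: eventually_mono)
  qed
  with main show ?thesis by blast
qed

end
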